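(* Let $m\ge2$ be even, $\kappa\in\mathbb{C}^\times$, and set $q_i=\exp(\kappa k_i\pi\sqrt{-1})$ and $l_i=\exp(\kappa\alpha_i\pi\sqrt{-1})/q_i$ for $i=0,1$. For generic $k_0,k_1,\alpha_0,\alpha_1\in\mathbb{C}$: (1) $(T_{LK}(\sigma_i)-l_i^{-1})(T_{LK}(\sigma_i)-q_i)(T_{LK}(\sigma_i)+q_i^{-1})=0$ for $i=0,1$; (2) $e_i=\frac{l_i}{q_i^{-1}-q_i}(T_{LK}(\sigma_i)-q_i)(T_{LK}(\sigma_i)+q_i^{-1})$ is a projector, meaning $\operatorname{rank}e_i=1$, for $i=0,1$.
   Context: $D_m$ is the dihedral group of order $2m$ acting on $\mathbb{R}^2$ and on its complexification $\mathbb{C}^2$. For $0\le i\le m-1$ let $H_i$ be the line through $0$ making angle $i\pi/m$ (anticlockwise) with the $x$-axis (and also its complexification), $s_i$ the reflection in $H_i$, $f_i$ a linear form on $\mathbb{C}^2$ with kernel $H_i$, $\omega_i=df_i/f_i$, and $M_m=\mathbb{C}^2\setminus\bigcup_i H_i$. Write $w(H_i)=H_{w(i)}$. The Artin group is $A_{D_m}=\pi_1(M_m/D_m)=\langle\sigma_0,\sigma_1\mid\sigma_0\sigma_1\cdots=\sigma_1\sigma_0\cdots\ (m\text{ factors})\rangle$; the base point is the image of a point $p$ in the open real sector between $H_0$ and $H_1$, and $\sigma_i$ is the class of the image of the path which follows the segment from $p$ to $s_i(p)$ except that near $H_i$ it follows the small half circle $t\mapsto p_i'-(1-e^{\pi\sqrt{-1}t})\frac{\langle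 p_i',a_i\rangle}{\langle a_i,a_i\rangle}a_i$, $t\in[0,1]$, where $a_i=s_i(p)-p$ and $p_i'$ is the point of the segment slightly before it meets $H_i$. Let $V$ be the complex vector space with basis $v_0,\dots,v_{m-1}$ and $\iota(w)v_i=v_{w(i)}$. For $0\le i\le m-1$ put $(k_i,\alpha_i)=(k_0,\alpha_0)$ if $i$ is even and $(k_i,\alpha_i)=(k_1,\alpha_1)$ if $i$ is odd, and define $p_i\in\mathrm{End}(V)$ by $p_i(v_i)=\alpha_iv_i$, $p_i(v_j)=\big(\sum_{t:\,s_t(H_j)=H_i}k_t\big)v_i$ for $j\neq i$ (so $p_i(v_j)=0$ if $i-j$ is odd). The connection $\Omega_m=\kappa\sum_{i=0}^{m-1}(k_i\iota(s_i)-p_i)\omega_i$ on $M_m\times V$ is flat and $D_m$-invariant, so it induces a flat connection on the quotient bundle $(M_m\times V)/D_m$ over $M_m/D_m$; $T_{LK}:A_{D_m}\to GL(V)$ is its monodromy representation (flat sections satisfy $dF=\Omega_mF$, so that for generic parameters $T_{LK}(\sigma_i)$ is conjugate to $\iota(s_i)\exp(\pi\sqrt{-1}\kappa(k_i\iota(s_i)-p_i))$). In this paper "projector" means an operator with one-dimensional image. "Generic" means outside a proper closed complex-analytic subset of the parameter space. *)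

theory Defs
  imports "HOL-Analysis.Analysis" "Jordan_Normal_Form.DL_Rank"
begin

no_notation Matrix.vec_index (infixl "$" 100)
no_notation Matrix.scalar_prod (infix "\<bullet>" 70)

section \<open>The dihedral arrangement\<close>

text \<open>The plane is \<^typ>\<open>real^2\<close>, its complexification is \<^typ>\<open>complex^2\<close>; elements of the
  dihedral group are real matrices, acting on both.\<close>

definition cplx :: "real^2 \<Rightarrow> complex^2" where
  "cplx x = (\<chi> i. complex_of_real (x $ i))"

definition cact :: "real^2^2 \<Rightarrow> complex^2 \<Rightarrow> complex^2" where
  "cact w z = (\<chi> i j. complex_of_real (w $ i $ j)) *v z"

definition angle :: "nat \<Rightarrow> nat \<Rightarrow> real" where
  "angle m i = real i * pi / real m"

definition mirror :: "nat \<Rightarrow> nat \<Rightarrow> (complex^2) set" where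
  "mirror m i = {c *s cplx (vector [cos (angle m i), sin (angle m i)]) | c. True}"

definition refl :: "nat \<Rightarrow> nat \<Rightarrow> real^2^2" where
  "refl m i = vector [vector [cos (2 * angle m i),   sin (2 * angle m i)],
                      vector [sin (2 * angle m i), - cos (2 * angle m i)]]"

definition rot :: "nat \<Rightarrow> nat \<Rightarrow> real^2^2" where
  "rot m j = vector [vector [cos (2 * angle m j), - sin (2 * angle m j)],
                     vector [sin (2 * angle m j),   cos (2 * angle m j)]]"

definition dihedral :: "nat \<Rightarrow> (real^2^2) set" where
  "dihedral m = rot m ` {..<m} \<union> refl m ` {..<m}"

definition arr_compl :: "nat \<Rightarrow> (complex^2) set" where
  "arr_compl m = UNIV - (\<Union>i<m. mirror m i)"

definition form :: "nat \<Rightarrow> nat \<Rightarrow> complex^2 \<Rightarrow> complex" where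
  "form m i z = of_real (sin (angle m i)) * z $ 1 - of_real (cos (angle m i)) * z $ 2"

lemma mirror_eq_kernel: "mirror m i = {z. form m i z = 0}"
proof (intro equalityI subsetI)
  fix z assume "z \<in> mirror m i"
  then show "z \<in> {z. form m i z = 0}"
    by (auto simp: mirror_def form_def cplx_def)
next
  fix z assume "z \<in> {z. form m i z = 0}"
  then have z: "of_real (sin (angle m i)) * z $ 1 = of_real (cos (angle m i)) * z $ 2"
    by (simp add: form_def)
  define co si :: complex where "co = of_real (cos (angle m i))" and "si = of_real (sin (angle m i))"
  have one: "co * co + si * si = 1"
    by (metis co_def si_def of_real_1 of_real_add of_real_mult power2_eq_square sin_cos_squared_add2)
  have z': "si * z $ 1 = co * z $ 2"
    using z by (simp add: co_def si_def)
  define c where "c = co * z $ 1 + si * z $ 2"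
  have "c * co = (co * co + si * si) * z $ 1 + si * (co * z $ 2 - si * z $ 1)"
    by (simp add: c_def algebra_simps)
  moreover have "c * si = (co * co + si * si) * z $ 2 + co * (si * z $ 1 - co * z $ 2)"
    by (simp add: c_def algebra_simps)
  ultimately have "z = c *s cplx (vector [cos (angle m i), sin (angle m i)])"
    using one z' by (simp add: Finite_Cartesian_Product.vec_eq_iff forall_2 cplx_def co_def si_def)
  then show "z \<in> mirror m i"
    by (auto simp: mirror_def)
qed

text \<open>The value of the form \<open>\<omega>\<^sub>i = df\<^sub>i/f\<^sub>i\<close> at the point \<open>z\<close> on the tangent vector \<open>u\<close>.\<close>

definition omega :: "nat \<Rightarrow> nat \<Rightarrow> complex^2 \<Rightarrow> complex^2 \<Rightarrow> complex" where
  "omega m i z u = form m i u / form m i z"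

text \<open>The index \<open>w(i)\<close> with \<open>w(H\<^sub>i) = H\<^bsub>w(i)\<^esub>\<close>.\<close>

definition act_idx :: "nat \<Rightarrow> real^2^2 \<Rightarrow> nat \<Rightarrow> nat" where
  "act_idx m w i = (THE j. j < m \<and> cact w ` mirror m i = mirror m j)"

section \<open>The connection\<close>

text \<open>\<open>V\<close> is \<^term>\<open>carrier_vec m :: complex Matrix.vec set\<close> with basis \<^term>\<open>unit_vec m i\<close>,
  and endomorphisms of \<open>V\<close> are \<open>m \<times> m\<close> matrices acting on columns. The parameters are sequences
  \<open>k, \<alpha>\<close> indexed by the mirrors.\<close>

definition iota :: "nat \<Rightarrow> real^2^2 \<Rightarrow> complex mat" where
  "iota m w = Matrix.mat m m (\<lambda>(r, c). if r = act_idx m w c then 1 else 0)"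

definition pmat :: "nat \<Rightarrow> (nat \<Rightarrow> complex) \<Rightarrow> (nat \<Rightarrow> complex) \<Rightarrow> nat \<Rightarrow> complex mat" where
  "pmat m k \<alpha> i = Matrix.mat m m (\<lambda>(r, c).
     if r \<noteq> i then 0
     else if c = i then \<alpha> i
     else (\<Sum>t\<in>{t. t < m \<and> cact (refl m t) ` mirror m c = mirror m i}. k t))"

definition lk_form ::
  "nat \<Rightarrow> complex \<Rightarrow> (nat \<Rightarrow> complex) \<Rightarrow> (nat \<Rightarrow> complex) \<Rightarrow> complex^2 \<Rightarrow> complex^2 \<Rightarrow> complex mat" where
  "lk_form m \<kappa> k \<alpha> z u = Matrix.mat m m (\<lambda>(r, c).
     \<kappa> * (\<Sum>i<m. (k i \<cdot>\<^sub>m iota m (refl m i) - pmat m k \<alpha> i) $$ (r, c) * omega m i z u))"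

text \<open>\<open>F\<close> is a flat section along the piecewise smooth path \<open>\<gamma>\<close> in \<open>M\<^sub>m\<close>: a continuous solution of
  \<open>dF = \<Omega> F\<close> pulled back along \<open>\<gamma>\<close>, finitely many corners being excepted.\<close>

definition flat_along ::
  "nat \<Rightarrow> complex \<Rightarrow> (nat \<Rightarrow> complex) \<Rightarrow> (nat \<Rightarrow> complex) \<Rightarrow> (real \<Rightarrow> complex^2)
    \<Rightarrow> (real \<Rightarrow> complex Matrix.vec) \<Rightarrow> bool" where
  "flat_along m \<kappa> k \<alpha> \<gamma> F \<longleftrightarrow>
     path_image \<gamma> \<subseteq> arr_compl m \<and>
     (\<forall>t\<in>{0..1}. F t \<in> carrier_vec m) \<and>
     (\<forall>j<m. continuous_on {0..1} (\<lambda>t. vec_index (F t) j)) \<and>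
     (\<exists>S. finite S \<and> (\<forall>t\<in>{0..1} - S. \<exists>u.
        (\<gamma> has_vector_derivative u) (at t within {0..1}) \<and>
        (\<forall>j<m. ((\<lambda>s. vec_index (F s) j) has_vector_derivative
                  vec_index (lk_form m \<kappa> k \<alpha> (\<gamma> t) u *\<^sub>v F t) j) (at t within {0..1}))))"

section \<open>Monodromy of the quotient bundle\<close>

text \<open>The point of \<open>(M\<^sub>m \<times> V)/D\<^sub>m\<close> represented by \<open>(x, v)\<close>, as an orbit.\<close>

definition bundle_pt ::
  "nat \<Rightarrow> complex^2 \<Rightarrow> complex Matrix.vec \<Rightarrow> ((complex^2) \<times> complex Matrix.vec) set" where
  "bundle_pt m x v = {(cact w x, iota m w *\<^sub>v v) | w. w \<in> dihedral m}"

text \<open>A loop in \<open>M\<^sub>m/D\<^sub>m\<close> based at the image of \<open>p\<close> is given by its lift \<open>\<gamma>\<close> starting at \<open>p\<close> (and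
  ending in the orbit of \<open>p\<close>). Flat sections of the quotient bundle along the loop are the images of
  flat sections \<open>F\<close> along \<open>\<gamma>\<close>, and \<open>V\<close> is identified with the fibre over the base point by
  \<^term>\<open>bundle_pt m p\<close>. If \<open>\<gamma>\<close> ends at \<open>w(p)\<close>, the monodromy is thus \<open>\<iota>(w)\<^sup>-\<^sup>1\<close> after parallel transport
  along \<open>\<gamma>\<close>.\<close>

definition lk_monodromy ::
  "nat \<Rightarrow> complex \<Rightarrow> (nat \<Rightarrow> complex) \<Rightarrow> (nat \<Rightarrow> complex) \<Rightarrow> (real \<Rightarrow> complex^2) \<Rightarrow> complex mat" where
  "lk_monodromy m \<kappa> k \<alpha> \<gamma> = (THE T. T \<in> carrier_mat m m \<and>
     (\<forall>F. flat_along m \<kappa> k \<alpha> \<gamma> F \<longrightarrow>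
        bundle_pt m (pathstart \<gamma>) (T *\<^sub>v F 0) = bundle_pt m (pathfinish \<gamma>) (F 1)))"

definition sector :: "nat \<Rightarrow> (real^2) set" where
  "sector m = {vector [r * cos \<theta>, r * sin \<theta>] | r \<theta>. 0 < r \<and> 0 < \<theta> \<and> \<theta> < pi / real m}"

text \<open>The lift of \<open>\<sigma>\<^sub>i\<close> to \<open>M\<^sub>m\<close>. Here \<open>p' = p + \<tau> a\<close> with \<open>0 < \<tau> < 1/2\<close> is the point at which the
  segment is left; the segment meets \<open>H\<^sub>i\<close> at parameter \<open>1/2\<close>, and the half circle ends at \<open>s\<^sub>i(p')\<close>.\<close>

definition sigma_path :: "nat \<Rightarrow> real^2 \<Rightarrow> real \<Rightarrow> nat \<Rightarrow> real \<Rightarrow> complex^2" where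
  "sigma_path m p \<tau> i =
    (let q = refl m i *v p;
         a = q - p;
         p' = p + \<tau> *\<^sub>R a;
         arc = (\<lambda>t. cplx p' - ((1 - exp (of_real pi * \<i> * of_real t)) *
                                of_real (inner p' a / inner a a)) *s cplx a)
     in linepath (cplx p) (cplx p') +++ arc +++ linepath (cplx (refl m i *v p')) (cplx q))"

section \<open>Generic parameters\<close>

definition holo_on :: "(complex^'n) set \<Rightarrow> (complex^'n \<Rightarrow> complex) \<Rightarrow> bool" where
  "holo_on U f \<longleftrightarrow> (\<forall>x\<in>U. \<exists>f'. (f has_derivative f') (at x) \<and> (\<forall>c v. f' (c *s v) = c * f' v))"

definition closed_analytic :: "(complex^'n) set \<Rightarrow> bool" where
  "closed_analytic Z \<longleftrightarrow> closed Z \<and>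
     (\<forall>x. \<exists>U Fs. open U \<and> x \<in> U \<and> finite Fs \<and> (\<forall>f\<in>Fs. holo_on U f) \<and>
        Z \<inter> U = {y \<in> U. \<forall>f\<in>Fs. f y = 0})"

definition generically :: "(complex^'n \<Rightarrow> bool) \<Rightarrow> bool" where
  "generically P \<longleftrightarrow> (\<exists>Z. closed_analytic Z \<and> Z \<noteq> UNIV \<and> (\<forall>x. x \<notin> Z \<longrightarrow> P x))"

definition by_parity :: "'a \<Rightarrow> 'a \<Rightarrow> nat \<Rightarrow> 'a" where
  "by_parity a b i = (if even i then a else b)"

end

theory Submission
  imports Defs
begin

text \<open>
  The whole loop is visible on one complex line. The path lifting \<open>\<sigma>\<^sub>i\<close> runs inside the line through
  \<open>p\<close> and \<open>s\<^sub>i(p)\<close>; write its points as \<open>h + c a\<close> with \<open>a = s\<^sub>i(p) - p\<close> and \<open>h\<close> the midpoint, which lies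
  on \<open>H\<^sub>i\<close>. The path goes from \<open>c = -1/2\<close> to \<open>c = 1/2\<close> along the real axis, avoiding \<open>0\<close> by a half circle
  in the lower half plane, and \<open>s\<^sub>i\<close> acts by \<open>c \<mapsto> -c\<close>. On this line the connection is the Fuchsian system
  \<open>F' = (A\<^sub>i / c + (\<Sum>j\<noteq>i. A\<^sub>j g\<^sub>j / (1 + g\<^sub>j c))) F\<close> with \<open>A\<^sub>j = \<kappa> (k\<^sub>j \<iota>(s\<^sub>j) - p\<^sub>j)\<close>, where \<open>g\<^sub>j\<close> is the
  quotient of the values of \<open>f\<^sub>j\<close> at \<open>a\<close> and at \<open>h\<close>. Since the segment crosses no mirror except
  \<open>H\<^sub>i\<close>, \<open>\<bar>g\<^sub>j\<bar> < 2\<close> (\<open>segment_geometry\<close>), so \<open>0\<close> is the only pole in some disc of radius greater than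
  \<open>1/2\<close>. On the line, parallel transport is the solution of an ordinary differential equation.

  The residue \<open>A\<^sub>i\<close> commutes with \<open>S = \<iota>(s\<^sub>i)\<close>, and the two have a common eigenbasis
  (\<open>lk_residue_diagonalizable\<close>): \<open>A\<^sub>i\<close> is \<open>-\<kappa> k\<^sub>i\<close> where \<open>S = -1\<close>, and where \<open>S = 1\<close> it is \<open>\<kappa> k\<^sub>i\<close> except
  on the line spanned by \<open>v\<^sub>i\<close>, where it is \<open>\<kappa> (k\<^sub>i - \<alpha>\<^sub>i)\<close>. For generic parameters no two eigenvalues
  differ by a nonzero integer, so the method of Frobenius gives a solution \<open>H(c) c\<^bsup>A\<^esup>\<close>, \<open>A = A\<^sub>i\<close>, with \<open>H\<close>
  holomorphic in the disc and \<open>H(0) = 1\<close>. The matrix \<open>H\<close> is unique, and the system is invariant under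
  \<open>c \<mapsto> -c\<close> combined with \<open>S\<close>, because \<open>S A\<^sub>j S\<close> is the residue at \<open>s\<^sub>i(H\<^sub>j)\<close>; hence \<open>S H(c) S = H(-c)\<close>.
  Going along the half circle multiplies \<open>c\<^bsup>A\<^esup>\<close> by \<open>exp(\<pi> \<i> A)\<close>, so that
  \<open>T(\<sigma>\<^sub>i) = S H(1/2) exp(\<pi> \<i> A) H(-1/2)\<^bsup>-1\<^esup> = H(-1/2) S exp(\<pi> \<i> A) H(-1/2)\<^bsup>-1\<^esup>\<close>
  (\<open>reflection_symmetric_half_monodromy\<close>, \<open>lk_monodromy_diagonalizable\<close>).

  Thus \<open>T(\<sigma>\<^sub>i)\<close> is diagonalizable, with eigenvalue \<open>l\<^sub>i\<^bsup>-1\<^esup>\<close> on one vector of an eigenbasis and \<open>q\<^sub>i\<close> or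
  \<open>-q\<^sub>i\<^bsup>-1\<^esup>\<close> on each of the others.
  This gives the cubic relation; moreover \<open>e\<^sub>i\<close> vanishes on all other eigenvectors and not on that one, provided
  that \<open>l\<^sub>i\<^bsup>-1\<^esup> \<noteq> q\<^sub>i\<close>, \<open>l\<^sub>i\<^bsup>-1\<^esup> \<noteq> -q\<^sub>i\<^bsup>-1\<^esup>\<close> and \<open>q\<^sub>i\<^sup>2 \<noteq> 1\<close>. All exceptional parameters are zeros of one entire
  function, a product of factors \<open>exp(2 \<pi> \<i> z) - 1\<close>.
\<close>

section \<open>Formal solutions at a regular singular point\<close>

text \<open>The coefficients of a Frobenius solution, rescaled by powers of the radius, satisfy such a
  convolution inequality. The factor \<open>\<epsilon> n\<close>, which comes from dividing by \<open>n - \<mu>\<^sub>r + \<mu>\<^sub>s\<close>, beats the geometric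
  sum from some index on, and from there the maximum of the earlier terms is not exceeded again.\<close>

lemma convolution_recursion_bounded:
  fixes a \<epsilon> :: "nat \<Rightarrow> real"
  assumes a: "\<And>n. 0 \<le> a n" and \<epsilon>: "\<epsilon> \<longlonglongrightarrow> 0" and \<epsilon>0: "\<And>n. 0 \<le> \<epsilon> n"
    and x: "0 \<le> x" "x < 1"
    and rec: "\<And>n. a (Suc n) \<le> \<epsilon> n * (\<Sum>j\<le>n. x ^ (n - j) * a j)"
  shows "\<exists>C. \<forall>n. a n \<le> C"
proof -
  obtain N where N: "\<And>n. n \<ge> N \<Longrightarrow> \<epsilon> n < 1 - x"
    using order_tendstoD(2)[OF \<epsilon>, of "1 - x"] x by (auto simp: eventually_sequentially)
  define C where "C = Max (a ` {..N})"
  have C: "a n \<le> C" if "n \<le> N" for n using that by (auto simp: C_def)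
  have C0: "0 \<le> C" using C[of 0] a[of 0] by simp
  have geom: "(\<Sum>j\<le>n. x ^ (n - j)) \<le> 1 / (1 - x)" for n
  proof -
    have "(\<Sum>j\<le>n. x ^ (n - j)) = (\<Sum>j\<le>n. x ^ j)"
      by (rule sum.reindex_bij_witness[of _ "\<lambda>j. n - j" "\<lambda>j. n - j"]) auto
    also have "\<dots> = (1 - x ^ Suc n) / (1 - x)" using x sum_gp0[of x n] by simp
    also have "\<dots> \<le> 1 / (1 - x)" using x by (intro divide_right_mono) auto
    finally show ?thesis .
  qed
  have "a n \<le> C" for n
  proof (induction n rule: less_induct)
    case (less n)
    show ?case
    proof (cases "n \<le> N")
      case True then show ?thesis by (rule C)
    next
      case False
      then obtain k where k: "n = Suc k" "k \<ge> N" by (cases n) auto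
      have "a n \<le> \<epsilon> k * (\<Sum>j\<le>k. x ^ (k - j) * a j)" using rec k by simp
      also have "\<dots> \<le> \<epsilon> k * (\<Sum>j\<le>k. x ^ (k - j) * C)"
        using less k x \<epsilon>0 by (intro mult_left_mono sum_mono) auto
      also have "\<dots> = \<epsilon> k * (\<Sum>j\<le>k. x ^ (k - j)) * C" by (simp add: sum_distrib_right)
      also have "\<dots> \<le> (1 - x) * (1 / (1 - x)) * C"
        using N[OF k(2)] \<epsilon>0 x C0 geom[of k]
        by (intro mult_right_mono mult_mono) (auto intro: sum_nonneg)
      finally show ?thesis using x by simp
    qed
  qed
  then show ?thesis by blast
qed

text \<open>These are the power series coefficients of the gauge transformation \<open>H\<close> with \<open>H(0) = 1\<close> that carries
  \<open>c F' = diag(\<mu>) F\<close> to \<open>c F' = (diag(\<mu>) + c R(c)) F\<close>. Comparing coefficients in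
  \<open>c H' = [diag(\<mu>), H] + c R H\<close> gives the recursion; with a diagonal residue the commutator acts on
  each entry by a scalar, so solving it is a division.\<close>

fun frob_coeff :: "nat \<Rightarrow> (nat \<Rightarrow> complex) \<Rightarrow> (nat \<Rightarrow> nat \<Rightarrow> complex fps) \<Rightarrow> nat \<Rightarrow> nat \<Rightarrow> nat \<Rightarrow> complex"
  where
  "frob_coeff m \<mu> R 0 r s = (if r = s then 1 else 0)"
| "frob_coeff m \<mu> R (Suc n) r s =
     (\<Sum>j\<le>n. \<Sum>u<m. fps_nth (R r u) (n - j) * frob_coeff m \<mu> R j u s) / (of_nat (Suc n) - \<mu> r + \<mu> s)"

definition frob :: "nat \<Rightarrow> (nat \<Rightarrow> complex) \<Rightarrow> (nat \<Rightarrow> nat \<Rightarrow> complex fps) \<Rightarrow> nat \<Rightarrow> nat \<Rightarrow> complex fps" where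
  "frob m \<mu> R r s = Abs_fps (\<lambda>n. frob_coeff m \<mu> R n r s)"

text \<open>The denominators \<open>n - \<mu>\<^sub>r + \<mu>\<^sub>s\<close> with \<open>n \<ge> 1\<close> do not vanish.\<close>

definition nonresonant :: "nat \<Rightarrow> (nat \<Rightarrow> complex) \<Rightarrow> bool" where
  "nonresonant m \<mu> \<longleftrightarrow> (\<forall>r<m. \<forall>s<m. \<forall>n. \<mu> r - \<mu> s \<noteq> of_nat (Suc n))"

lemma nonresonant_uminus: "nonresonant m \<mu> \<Longrightarrow> nonresonant m (\<lambda>r. - \<mu> r)"
  by (auto simp: nonresonant_def)

lemma frob_nth_0: "fps_nth (frob m \<mu> R r s) 0 = (if r = s then 1 else 0)"
  by (simp add: frob_def)

lemma frob_eq: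
  assumes "nonresonant m \<mu>" "r < m" "s < m"
  shows "fps_X * fps_deriv (frob m \<mu> R r s) =
    fps_const (\<mu> r - \<mu> s) * frob m \<mu> R r s + fps_X * (\<Sum>u<m. R r u * frob m \<mu> R u s)"
proof (rule fps_ext)
  fix n
  show "fps_nth (fps_X * fps_deriv (frob m \<mu> R r s)) n =
    fps_nth (fps_const (\<mu> r - \<mu> s) * frob m \<mu> R r s + fps_X * (\<Sum>u<m. R r u * frob m \<mu> R u s)) n"
  proof (cases n)
    case 0
    then show ?thesis by (simp add: frob_def)
  next
    case (Suc k)
    have nz: "of_nat (Suc k) - \<mu> r + \<mu> s \<noteq> 0"
    proof
      assume "of_nat (Suc k) - \<mu> r + \<mu> s = 0"
      then have "\<mu> r - \<mu> s = of_nat (Suc k)" by (simp add: algebra_simps)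
      then show False using assms unfolding nonresonant_def by blast
    qed
    define G where "G = (\<Sum>u<m. R r u * frob m \<mu> R u s)"
    have "fps_nth G k =
      (\<Sum>u<m. \<Sum>j\<le>k. fps_nth (R r u) (k - j) * frob_coeff m \<mu> R j u s)"
      unfolding G_def fps_sum_nth
    proof (intro sum.cong refl)
      fix u
      show "fps_nth (R r u * frob m \<mu> R u s) k = (\<Sum>j\<le>k. fps_nth (R r u) (k - j) * frob_coeff m \<mu> R j u s)"
        unfolding fps_mult_nth frob_def atLeast0AtMost
        by (rule sum.reindex_bij_witness[of _ "\<lambda>j. k - j" "\<lambda>j. k - j"]) auto
    qed
    also have "\<dots> = (of_nat (Suc k) - \<mu> r + \<mu> s) * frob_coeff m \<mu> R (Suc k) r s"
      using nz by (subst sum.swap) simp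
    finally show ?thesis using Suc
      by (fold G_def) (simp add: frob_def algebra_simps del: frob_coeff.simps)
  qed
qed

text \<open>The disc in which \<open>R\<close> is controlled is also a disc of convergence of the gauge transformation: after scaling by
  any \<open>x < \<rho>\<close> the column sums of the coefficients satisfy the hypothesis of
  \<open>convolution_recursion_bounded\<close> with ratio \<open>x / \<rho>\<close>.\<close>

lemma frob_conv_radius:
  assumes \<rho>: "0 < \<rho>" and R: "\<And>r u n. r < m \<Longrightarrow> u < m \<Longrightarrow> norm (fps_nth (R r u) n) \<le> B / \<rho> ^ n"
    and rs: "r < m" "s < m"
  shows "fps_conv_radius (frob m \<mu> R r s) \<ge> ereal \<rho>"
proof -
  define h where "h n u = norm (frob_coeff m \<mu> R n u s)" for n u
  define \<delta> where "\<delta> n = (\<Sum>u<m. 1 / norm (of_nat (Suc n) - \<mu> u + \<mu> s))" for n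
  have B0: "0 \<le> B" using R[of r s 0] rs norm_ge_zero[of "fps_nth (R r s) 0"] by (simp del: norm_ge_zero)
  have \<delta>: "\<delta> \<longlonglongrightarrow> 0"
  proof -
    have "(\<lambda>n. 1 / norm (of_nat (Suc n) - \<mu> u + \<mu> s)) \<longlonglongrightarrow> 0" for u
    proof (rule tendsto_divide_0[OF tendsto_const])
      have 1: "filterlim (\<lambda>n. complex_of_nat (Suc n) + (\<mu> s - \<mu> u)) at_infinity sequentially"
        by (rule tendsto_add_filterlim_at_infinity'[OF _ tendsto_const])
          (rule filterlim_compose[OF tendsto_of_nat filterlim_Suc])
      have "(\<lambda>n. complex_of_nat (Suc n) + (\<mu> s - \<mu> u)) = (\<lambda>n. of_nat (Suc n) - \<mu> u + \<mu> s)"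
        by (auto simp: algebra_simps)
      with 1 show "filterlim (\<lambda>n. norm (of_nat (Suc n) - \<mu> u + \<mu> s)) at_infinity sequentially"
        by (metis filterlim_at_infinity_conv_norm_at_top filterlim_at_top_imp_at_infinity)
    qed
    then show ?thesis unfolding \<delta>_def by (intro tendsto_null_sum) auto
  qed
  have step: "(\<Sum>u<m. h (Suc n) u) \<le> \<delta> n * (\<Sum>j\<le>n. B / \<rho> ^ (n - j) * (\<Sum>u<m. h j u))" for n
  proof -
    have "h (Suc n) v \<le> 1 / norm (of_nat (Suc n) - \<mu> v + \<mu> s) * (\<Sum>j\<le>n. B / \<rho> ^ (n - j) * (\<Sum>u<m. h j u))"
      if "v < m" for v
    proof -
      have "norm (\<Sum>j\<le>n. \<Sum>u<m. fps_nth (R v u) (n - j) * frob_coeff m \<mu> R j u s)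
        \<le> (\<Sum>j\<le>n. \<Sum>u<m. norm (fps_nth (R v u) (n - j)) * h j u)"
        by (intro order.trans[OF norm_sum] sum_mono) (simp add: norm_mult h_def)
      also have "\<dots> \<le> (\<Sum>j\<le>n. \<Sum>u<m. B / \<rho> ^ (n - j) * h j u)"
        using R that by (intro sum_mono mult_right_mono) (auto simp: h_def)
      finally have "norm (\<Sum>j\<le>n. \<Sum>u<m. fps_nth (R v u) (n - j) * frob_coeff m \<mu> R j u s)
        \<le> (\<Sum>j\<le>n. B / \<rho> ^ (n - j) * (\<Sum>u<m. h j u))" by (simp add: sum_distrib_left)
      from divide_right_mono[OF this norm_ge_zero] show ?thesis
        by (simp add: h_def norm_divide del: of_nat_Suc)
    qed
    then show ?thesis unfolding \<delta>_def by (subst sum_distrib_right) (auto intro: sum_mono)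
  qed
  have bdd: "\<exists>C. \<forall>n. (\<Sum>u<m. h n u) * x ^ n \<le> C" if x: "0 < x" "x < \<rho>" for x
  proof (rule convolution_recursion_bounded[where \<epsilon> = "\<lambda>n. B * x * \<delta> n" and x = "x / \<rho>"])
    show "(\<lambda>n. B * x * \<delta> n) \<longlonglongrightarrow> 0" using tendsto_mult_right_zero[OF \<delta>] by simp
    fix n
    have "(\<Sum>u<m. h (Suc n) u) * x ^ Suc n \<le>
      \<delta> n * (\<Sum>j\<le>n. B / \<rho> ^ (n - j) * (\<Sum>u<m. h j u)) * x ^ Suc n"
      using step x by (intro mult_right_mono) auto
    also have "\<dots> = \<delta> n * (\<Sum>j\<le>n. B / \<rho> ^ (n - j) * (\<Sum>u<m. h j u) * x ^ Suc n)"
      by (simp add: sum_distrib_right mult.assoc)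
    also have "(\<Sum>j\<le>n. B / \<rho> ^ (n - j) * (\<Sum>u<m. h j u) * x ^ Suc n) =
      (\<Sum>j\<le>n. B * x * ((x / \<rho>) ^ (n - j) * ((\<Sum>u<m. h j u) * x ^ j)))"
    proof (intro sum.cong refl)
      fix j assume "j \<in> {..n}"
      then have "x ^ Suc n = x * x ^ (n - j) * x ^ j"
        by (simp flip: power_add)
      then show "B / \<rho> ^ (n - j) * (\<Sum>u<m. h j u) * x ^ Suc n =
         B * x * ((x / \<rho>) ^ (n - j) * ((\<Sum>u<m. h j u) * x ^ j))"
        using \<rho> by (simp only: power_divide times_divide_eq_left times_divide_eq_right mult_ac)
    qed
    also have "\<delta> n * \<dots> = B * x * \<delta> n * (\<Sum>j\<le>n. (x / \<rho>) ^ (n - j) * ((\<Sum>u<m. h j u) * x ^ j))"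
      by (simp add: sum_distrib_left mult_ac)
    finally show "(\<Sum>u<m. h (Suc n) u) * x ^ Suc n \<le>
      B * x * \<delta> n * (\<Sum>j\<le>n. (x / \<rho>) ^ (n - j) * ((\<Sum>u<m. h j u) * x ^ j))" .
  qed (use x \<rho> B0 in \<open>auto simp: \<delta>_def h_def intro!: mult_nonneg_nonneg sum_nonneg\<close>)
  show ?thesis unfolding fps_conv_radius_def
  proof (rule conv_radius_geI_ex')
    fix y :: real assume y: "0 < y" "ereal y < ereal \<rho>"
    define x where "x = (y + \<rho>) / 2"
    have x: "0 < x" "x < \<rho>" "y < x" using y by (auto simp: x_def)
    obtain C where C: "\<And>n. (\<Sum>u<m. h n u) * x ^ n \<le> C" using bdd[OF x(1,2)] by blast
    have le: "h n r \<le> (\<Sum>u<m. h n u)" for n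
      using rs by (intro member_le_sum) (auto simp: h_def)
    show "summable (\<lambda>n. fps_nth (frob m \<mu> R r s) n * of_real y ^ n)"
    proof (rule summable_comparison_test')
      show "summable (\<lambda>n. C * (y / x) ^ n)"
        using x y by (intro summable_mult summable_geometric) auto
      fix n
      have "norm (fps_nth (frob m \<mu> R r s) n * of_real y ^ n) = h n r * y ^ n"
        using y by (simp add: frob_def h_def norm_mult norm_power)
      also have "\<dots> = (h n r * x ^ n) * (y / x) ^ n" using x by (simp add: power_divide)
      also have "\<dots> \<le> C * (y / x) ^ n"
        using x y by (intro mult_right_mono order.trans[OF mult_right_mono[OF le] C]) auto
      finally show "norm (fps_nth (frob m \<mu> R r s) n * of_real y ^ n) \<le> C * (y / x) ^ n" .
    qed
  qed
qed

text \<open>The inverse of \<open>H\<close> satisfies \<open>c K' = [diag(\<mu>), K] - c K R\<close>. Transposing turns this into an equation of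
  the same shape as the one for \<open>H\<close>, with \<open>-\<mu>\<close> and the negative transpose of \<open>R\<close>, so that
  the construction and the convergence proof for \<open>H\<close> apply to \<open>K\<close>.\<close>

definition frob_inv :: "nat \<Rightarrow> (nat \<Rightarrow> complex) \<Rightarrow> (nat \<Rightarrow> nat \<Rightarrow> complex fps) \<Rightarrow> nat \<Rightarrow> nat \<Rightarrow> complex fps" where
  "frob_inv m \<mu> R r s = frob m (\<lambda>r. - \<mu> r) (\<lambda>r s. - R s r) s r"

lemma frob_inv_eq:
  assumes "nonresonant m \<mu>" "r < m" "s < m"
  shows "fps_X * fps_deriv (frob_inv m \<mu> R r s) =
    fps_const (\<mu> r - \<mu> s) * frob_inv m \<mu> R r s - fps_X * (\<Sum>u<m. frob_inv m \<mu> R r u * R u s)"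
proof -
  have "fps_X * fps_deriv (frob_inv m \<mu> R r s) =
    fps_const (\<mu> r - \<mu> s) * frob_inv m \<mu> R r s + fps_X * (\<Sum>u<m. - R u s * frob_inv m \<mu> R r u)"
    using frob_eq[OF nonresonant_uminus[OF assms(1)] assms(3,2), of "\<lambda>r s. - R s r"]
    by (simp add: frob_inv_def add.commute)
  then show ?thesis by (simp add: sum_negf mult.commute)
qed

text \<open>The product \<open>Z = K H\<close> satisfies \<open>c Z' = [diag(\<mu>), Z]\<close>, as the terms with \<open>R\<close> cancel. By
  nonresonance all coefficients of \<open>Z\<close> of positive degree vanish, and \<open>Z(0) = 1\<close>. With the inverse at hand,
  existence and uniqueness of transport both reduce to the product rule.\<close>

lemma frob_inv_mult_frob:
  assumes nr: "nonresonant m \<mu>" and rs: "r < m" "s < m"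
  shows "(\<Sum>u<m. frob_inv m \<mu> R r u * frob m \<mu> R u s) = (if r = s then 1 else 0)"
proof -
  define H where "H = frob m \<mu> R"
  define K where "K = frob_inv m \<mu> R"
  define Z where "Z = (\<Sum>u<m. K r u * H u s)"
  have "fps_X * fps_deriv Z = (\<Sum>u<m. (fps_X * fps_deriv (K r u)) * H u s + K r u * (fps_X * fps_deriv (H u s)))"
    by (simp add: Z_def fps_deriv_sum sum_distrib_left algebra_simps)
  also have "\<dots> = (\<Sum>u<m. fps_const (\<mu> r - \<mu> s) * (K r u * H u s)
      - fps_X * (\<Sum>v<m. K r v * R v u * H u s) + fps_X * (\<Sum>v<m. K r u * R u v * H v s))"
  proof (intro sum.cong refl)
    fix u assume "u \<in> {..<m}"
    then have u: "u < m" by simp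
    have "(fps_X * fps_deriv (K r u)) * H u s + K r u * (fps_X * fps_deriv (H u s)) =
      (fps_const (\<mu> r - \<mu> u) + fps_const (\<mu> u - \<mu> s)) * (K r u * H u s)
      - fps_X * ((\<Sum>v<m. K r v * R v u) * H u s) + fps_X * (K r u * (\<Sum>v<m. R u v * H v s))"
      unfolding H_def K_def frob_eq[OF nr u rs(2)] frob_inv_eq[OF nr rs(1) u]
      by (simp add: algebra_simps del: fps_const_sub fps_const_add)
    then show "(fps_X * fps_deriv (K r u)) * H u s + K r u * (fps_X * fps_deriv (H u s)) =
      fps_const (\<mu> r - \<mu> s) * (K r u * H u s)
      - fps_X * (\<Sum>v<m. K r v * R v u * H u s) + fps_X * (\<Sum>v<m. K r u * R u v * H v s)"
      by (simp add: sum_distrib_left sum_distrib_right mult.assoc)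
  qed
  also have "\<dots> = fps_const (\<mu> r - \<mu> s) * Z"
  proof -
    have "(\<Sum>u<m. \<Sum>v<m. K r v * R v u * H u s) = (\<Sum>u<m. \<Sum>v<m. K r u * R u v * H v s)"
      by (rule sum.swap)
    then show ?thesis by (simp add: sum.distrib sum_subtractf Z_def flip: sum_distrib_left)
  qed
  finally have eq: "fps_X * fps_deriv Z = fps_const (\<mu> r - \<mu> s) * Z" .
  have "fps_nth Z n = fps_nth (if r = s then 1 else 0) n" for n
  proof (cases n)
    case 0
    have "fps_nth Z 0 = (\<Sum>u<m. (if u = r then 1 else 0) * (if u = s then 1 else 0))"
      by (simp add: Z_def H_def K_def fps_sum_nth frob_nth_0 frob_inv_def)
    also have "\<dots> = (\<Sum>u<m. if u = r then (if r = s then 1 else 0) else 0)"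
      by (intro sum.cong) auto
    also have "\<dots> = (if r = s then 1 else 0)" using rs by simp
    finally show ?thesis using 0 by simp
  next
    case (Suc k)
    have "fps_nth (fps_X * fps_deriv Z) n = fps_nth (fps_const (\<mu> r - \<mu> s) * Z) n" using eq by simp
    then have "of_nat (Suc k) * fps_nth Z n = (\<mu> r - \<mu> s) * fps_nth Z n" using Suc by simp
    moreover have "of_nat (Suc k) \<noteq> \<mu> r - \<mu> s" using nr rs unfolding nonresonant_def by metis
    ultimately show ?thesis using Suc by simp
  qed
  then show ?thesis by (simp add: fps_eq_iff Z_def H_def K_def)
qed

text \<open>If the system is invariant under \<open>c \<mapsto> -c\<close> combined with conjugation by \<open>diag(sg)\<close>, then so is its unique
  normalized gauge transformation; this is the entrywise form of \<open>S H(-c) = H(c) S\<close>.\<close>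

lemma frob_coeff_parity:
  assumes sg: "\<And>r. r < m \<Longrightarrow> sg r * sg r = (1::complex)"
    and R: "\<And>r u n. r < m \<Longrightarrow> u < m \<Longrightarrow> sg r * fps_nth (R r u) n * sg u = (- 1) ^ Suc n * fps_nth (R r u) n"
    and "r < m" "s < m"
  shows "sg r * frob_coeff m \<mu> R n r s = (- 1) ^ n * frob_coeff m \<mu> R n r s * sg s"
  using \<open>r < m\<close>
proof (induction n arbitrary: r rule: less_induct)
  case (less n)
  show ?case
  proof (cases n)
    case 0
    then show ?thesis by simp
  next
    case (Suc k)
    have "sg r * (fps_nth (R r u) (k - j) * frob_coeff m \<mu> R j u s) =
      (- 1) ^ n * (fps_nth (R r u) (k - j) * frob_coeff m \<mu> R j u s) * sg s" if "u < m" "j \<le> k" for u j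
    proof -
      have "sg r * (fps_nth (R r u) (k - j) * frob_coeff m \<mu> R j u s) =
        (sg u * sg u) * (sg r * (fps_nth (R r u) (k - j) * frob_coeff m \<mu> R j u s))"
        using sg[OF that(1)] by simp
      also have "\<dots> = (sg r * fps_nth (R r u) (k - j) * sg u) * (sg u * frob_coeff m \<mu> R j u s)"
        by (simp only: mult_ac)
      also have "\<dots> = ((- 1) ^ Suc (k - j) * fps_nth (R r u) (k - j)) * ((- 1) ^ j * frob_coeff m \<mu> R j u s * sg s)"
        using R[OF less.prems that(1)] less.IH[of j u] that Suc by simp
      also have "\<dots> = (- 1) ^ (Suc (k - j) + j) * (fps_nth (R r u) (k - j) * frob_coeff m \<mu> R j u s) * sg s"
        by (simp only: power_add mult_ac)
      also have "Suc (k - j) + j = n" using that Suc by simp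
      finally show ?thesis .
    qed
    then have "sg r * (\<Sum>j\<le>k. \<Sum>u<m. fps_nth (R r u) (k - j) * frob_coeff m \<mu> R j u s) =
      (- 1) ^ n * (\<Sum>j\<le>k. \<Sum>u<m. fps_nth (R r u) (k - j) * frob_coeff m \<mu> R j u s) * sg s"
      unfolding sum_distrib_left sum_distrib_right by (intro sum.cong refl) auto
    then show ?thesis using Suc by (simp del: of_nat_Suc)
  qed
qed

lemma eval_frob_parity:
  assumes sg: "\<And>r. r < m \<Longrightarrow> sg r * sg r = (1::complex)"
    and R: "\<And>r u n. r < m \<Longrightarrow> u < m \<Longrightarrow> sg r * fps_nth (R r u) n * sg u = (- 1) ^ Suc n * fps_nth (R r u) n"
    and rs: "r < m" "s < m" and c: "ereal (norm c) < fps_conv_radius (frob m \<mu> R r s)"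
  shows "sg r * eval_fps (frob m \<mu> R r s) (- c) = eval_fps (frob m \<mu> R r s) c * sg s"
proof -
  have "sg r * eval_fps (frob m \<mu> R r s) (- c) = (\<Sum>n. sg r * (frob_coeff m \<mu> R n r s * (- c) ^ n))"
    using summable_fps[of "- c" "frob m \<mu> R r s"] c by (simp add: eval_fps_def suminf_mult frob_def)
  also have "\<dots> = (\<Sum>n. frob_coeff m \<mu> R n r s * c ^ n * sg s)"
  proof (rule suminf_cong)
    fix n
    have "sg r * (frob_coeff m \<mu> R n r s * (- c) ^ n) = (sg r * frob_coeff m \<mu> R n r s) * (- 1) ^ n * c ^ n"
      by (simp add: power_minus[of c])
    also have "sg r * frob_coeff m \<mu> R n r s = (- 1) ^ n * frob_coeff m \<mu> R n r s * sg s"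
      by (rule frob_coeff_parity[OF sg R rs])
    also have "(- 1) ^ n * frob_coeff m \<mu> R n r s * sg s * (- 1) ^ n * c ^ n =
      ((- 1) ^ n * (- 1) ^ n) * (frob_coeff m \<mu> R n r s * c ^ n * sg s)"
      by (simp only: mult_ac)
    finally show "sg r * (frob_coeff m \<mu> R n r s * (- c) ^ n) = frob_coeff m \<mu> R n r s * c ^ n * sg s"
      by (simp flip: power_mult_distrib)
  qed
  also have "\<dots> = eval_fps (frob m \<mu> R r s) c * sg s"
    using summable_fps[of c "frob m \<mu> R r s"] c by (simp add: eval_fps_def suminf_mult2 frob_def)
  finally show ?thesis .
qed

section \<open>Fundamental matrices and parallel transport\<close>

lemmas square_mat_assoc = assoc_mult_mat[of _ m m _ m _ m for m] mult_carrier_mat[of _ m m _ m for m] left_mult_one_mat[of _ m m for m]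

lemma mult_mat_entry:
  assumes "A \<in> carrier_mat m m" "B \<in> carrier_mat m m" "r < m" "s < m"
  shows "(A * B) $$ (r, s) = (\<Sum>u<m. A $$ (r, u) * B $$ (u, s))"
  using assms by (auto simp: scalar_prod_def atLeast0LessThan intro!: sum.cong)

lemma mult_vec_entry:
  assumes "A \<in> carrier_mat m m" "v \<in> carrier_vec m" "r < m"
  shows "vec_index (A *\<^sub>v v) r = (\<Sum>u<m. A $$ (r, u) * vec_index v u)"
  using assms by (auto simp: scalar_prod_def atLeast0LessThan intro!: sum.cong)

definition diagonal :: "nat \<Rightarrow> (nat \<Rightarrow> complex) \<Rightarrow> complex mat" where
  "diagonal m d = Matrix.mat m m (\<lambda>(r, s). if r = s then d r else 0)"

lemma diagonal_carrier [simp]: "diagonal m d \<in> carrier_mat m m"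
  by (simp add: diagonal_def)

lemma diagonal_mult_entry:
  assumes "B \<in> carrier_mat m m" "r < m" "s < m"
  shows "(diagonal m d * B) $$ (r, s) = d r * B $$ (r, s)" "(B * diagonal m d) $$ (r, s) = B $$ (r, s) * d s"
proof -
  have "(diagonal m d * B) $$ (r, s) = (\<Sum>u<m. if u = r then d r * B $$ (r, s) else 0)"
    unfolding mult_mat_entry[OF diagonal_carrier assms]
    by (intro sum.cong refl) (use assms in \<open>auto simp: diagonal_def\<close>)
  then show "(diagonal m d * B) $$ (r, s) = d r * B $$ (r, s)" using assms by simp
  have "(B * diagonal m d) $$ (r, s) = (\<Sum>u<m. if u = s then B $$ (r, s) * d s else 0)"
    unfolding mult_mat_entry[OF assms(1) diagonal_carrier assms(2,3)]
    by (intro sum.cong refl) (use assms in \<open>auto simp: diagonal_def\<close>)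
  then show "(B * diagonal m d) $$ (r, s) = B $$ (r, s) * d s" using assms by simp
qed

lemma diagonal_mult_diagonal: "diagonal m d * diagonal m d' = diagonal m (\<lambda>s. d s * d' s)"
proof (rule eq_matI)
  fix r s assume "r < dim_row (diagonal m (\<lambda>s. d s * d' s))" "s < dim_col (diagonal m (\<lambda>s. d s * d' s))"
  then have rs: "r < m" "s < m" by (auto simp: diagonal_def)
  then show "(diagonal m d * diagonal m d') $$ (r, s) = diagonal m (\<lambda>s. d s * d' s) $$ (r, s)"
    unfolding diagonal_mult_entry(1)[OF diagonal_carrier rs] by (simp add: diagonal_def)
qed (auto simp: diagonal_def)

text \<open>\<open>\<Phi>\<close> is a fundamental matrix of \<open>F' = M F\<close> on \<open>D\<close>, and \<open>\<Psi>\<close> is its inverse. The derivative of \<open>\<Psi>\<close> is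
  recorded separately so that \<open>\<Psi> F\<close> can be differentiated for an arbitrary solution \<open>F\<close>.\<close>

definition fundamental_pair ::
  "nat \<Rightarrow> complex set \<Rightarrow> (complex \<Rightarrow> complex mat) \<Rightarrow> (complex \<Rightarrow> complex mat) \<Rightarrow> (complex \<Rightarrow> complex mat) \<Rightarrow> bool"
  where
  "fundamental_pair m D M \<Phi> \<Psi> \<longleftrightarrow>
     (\<forall>c. M c \<in> carrier_mat m m \<and> \<Phi> c \<in> carrier_mat m m \<and> \<Psi> c \<in> carrier_mat m m) \<and>
     (\<forall>c\<in>D. \<Psi> c * \<Phi> c = 1\<^sub>m m \<and>
       (\<forall>r<m. \<forall>s<m.
         ((\<lambda>c. \<Phi> c $$ (r, s)) has_field_derivative (M c * \<Phi> c) $$ (r, s)) (at c) \<and>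
         ((\<lambda>c. \<Psi> c $$ (r, s)) has_field_derivative - (\<Psi> c * M c) $$ (r, s)) (at c)))"

lemma fundamental_pair_conj:
  assumes "fundamental_pair m D M \<Phi> \<Psi>"
    and Q: "Q \<in> carrier_mat m m" "Q' \<in> carrier_mat m m" "Q' * Q = 1\<^sub>m m"
  shows "fundamental_pair m D (\<lambda>c. Q * M c * Q') (\<lambda>c. Q * \<Phi> c) (\<lambda>c. \<Psi> c * Q')"
proof -
  have cM [simp]: "M c \<in> carrier_mat m m" and c\<Phi> [simp]: "\<Phi> c \<in> carrier_mat m m"
    and c\<Psi> [simp]: "\<Psi> c \<in> carrier_mat m m" for c
    using assms(1) by (auto simp: fundamental_pair_def)
  note [simp] = Q(1,2)
  show ?thesis unfolding fundamental_pair_def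
  proof (intro conjI allI ballI impI)
    fix c assume c: "c \<in> D"
    have "(\<Psi> c * Q') * (Q * \<Phi> c) = \<Psi> c * ((Q' * Q) * \<Phi> c)"
      by (simp add: square_mat_assoc[where m = m])
    then show "(\<Psi> c * Q') * (Q * \<Phi> c) = 1\<^sub>m m"
      using assms(1) c Q(3) by (simp add: fundamental_pair_def square_mat_assoc[where m = m])
    fix r s assume rs: "r < m" "s < m"
    have eq1: "(Q * M c * Q') * (Q * \<Phi> c) = Q * (M c * \<Phi> c)"
    proof -
      have "(Q * M c * Q') * (Q * \<Phi> c) = Q * (M c * ((Q' * Q) * \<Phi> c))"
        by (simp add: square_mat_assoc[where m = m])
      then show ?thesis by (simp add: Q(3) square_mat_assoc[where m = m])
    qed
    have eq2: "(\<Psi> c * Q') * (Q * M c * Q') = \<Psi> c * M c * Q'"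
    proof -
      have "(\<Psi> c * Q') * (Q * M c * Q') = \<Psi> c * ((Q' * Q) * (M c * Q'))"
        by (simp add: square_mat_assoc[where m = m])
      then show ?thesis by (simp add: Q(3) square_mat_assoc[where m = m])
    qed
    have "((\<lambda>c. \<Sum>u<m. Q $$ (r, u) * \<Phi> c $$ (u, s)) has_field_derivative
        (\<Sum>u<m. Q $$ (r, u) * (M c * \<Phi> c) $$ (u, s))) (at c)"
      using assms(1) c rs by (intro DERIV_sum DERIV_cmult) (auto simp: fundamental_pair_def)
    then show "((\<lambda>c. (Q * \<Phi> c) $$ (r, s)) has_field_derivative
        ((Q * M c * Q') * (Q * \<Phi> c)) $$ (r, s)) (at c)"
      using rs unfolding eq1 by (simp add: mult_mat_entry[of _ m] square_mat_assoc(2)[where m = m] del: index_mult_mat(1))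
    have "((\<lambda>c. \<Sum>u<m. \<Psi> c $$ (r, u) * Q' $$ (u, s)) has_field_derivative
        (\<Sum>u<m. - (\<Psi> c * M c) $$ (r, u) * Q' $$ (u, s))) (at c)"
      using assms(1) c rs by (intro DERIV_sum DERIV_cmult_right) (auto simp: fundamental_pair_def)
    then show "((\<lambda>c. (\<Psi> c * Q') $$ (r, s)) has_field_derivative
        - ((\<Psi> c * Q') * (Q * M c * Q')) $$ (r, s)) (at c)"
      using rs unfolding eq2 by (simp add: mult_mat_entry[of _ m] square_mat_assoc(2)[where m = m] sum_negf del: index_mult_mat(1))
  qed (simp_all add: square_mat_assoc(2)[where m = m])
qed

text \<open>Uniqueness of transport without any estimate: \<open>\<Psi>(c(t)) F(t)\<close> is continuous and has derivative zero
  outside a finite set, hence is constant.\<close>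

lemma fundamental_pair_transport:
  assumes fp: "fundamental_pair m D M \<Phi> \<Psi>" and D: "c ` {0..1::real} \<subseteq> D"
    and c: "continuous_on {0..1} c"
    and F: "\<And>t. t \<in> {0..1} \<Longrightarrow> F t \<in> carrier_vec m"
    and contF: "\<And>j. j < m \<Longrightarrow> continuous_on {0..1} (\<lambda>t. vec_index (F t) j)"
    and S: "finite S"
    and deriv: "\<And>t. t \<in> {0..1} - S \<Longrightarrow> \<exists>c'. (c has_vector_derivative c') (at t within {0..1}) \<and>
        (\<forall>j<m. ((\<lambda>s. vec_index (F s) j) has_vector_derivative c' * vec_index (M (c t) *\<^sub>v F t) j) (at t within {0..1}))"
  shows "F 1 = \<Phi> (c 1) *\<^sub>v (\<Psi> (c 0) *\<^sub>v F 0)"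
proof -
  have cM [simp]: "M c \<in> carrier_mat m m" and c\<Phi> [simp]: "\<Phi> c \<in> carrier_mat m m"
    and c\<Psi> [simp]: "\<Psi> c \<in> carrier_mat m m" for c
    using fp by (auto simp: fundamental_pair_def)
  have \<Psi>': "((\<lambda>c. \<Psi> c $$ (r, s)) has_field_derivative - (\<Psi> z * M z) $$ (r, s)) (at z)"
    if "z \<in> D" "r < m" "s < m" for z r s
    using fp that by (auto simp: fundamental_pair_def)
  define G where "G r t = (\<Sum>s<m. \<Psi> (c t) $$ (r, s) * vec_index (F t) s)" for r t
  have GF: "vec_index (\<Psi> (c t) *\<^sub>v F t) r = G r t" if "t \<in> {0..1}" "r < m" for t r
    using that F by (simp only: mult_vec_entry[OF c\<Psi>] G_def)
  have const: "G r t = G r 0" if r: "r < m" and t: "t \<in> {0..1}" for r t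
  proof (rule has_derivative_zero_unique_strong_interval[OF S _ refl _ t])
    show "continuous_on {0..1} (G r)"
      unfolding G_def
    proof (intro continuous_on_sum continuous_on_mult contF)
      fix s assume "s \<in> {..<m}"
      then have "continuous_on D (\<lambda>z. \<Psi> z $$ (r, s))"
        using r by (intro DERIV_continuous_on[where D = "\<lambda>z. - (\<Psi> z * M z) $$ (r, s)"]
            has_field_derivative_at_within[OF \<Psi>']) simp_all
      then show "continuous_on {0..1} (\<lambda>t. \<Psi> (c t) $$ (r, s))"
        using continuous_on_compose2 c D by blast
    qed auto
    fix x assume x: "x \<in> {0..1} - S"
    obtain c' where c': "(c has_vector_derivative c') (at x within {0..1})"
      and F': "\<And>j. j < m \<Longrightarrow> ((\<lambda>s. vec_index (F s) j) has_vector_derivative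
          c' * vec_index (M (c x) *\<^sub>v F x) j) (at x within {0..1})"
      using deriv[OF x] by auto
    have cx: "c x \<in> D" and Fx: "F x \<in> carrier_vec m" using x D F by auto
    have "(G r has_vector_derivative
        (\<Sum>s<m. \<Psi> (c x) $$ (r, s) * (c' * vec_index (M (c x) *\<^sub>v F x) s)
           + c' * - (\<Psi> (c x) * M (c x)) $$ (r, s) * vec_index (F x) s)) (at x within {0..1})"
      unfolding G_def
    proof (intro has_vector_derivative_sum has_vector_derivative_mult F')
      fix s assume s: "s \<in> {..<m}"
      have "((\<lambda>z. \<Psi> z $$ (r, s)) has_field_derivative - (\<Psi> (c x) * M (c x)) $$ (r, s)) (at (c x) within c ` {0..1})"
        by (rule has_field_derivative_at_within[OF \<Psi>'[OF cx r]]) (use s in simp)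
      from field_vector_diff_chain_within[OF c' this]
      show "((\<lambda>t. \<Psi> (c t) $$ (r, s)) has_vector_derivative c' * - (\<Psi> (c x) * M (c x)) $$ (r, s)) (at x within {0..1})"
        unfolding o_def .
    qed auto
    moreover have "(\<Sum>s<m. \<Psi> (c x) $$ (r, s) * (c' * vec_index (M (c x) *\<^sub>v F x) s)
           + c' * - (\<Psi> (c x) * M (c x)) $$ (r, s) * vec_index (F x) s)
      = c' * (vec_index (\<Psi> (c x) *\<^sub>v (M (c x) *\<^sub>v F x)) r - vec_index ((\<Psi> (c x) * M (c x)) *\<^sub>v F x) r)"
      unfolding mult_vec_entry[OF c\<Psi> mult_mat_vec_carrier[OF cM Fx] r]
        mult_vec_entry[OF mult_carrier_mat[OF c\<Psi> cM] Fx r]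
      by (simp add: sum.distrib sum_subtractf sum_distrib_left sum_negf right_diff_distrib mult_ac)
    moreover have "\<Psi> (c x) *\<^sub>v (M (c x) *\<^sub>v F x) = (\<Psi> (c x) * M (c x)) *\<^sub>v F x"
      using Fx by (metis assoc_mult_mat_vec cM c\<Psi>)
    ultimately show "(G r has_derivative (\<lambda>h. 0)) (at x within {0..1})"
      by (simp add: has_vector_derivative_def)
  qed
  have "\<Psi> (c 1) *\<^sub>v F 1 = \<Psi> (c 0) *\<^sub>v F 0"
  proof (rule eq_vecI)
    fix r assume "r < dim_vec (\<Psi> (c 0) *\<^sub>v F 0)"
    then have "r < m" using c\<Psi>[of "c 0"] by (simp del: c\<Psi>)
    then show "vec_index (\<Psi> (c 1) *\<^sub>v F 1) r = vec_index (\<Psi> (c 0) *\<^sub>v F 0) r"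
      using GF[of 1 r] GF[of 0 r] const[of r 1] by simp
  qed (use c\<Psi>[of "c 0"] c\<Psi>[of "c 1"] in \<open>simp del: c\<Psi>\<close>)
  moreover have "\<Phi> (c 1) * \<Psi> (c 1) = 1\<^sub>m m"
    using fp D by (intro mat_mult_left_right_inverse[OF c\<Psi> c\<Phi>]) (auto simp: fundamental_pair_def image_subset_iff)
  ultimately show ?thesis
    using F[of 1] assoc_mult_mat_vec[OF c\<Phi>[of "c 1"] c\<Psi>[of "c 1"] F[of 1]] by simp
qed

lemma fundamental_pair_solution:
  assumes fp: "fundamental_pair m D M \<Phi> \<Psi>" and D: "c ` {0..1::real} \<subseteq> D"
    and c: "continuous_on {0..1} c" and w: "w \<in> carrier_vec m"
  shows "\<And>t. \<Phi> (c t) *\<^sub>v w \<in> carrier_vec m"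
    and "\<And>j. j < m \<Longrightarrow> continuous_on {0..1} (\<lambda>t. vec_index (\<Phi> (c t) *\<^sub>v w) j)"
    and "\<And>t c' j. t \<in> {0..1} \<Longrightarrow> (c has_vector_derivative c') (at t within {0..1}) \<Longrightarrow> j < m \<Longrightarrow>
      ((\<lambda>s. vec_index (\<Phi> (c s) *\<^sub>v w) j) has_vector_derivative
         c' * vec_index (M (c t) *\<^sub>v (\<Phi> (c t) *\<^sub>v w)) j) (at t within {0..1})"
proof -
  have cM [simp]: "M c \<in> carrier_mat m m" and c\<Phi> [simp]: "\<Phi> c \<in> carrier_mat m m" for c
    using fp by (auto simp: fundamental_pair_def)
  show "\<Phi> (c t) *\<^sub>v w \<in> carrier_vec m" for t
    by (rule mult_mat_vec_carrier[OF c\<Phi> w])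
  have \<Phi>': "((\<lambda>c. \<Phi> c $$ (r, s)) has_field_derivative (M z * \<Phi> z) $$ (r, s)) (at z)"
    if "z \<in> D" "r < m" "s < m" for z r s
    using fp that by (auto simp: fundamental_pair_def)
  have ent: "vec_index (\<Phi> z *\<^sub>v w) j = (\<Sum>s<m. \<Phi> z $$ (j, s) * vec_index w s)" if "j < m" for z j
    using mult_vec_entry[OF c\<Phi> w that] .
  show "continuous_on {0..1} (\<lambda>t. vec_index (\<Phi> (c t) *\<^sub>v w) j)" if j: "j < m" for j
    unfolding ent[OF j]
  proof (intro continuous_on_sum continuous_on_mult continuous_on_const)
    fix s assume "s \<in> {..<m}"
    then have "continuous_on D (\<lambda>z. \<Phi> z $$ (j, s))"
      using j by (intro DERIV_continuous_on[where D = "\<lambda>z. (M z * \<Phi> z) $$ (j, s)"]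
          has_field_derivative_at_within[OF \<Phi>']) simp_all
    then show "continuous_on {0..1} (\<lambda>t. \<Phi> (c t) $$ (j, s))"
      using continuous_on_compose2 c D by blast
  qed
  show "((\<lambda>s. vec_index (\<Phi> (c s) *\<^sub>v w) j) has_vector_derivative
         c' * vec_index (M (c t) *\<^sub>v (\<Phi> (c t) *\<^sub>v w)) j) (at t within {0..1})"
    if t: "t \<in> {0..1}" and c': "(c has_vector_derivative c') (at t within {0..1})" and j: "j < m" for t c' j
  proof -
    have ct: "c t \<in> D" using D t by auto
    have "((\<lambda>s. \<Sum>u<m. \<Phi> (c s) $$ (j, u) * vec_index w u) has_vector_derivative
        (\<Sum>u<m. c' * (M (c t) * \<Phi> (c t)) $$ (j, u) * vec_index w u)) (at t within {0..1})"
    proof (intro has_vector_derivative_sum has_vector_derivative_mult_left)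
      fix u assume u: "u \<in> {..<m}"
      have "((\<lambda>z. \<Phi> z $$ (j, u)) has_field_derivative (M (c t) * \<Phi> (c t)) $$ (j, u)) (at (c t) within c ` {0..1})"
        by (rule has_field_derivative_at_within[OF \<Phi>'[OF ct j]]) (use u in simp)
      from field_vector_diff_chain_within[OF c' this]
      show "((\<lambda>s. \<Phi> (c s) $$ (j, u)) has_vector_derivative c' * (M (c t) * \<Phi> (c t)) $$ (j, u)) (at t within {0..1})"
        unfolding o_def .
    qed
    moreover have "vec_index (M (c t) *\<^sub>v (\<Phi> (c t) *\<^sub>v w)) j = (\<Sum>u<m. (M (c t) * \<Phi> (c t)) $$ (j, u) * vec_index w u)"
      using mult_vec_entry[OF mult_carrier_mat[OF cM c\<Phi>] w j] assoc_mult_mat_vec[OF cM c\<Phi> w] by simp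
    ultimately show ?thesis unfolding ent[OF j] by (simp add: sum_distrib_left mult.assoc)
  qed
qed

text \<open>The convergence radius is part of the conclusion because the induction step needs it for the partial
  sum.\<close>

lemma eval_fps_sum_mult:
  assumes "finite A" "\<And>u. u \<in> A \<Longrightarrow> ereal (norm c) < fps_conv_radius (f u)"
    "\<And>u. u \<in> A \<Longrightarrow> ereal (norm c) < fps_conv_radius (g u)"
  shows "eval_fps (\<Sum>u\<in>A. f u * g u) c = (\<Sum>u\<in>A. eval_fps (f u) c * eval_fps (g u) (c::complex))
    \<and> ereal (norm c) < fps_conv_radius (\<Sum>u\<in>A. f u * g u)"
  using assms
proof (induction A rule: finite_induct)
  case (insert x A)
  have 1: "ereal (norm c) < fps_conv_radius (f x * g x)"
    using insert.prems by (intro less_le_trans[OF _ fps_conv_radius_mult]) auto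
  have 2: "ereal (norm c) < fps_conv_radius (\<Sum>u\<in>A. f u * g u)"
    "eval_fps (\<Sum>u\<in>A. f u * g u) c = (\<Sum>u\<in>A. eval_fps (f u) c * eval_fps (g u) c)"
    using insert by auto
  have "ereal (norm c) < fps_conv_radius (f x * g x + (\<Sum>u\<in>A. f u * g u))"
    using 1 2(1) by (intro less_le_trans[OF _ fps_conv_radius_add]) auto
  then show ?case using insert 1 2 by (simp add: eval_fps_add eval_fps_mult)
qed simp

lemma conv_radius_of_coeff_bound:
  fixes f :: "complex fps"
  assumes \<rho>: "0 < \<rho>" and R: "\<And>n. norm (fps_nth f n) \<le> B / \<rho> ^ n"
  shows "fps_conv_radius f \<ge> ereal \<rho>"
  unfolding fps_conv_radius_def
proof (rule conv_radius_geI_ex')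
  fix y :: real assume y: "0 < y" "ereal y < ereal \<rho>"
  show "summable (\<lambda>n. fps_nth f n * of_real y ^ n)"
  proof (rule summable_comparison_test')
    show "summable (\<lambda>n. B * (y / \<rho>) ^ n)"
      using y by (intro summable_mult summable_geometric) auto
    fix n
    have "norm (fps_nth f n * of_real y ^ n) \<le> B / \<rho> ^ n * y ^ n"
      unfolding norm_mult norm_power norm_of_real using y by (intro mult_mono R order.trans[OF norm_ge_zero R]) auto
    then show "norm (fps_nth f n * of_real y ^ n) \<le> B * (y / \<rho>) ^ n"
      by (simp only: power_divide times_divide_eq_left times_divide_eq_right)
  qed
qed

text \<open>The disc is slit along the positive imaginary axis, where \<open>Ln (\<i> * c)\<close> is not differentiable; the paths
  considered below stay in the closed lower half plane. The origin is excluded too, as \<open>0\<close> is a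
  nonpositive real.\<close>

definition slit_disc :: "real \<Rightarrow> complex set" where
  "slit_disc \<rho> = {c. norm c < \<rho> \<and> \<i> * c \<notin> \<real>\<^sub>\<le>\<^sub>0}"

text \<open>The fundamental matrix is \<open>H(c) c\<^bsup>diag(\<mu>)\<^esup>\<close>, with the branch of the logarithm adapted to the slit. The
  constant by which \<open>Ln (\<i> * c)\<close> differs from a logarithm of \<open>c\<close> cancels in every transport matrix.\<close>

lemma fuchsian_fundamental_pair:
  fixes \<mu> :: "nat \<Rightarrow> complex" and R :: "nat \<Rightarrow> nat \<Rightarrow> complex fps"
  assumes nr: "nonresonant m \<mu>" and \<rho>: "0 < \<rho>"
    and R: "\<And>r u n. r < m \<Longrightarrow> u < m \<Longrightarrow> norm (fps_nth (R r u) n) \<le> B / \<rho> ^ n"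
  defines "H \<equiv> \<lambda>c. Matrix.mat m m (\<lambda>(r, s). eval_fps (frob m \<mu> R r s) c)"
    and "K \<equiv> \<lambda>c. Matrix.mat m m (\<lambda>(r, s). eval_fps (frob_inv m \<mu> R r s) c)"
    and "E \<equiv> \<lambda>x. diagonal m (\<lambda>r. exp (\<mu> r * x))"
  shows "fundamental_pair m (slit_disc \<rho>)
      (\<lambda>c. Matrix.mat m m (\<lambda>(r, s). (if r = s then \<mu> r else 0) / c + eval_fps (R r s) c))
      (\<lambda>c. H c * E (Ln (\<i> * c))) (\<lambda>c. E (- Ln (\<i> * c)) * K c)"
    and "\<And>c. norm c < \<rho> \<Longrightarrow> K c * H c = 1\<^sub>m m"
proof -
  let ?h = "\<lambda>r s. eval_fps (frob m \<mu> R r s)"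
  let ?k = "\<lambda>r s. eval_fps (frob_inv m \<mu> R r s)"
  let ?R = "\<lambda>r s. eval_fps (R r s)"
  have rR: "ereal (norm c) < fps_conv_radius (R r s)" if "norm c < \<rho>" "r < m" "s < m" for c r s
    using conv_radius_of_coeff_bound[OF \<rho> R[OF that(2,3)]] that by (simp add: less_le_trans[of _ "ereal \<rho>"])
  have rH: "ereal (norm c) < fps_conv_radius (frob m \<mu> R r s)" if "norm c < \<rho>" "r < m" "s < m" for c r s
    using frob_conv_radius[OF \<rho> R that(2,3)] that by (simp add: less_le_trans[of _ "ereal \<rho>"])
  have rK: "ereal (norm c) < fps_conv_radius (frob_inv m \<mu> R r s)" if "norm c < \<rho>" "r < m" "s < m" for c r s
    using frob_conv_radius[OF \<rho> _ that(3,2), of "\<lambda>r s. - R s r" B] R that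
    by (simp add: frob_inv_def less_le_trans[of _ "ereal \<rho>"])
  have KH: "(\<Sum>u<m. ?k r u c * ?h u s c) = (if r = s then 1 else 0)" if "norm c < \<rho>" "r < m" "s < m" for c r s
  proof -
    have "(\<Sum>u<m. ?k r u c * ?h u s c) = eval_fps (\<Sum>u<m. frob_inv m \<mu> R r u * frob m \<mu> R u s) c"
      using eval_fps_sum_mult[of "{..<m}" c "frob_inv m \<mu> R r" "\<lambda>u. frob m \<mu> R u s"] that
      by (simp add: rK rH)
    then show ?thesis using frob_inv_mult_frob[OF nr that(2,3)] by simp
  qed
  show KH': "K c * H c = 1\<^sub>m m" if "norm c < \<rho>" for c
    using KH[OF that] by (intro eq_matI) (auto simp: K_def H_def mult_mat_entry[of _ m] simp del: index_mult_mat(1))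
  have h': "(?h r s has_field_derivative
      (\<mu> r - \<mu> s) / c * ?h r s c + (\<Sum>u<m. ?R r u c * ?h u s c)) (at c)"
    if c: "norm c < \<rho>" "c \<noteq> 0" and rs: "r < m" "s < m" for c r s
  proof -
    let ?f = "frob m \<mu> R r s"
    have sum: "ereal (norm c) < fps_conv_radius (\<Sum>u<m. R r u * frob m \<mu> R u s)"
      "eval_fps (\<Sum>u<m. R r u * frob m \<mu> R u s) c = (\<Sum>u<m. ?R r u c * ?h u s c)"
      using eval_fps_sum_mult[of "{..<m}" c "R r" "\<lambda>u. frob m \<mu> R u s"] c rs by (simp_all add: rR rH)
    have d: "ereal (norm c) < fps_conv_radius (fps_deriv ?f)"
      using rH[OF c(1) rs] by (rule less_le_trans[OF _ fps_conv_radius_deriv])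
    have r1: "ereal (norm c) < fps_conv_radius (fps_const (\<mu> r - \<mu> s) * ?f)"
      using rH[OF c(1) rs] by (intro less_le_trans[OF _ fps_conv_radius_mult]) simp
    have r2: "ereal (norm c) < fps_conv_radius (fps_X * (\<Sum>u<m. R r u * frob m \<mu> R u s))"
      using sum(1) by (intro less_le_trans[OF _ fps_conv_radius_mult]) simp
    have "c * eval_fps (fps_deriv ?f) c = eval_fps (fps_X * fps_deriv ?f) c"
      using d by (simp add: eval_fps_mult)
    also have "\<dots> = (\<mu> r - \<mu> s) * ?h r s c + c * (\<Sum>u<m. ?R r u c * ?h u s c)"
      unfolding frob_eq[OF nr rs] using r1 r2 sum rH[OF c(1) rs] by (simp add: eval_fps_add eval_fps_mult)
    finally have eq: "eval_fps (fps_deriv ?f) c = (\<mu> r - \<mu> s) / c * ?h r s c + (\<Sum>u<m. ?R r u c * ?h u s c)"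
      using c by (simp add: field_simps)
    have "(eval_fps ?f has_field_derivative eval_fps (fps_deriv ?f) c) (at c)"
      using has_field_derivative_eval_fps[of c ?f UNIV] rH[OF c(1) rs] by simp
    then show ?thesis unfolding eq .
  qed
  have k': "(?k r s has_field_derivative
      (\<mu> r - \<mu> s) / c * ?k r s c - (\<Sum>u<m. ?k r u c * ?R u s c)) (at c)"
    if c: "norm c < \<rho>" "c \<noteq> 0" and rs: "r < m" "s < m" for c r s
  proof -
    let ?f = "frob_inv m \<mu> R r s"
    have sum: "ereal (norm c) < fps_conv_radius (\<Sum>u<m. frob_inv m \<mu> R r u * R u s)"
      "eval_fps (\<Sum>u<m. frob_inv m \<mu> R r u * R u s) c = (\<Sum>u<m. ?k r u c * ?R u s c)"
      using eval_fps_sum_mult[of "{..<m}" c "frob_inv m \<mu> R r" "\<lambda>u. R u s"] c rs by (simp_all add: rR rK)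
    have d: "ereal (norm c) < fps_conv_radius (fps_deriv ?f)"
      using rK[OF c(1) rs] by (rule less_le_trans[OF _ fps_conv_radius_deriv])
    have r1: "ereal (norm c) < fps_conv_radius (fps_const (\<mu> r - \<mu> s) * ?f)"
      using rK[OF c(1) rs] by (intro less_le_trans[OF _ fps_conv_radius_mult]) simp
    have r2: "ereal (norm c) < fps_conv_radius (fps_X * (\<Sum>u<m. frob_inv m \<mu> R r u * R u s))"
      using sum(1) by (intro less_le_trans[OF _ fps_conv_radius_mult]) simp
    have "c * eval_fps (fps_deriv ?f) c = eval_fps (fps_X * fps_deriv ?f) c"
      using d by (simp add: eval_fps_mult)
    also have "\<dots> = (\<mu> r - \<mu> s) * ?k r s c - c * (\<Sum>u<m. ?k r u c * ?R u s c)"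
      unfolding frob_inv_eq[OF nr rs] using r1 r2 sum rK[OF c(1) rs] by (simp add: eval_fps_diff eval_fps_mult)
    finally have eq: "eval_fps (fps_deriv ?f) c = (\<mu> r - \<mu> s) / c * ?k r s c - (\<Sum>u<m. ?k r u c * ?R u s c)"
      using c by (simp add: field_simps)
    have "(eval_fps ?f has_field_derivative eval_fps (fps_deriv ?f) c) (at c)"
      using has_field_derivative_eval_fps[of c ?f UNIV] rK[OF c(1) rs] by simp
    then show ?thesis unfolding eq .
  qed
  have cH [simp]: "H c \<in> carrier_mat m m" and cK [simp]: "K c \<in> carrier_mat m m"
    and cE [simp]: "E c \<in> carrier_mat m m" for c
    by (auto simp: H_def K_def E_def)
  have HE: "(H c * E x) $$ (r, s) = ?h r s c * exp (\<mu> s * x)" if "r < m" "s < m" for c x r s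
    unfolding E_def diagonal_mult_entry(2)[OF cH that] using that by (simp add: H_def)
  have EK: "(E x * K c) $$ (r, s) = exp (\<mu> r * x) * ?k r s c" if "r < m" "s < m" for c x r s
    unfolding E_def diagonal_mult_entry(1)[OF cK that] using that by (simp add: K_def)
  let ?M = "\<lambda>c. Matrix.mat m m (\<lambda>(r, s). (if r = s then \<mu> r else 0) / c + ?R r s c)"
  show "fundamental_pair m (slit_disc \<rho>) ?M (\<lambda>c. H c * E (Ln (\<i> * c))) (\<lambda>c. E (- Ln (\<i> * c)) * K c)"
    unfolding fundamental_pair_def
  proof (intro conjI allI ballI impI)
    fix c
    show "H c * E (Ln (\<i> * c)) \<in> carrier_mat m m" "E (- Ln (\<i> * c)) * K c \<in> carrier_mat m m"
      by (simp_all add: square_mat_assoc[where m = m])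
    assume "c \<in> slit_disc \<rho>"
    then have c: "norm c < \<rho>" "c \<noteq> 0" and ic: "\<i> * c \<notin> \<real>\<^sub>\<le>\<^sub>0" by (auto simp: slit_disc_def)
    let ?L = "Ln (\<i> * c)"
    have L': "((\<lambda>c. Ln (\<i> * c)) has_field_derivative 1 / c) (at c)"
      using ic c by (auto intro!: derivative_eq_intros simp: field_simps)
    have "(E (- ?L) * K c) * (H c * E ?L) = E (- ?L) * ((K c * H c) * E ?L)"
      by (simp add: square_mat_assoc[where m = m])
    also have "\<dots> = E (- ?L) * E ?L" by (simp add: KH'[OF c(1)] square_mat_assoc[where m = m])
    also have "\<dots> = 1\<^sub>m m"
      unfolding E_def diagonal_mult_diagonal exp_add[symmetric] by (auto simp: diagonal_def)
    finally show "(E (- ?L) * K c) * (H c * E ?L) = 1\<^sub>m m" .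
    fix r s assume rs: "r < m" "s < m"
    have eq1: "(?M c * (H c * E ?L)) $$ (r, s) =
      ((\<mu> r - \<mu> s) / c * ?h r s c + (\<Sum>u<m. ?R r u c * ?h u s c)) * exp (\<mu> s * ?L)
         + exp (\<mu> s * ?L) * (\<mu> s * (1 / c)) * ?h r s c"
    proof -
      have "(?M c * (H c * E ?L)) $$ (r, s) = (\<Sum>u<m. ?M c $$ (r, u) * (H c * E ?L) $$ (u, s))"
        by (rule mult_mat_entry[OF _ mult_carrier_mat[OF cH cE] rs]) auto
      also have "\<dots> = (\<Sum>u<m. (if u = r then \<mu> r / c * (?h r s c * exp (\<mu> s * ?L)) else 0) +
        ?R r u c * (?h u s c * exp (\<mu> s * ?L)))"
        using rs by (intro sum.cong refl) (auto simp: HE algebra_simps)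
      also have "\<dots> = \<mu> r / c * (?h r s c * exp (\<mu> s * ?L)) + (\<Sum>u<m. ?R r u c * ?h u s c) * exp (\<mu> s * ?L)"
        using rs by (simp add: sum.distrib sum_distrib_right mult.assoc)
      finally show ?thesis by (simp add: algebra_simps diff_divide_distrib)
    qed
    have "((\<lambda>c. ?h r s c * exp (\<mu> s * Ln (\<i> * c))) has_field_derivative (?M c * (H c * E ?L)) $$ (r, s)) (at c)"
      unfolding eq1 by (rule DERIV_mult[OF h'[OF c rs] DERIV_chain2[OF DERIV_exp DERIV_cmult[OF L']]])
    then show "((\<lambda>c. (H c * E (Ln (\<i> * c))) $$ (r, s)) has_field_derivative (?M c * (H c * E ?L)) $$ (r, s)) (at c)"
      by (simp only: HE[OF rs])
    have eq2: "- ((E (- ?L) * K c) * ?M c) $$ (r, s) =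
      exp (\<mu> r * - ?L) * (\<mu> r * - (1 / c)) * ?k r s c +
      ((\<mu> r - \<mu> s) / c * ?k r s c - (\<Sum>u<m. ?k r u c * ?R u s c)) * exp (\<mu> r * - ?L)"
    proof -
      have "((E (- ?L) * K c) * ?M c) $$ (r, s) = (\<Sum>u<m. (E (- ?L) * K c) $$ (r, u) * ?M c $$ (u, s))"
        by (rule mult_mat_entry[OF mult_carrier_mat[OF cE cK] _ rs]) auto
      also have "\<dots> = (\<Sum>u<m. (if u = s then \<mu> s / c * (?k r s c * exp (\<mu> r * - ?L)) else 0) +
        (?k r u c * ?R u s c) * exp (\<mu> r * - ?L))"
        using rs by (intro sum.cong refl) (auto simp: EK algebra_simps)
      also have "\<dots> = \<mu> s / c * (?k r s c * exp (\<mu> r * - ?L)) + (\<Sum>u<m. ?k r u c * ?R u s c) * exp (\<mu> r * - ?L)"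
        using rs by (simp add: sum.distrib sum_distrib_right)
      finally show ?thesis by (simp add: algebra_simps diff_divide_distrib)
    qed
    have "((\<lambda>c. exp (\<mu> r * - Ln (\<i> * c)) * ?k r s c) has_field_derivative - ((E (- ?L) * K c) * ?M c) $$ (r, s)) (at c)"
      unfolding eq2
      by (rule DERIV_mult[OF DERIV_chain2[OF DERIV_exp DERIV_cmult[OF DERIV_minus[OF L']]] k'[OF c rs]])
    then show "((\<lambda>c. (E (- Ln (\<i> * c)) * K c) $$ (r, s)) has_field_derivative - ((E (- ?L) * K c) * ?M c) $$ (r, s)) (at c)"
      by (simp only: EK[OF rs])
  qed (auto simp: E_def H_def K_def)
qed

section \<open>The dihedral group acting on the mirrors\<close>

text \<open>Mirrors, reflections and rotations are indexed by all integers, so that the group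
  law becomes addition and subtraction of indices; the index modulo \<open>m\<close> recovers the indexing by \<open>i < m\<close>.\<close>

definition int_angle :: "nat \<Rightarrow> int \<Rightarrow> real" where
  "int_angle m a = of_int a * pi / real m"

definition line :: "real \<Rightarrow> (complex^2) set" where
  "line x = {c *s cplx (vector [cos x, sin x]) | c. True}"

definition int_refl :: "nat \<Rightarrow> int \<Rightarrow> real^2^2" where
  "int_refl m a = vector [vector [cos (2 * int_angle m a),   sin (2 * int_angle m a)],
                          vector [sin (2 * int_angle m a), - cos (2 * int_angle m a)]]"

definition int_rot :: "nat \<Rightarrow> int \<Rightarrow> real^2^2" where
  "int_rot m a = vector [vector [cos (2 * int_angle m a), - sin (2 * int_angle m a)],
                         vector [sin (2 * int_angle m a),   cos (2 * int_angle m a)]]"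

lemma angle_eq_int: "angle m i = int_angle m (int i)"
  by (simp add: angle_def int_angle_def)

lemma refl_eq_int: "refl m i = int_refl m (int i)" and rot_eq_int: "rot m i = int_rot m (int i)"
  by (simp_all add: refl_def rot_def int_refl_def int_rot_def angle_eq_int)

lemma mirror_eq_line: "mirror m i = line (int_angle m (int i))"
  by (simp add: mirror_def line_def angle_eq_int)

lemma int_angle_add: "int_angle m (a + b) = int_angle m a + int_angle m b"
  and int_angle_diff: "int_angle m (a - b) = int_angle m a - int_angle m b"
  by (simp_all add: int_angle_def distrib_right left_diff_distrib add_divide_distrib diff_divide_distrib)

lemma int_angle_double: "int_angle m (2 * a) = 2 * int_angle m a"
  by (simp add: int_angle_def)

lemma sin_int_angle_eq_0_iff:
  assumes "m > 0"
  shows "sin (int_angle m a) = 0 \<longleftrightarrow> int m dvd a"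
proof -
  have "sin (int_angle m a) = 0 \<longleftrightarrow> (\<exists>i::int. of_int a = (of_int (int m * i) :: real))"
    using assms by (simp add: sin_zero_iff_int2 int_angle_def field_simps)
  then show ?thesis by (simp only: of_int_eq_iff dvd_def)
qed

lemma line_eq_iff: "line x = line y \<longleftrightarrow> sin (x - y) = 0"
proof
  assume "line x = line y"
  moreover have "cplx (vector [cos x, sin x]) \<in> line x"
    unfolding line_def by (force intro!: exI[of _ 1])
  ultimately obtain c where c: "cplx (vector [cos x, sin x]) = c *s cplx (vector [cos y, sin y])"
    by (auto simp: line_def)
  have "complex_of_real (cos x) = c * of_real (cos y)" "complex_of_real (sin x) = c * of_real (sin y)"
    using arg_cong[OF c, of "\<lambda>v. v $ 1"] arg_cong[OF c, of "\<lambda>v. v $ 2"] by (simp_all add: cplx_def)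
  then have "complex_of_real (sin (x - y)) = 0" by (simp add: sin_diff)
  then show "sin (x - y) = 0" by (simp only: of_real_eq_0_iff)
next
  assume "sin (x - y) = 0"
  then obtain i :: int where i: "x - y = of_int i * pi" using sin_zero_iff_int2 by blast
  have s: "sin (of_int i * pi) = 0" using sin_zero_iff_int2 by blast
  have x: "x = y + of_int i * pi" using i by simp
  define e where "e = cos (of_int i * pi)"
  have e: "e * e = 1" using sin_cos_squared_add2[of "of_int i * pi"] s by (simp add: e_def power2_eq_square)
  have xy: "cplx (vector [cos x, sin x]) = of_real e *s cplx (vector [cos y, sin y])"
    unfolding x by (simp add: Finite_Cartesian_Product.vec_eq_iff forall_2 cplx_def cos_add sin_add s e_def mult.commute)
  have ee: "complex_of_real e * of_real e = 1"
    unfolding of_real_mult[symmetric] e by simp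
  have "c *s cplx (vector [cos y, sin y]) = (c * of_real e) *s cplx (vector [cos x, sin x])" for c
    unfolding xy vector_smult_assoc mult.assoc ee by simp
  moreover have "c *s cplx (vector [cos x, sin x]) = (c * of_real e) *s cplx (vector [cos y, sin y])" for c
    unfolding xy vector_smult_assoc ..
  ultimately show "line x = line y" unfolding line_def by blast
qed

lemma cact_smult: "cact w (c *s z) = c *s cact w z"
  by (simp add: cact_def Finite_Cartesian_Product.vec_eq_iff forall_2 matrix_vector_mult_def sum_2 algebra_simps)

lemma cact_cplx: "cact w (cplx x) = cplx (w *v x)"
  by (simp add: cact_def cplx_def Finite_Cartesian_Product.vec_eq_iff forall_2 matrix_vector_mult_def sum_2)

lemma cact_mult: "cact (w ** w') z = cact w (cact w' z)"
  by (simp add: cact_def Finite_Cartesian_Product.vec_eq_iff forall_2 matrix_vector_mult_def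
      matrix_matrix_mult_def sum_2 algebra_simps)

text \<open>It suffices to know where the direction vector goes.\<close>

lemma cact_line:
  assumes "w *v vector [cos x, sin x] = vector [cos y, sin y]"
  shows "cact w ` line x = line y"
proof -
  have "cact w (c *s cplx (vector [cos x, sin x])) = c *s cplx (vector [cos y, sin y])" for c
    by (simp add: cact_smult cact_cplx assms)
  moreover have "line x = range (\<lambda>c. c *s cplx (vector [cos x, sin x]))" for x
    by (auto simp: line_def)
  ultimately show ?thesis by (simp add: image_image)
qed

lemma cact_int_refl_line: "cact (int_refl m a) ` line x = line (2 * int_angle m a - x)"
  by (rule cact_line)
    (simp add: int_refl_def Finite_Cartesian_Product.vec_eq_iff forall_2 matrix_vector_mult_def sum_2 cos_diff sin_diff)

lemma cact_int_rot_line: "cact (int_rot m a) ` line x = line (2 * int_angle m a + x)"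
  by (rule cact_line)
    (simp add: int_rot_def Finite_Cartesian_Product.vec_eq_iff forall_2 matrix_vector_mult_def sum_2 cos_add sin_add)

lemma int_refl_mult_refl: "int_refl m a ** int_refl m b = int_rot m (a - b)"
  by (simp add: int_refl_def int_rot_def Finite_Cartesian_Product.vec_eq_iff forall_2 matrix_matrix_mult_def
      sum_2 int_angle_diff right_diff_distrib cos_diff sin_diff)

lemma int_rot_mult_refl: "int_rot m a ** int_refl m b = int_refl m (a + b)"
  by (simp add: int_refl_def int_rot_def Finite_Cartesian_Product.vec_eq_iff forall_2 matrix_matrix_mult_def
      sum_2 int_angle_add distrib_left cos_add sin_add)

lemma cact_int_rot_0: "cact (int_rot m 0) z = z"
  by (simp add: int_rot_def int_angle_def cact_def Finite_Cartesian_Product.vec_eq_iff forall_2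
      matrix_vector_mult_def sum_2)

lemma int_angle_mod:
  assumes "m > 0"
  shows "\<exists>n::int. int_angle m a = int_angle m (a mod int m) + of_int n * pi"
proof
  have "of_int a = (of_int (a mod int m) + real m * of_int (a div int m) :: real)"
    by (metis of_int_add of_int_mult of_int_of_nat_eq mod_mult_div_eq)
  then show "int_angle m a = int_angle m (a mod int m) + of_int (a div int m) * pi"
    using assms by (simp add: int_angle_def field_simps)
qed

lemma cos_sin_double_int_angle_mod:
  assumes "m > 0"
  shows "cos (2 * int_angle m a) = cos (2 * int_angle m (a mod int m))"
    and "sin (2 * int_angle m a) = sin (2 * int_angle m (a mod int m))"
proof -
  obtain n where n: "int_angle m a = int_angle m (a mod int m) + of_int n * pi"
    using int_angle_mod[OF assms] by blast
  have d: "2 * int_angle m a = 2 * int_angle m (a mod int m) + of_int n * (2 * pi)" using n by simp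
  show "cos (2 * int_angle m a) = cos (2 * int_angle m (a mod int m))"
    "sin (2 * int_angle m a) = sin (2 * int_angle m (a mod int m))"
    unfolding d cos_add sin_add by (simp_all add: sin_int_2pin[of n] cos_int_2pin[of n] mult.commute[of "of_int n"])
qed

lemma dihedral_eq:
  assumes "m > 0"
  shows "dihedral m = range (int_rot m) \<union> range (int_refl m)"
proof -
  have ex: "\<exists>j<m. int j = a mod int m" for a
    using assms by (intro exI[of _ "nat (a mod int m)"]) (auto simp: nat_less_iff)
  have "int_rot m a \<in> rot m ` {..<m}" for a
  proof -
    obtain j where "j < m" "int j = a mod int m" using ex by blast
    moreover from this have "int_rot m a = rot m j"
      using assms by (simp add: rot_eq_int int_rot_def cos_sin_double_int_angle_mod[of m a])
    ultimately show ?thesis by blast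
  qed
  moreover have "int_refl m a \<in> refl m ` {..<m}" for a
  proof -
    obtain j where "j < m" "int j = a mod int m" using ex by blast
    moreover from this have "int_refl m a = refl m j"
      using assms by (simp add: refl_eq_int int_refl_def cos_sin_double_int_angle_mod[of m a])
    ultimately show ?thesis by blast
  qed
  ultimately show ?thesis by (auto simp: dihedral_def rot_eq_int refl_eq_int)
qed

lemma mirror_eq_iff: "m > 0 \<Longrightarrow> line (int_angle m a) = mirror m j \<longleftrightarrow> int m dvd a - int j"
  unfolding mirror_eq_line line_eq_iff int_angle_diff[symmetric] by (rule sin_int_angle_eq_0_iff)

lemma cact_refl_mirror_iff:
  assumes "m > 0"
  shows "cact (refl m t) ` mirror m c = mirror m r \<longleftrightarrow> int m dvd 2 * int t - int c - int r"
proof -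
  have "cact (refl m t) ` mirror m c = line (int_angle m (2 * int t - int c))"
    by (simp add: refl_eq_int mirror_eq_line[of m c] cact_int_refl_line int_angle_diff int_angle_double)
  then show ?thesis using mirror_eq_iff[OF assms] by simp
qed

text \<open>Distinct indices below \<open>m\<close> give distinct mirrors, so the definite description in \<open>act_idx\<close> is met by at
  most one index.\<close>

lemma act_idx_eqI:
  assumes "m > 0" "j < m" "cact w ` mirror m i = mirror m j"
  shows "act_idx m w i = j"
  unfolding act_idx_def
proof (rule the_equality)
  fix j' assume j': "j' < m \<and> cact w ` mirror m i = mirror m j'"
  then have "int m dvd int j' - int j"
    using assms mirror_eq_iff[OF assms(1), of "int j'" j] by (simp add: mirror_eq_line)
  then show "j' = j" using j' assms(2) zdvd_not_zless[of "int j' - int j" "int m"]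
      zdvd_not_zless[of "int j - int j'" "int m"] by (cases j j' rule: linorder_cases) (auto simp: dvd_diff_commute)
qed (use assms in simp)

lemma act_idx_dihedral:
  assumes "m > 0" "w \<in> dihedral m"
  shows "act_idx m w i < m" "cact w ` mirror m i = mirror m (act_idx m w i)"
proof -
  obtain a where a: "cact w ` mirror m i = line (int_angle m a)"
  proof (cases "w \<in> range (int_rot m)")
    case True
    then obtain b where "w = int_rot m b" by auto
    then show ?thesis using that[of "2 * b + int i"]
      by (simp add: mirror_eq_line cact_int_rot_line int_angle_add int_angle_double)
  next
    case False
    then obtain b where "w = int_refl m b" using assms(2) unfolding dihedral_eq[OF assms(1)] by auto
    then show ?thesis using that[of "2 * b - int i"]
      by (simp add: mirror_eq_line cact_int_refl_line int_angle_diff int_angle_double)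
  qed
  define j where "j = nat (a mod int m)"
  have j: "j < m" "int j = a mod int m" using assms(1) by (auto simp: j_def nat_less_iff)
  have "cact w ` mirror m i = mirror m j"
    unfolding a mirror_eq_iff[OF assms(1)] j(2) by (simp add: minus_mod_eq_mult_div)
  moreover from this have "act_idx m w i = j" using act_idx_eqI assms(1) j(1) by blast
  ultimately show "act_idx m w i < m" "cact w ` mirror m i = mirror m (act_idx m w i)" using j(1) by auto
qed

lemma refl_in_dihedral: "m > 0 \<Longrightarrow> refl m t \<in> dihedral m"
  by (simp add: dihedral_eq refl_eq_int)

lemma rot_0_in_dihedral: "m > 0 \<Longrightarrow> rot m 0 \<in> dihedral m"
  by (simp add: dihedral_def)

lemma dihedral_mult_refl:
  assumes "m > 0" "w \<in> dihedral m"
  shows "w ** refl m t \<in> dihedral m"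
  using assms(2) unfolding dihedral_eq[OF assms(1)] refl_eq_int
  by (auto simp: int_refl_mult_refl int_rot_mult_refl)

lemma refl_mult_refl: "refl m t ** refl m t = rot m 0"
  by (simp add: refl_eq_int rot_eq_int int_refl_mult_refl)

lemma act_idx_refl_iff:
  assumes "m > 0" "r < m"
  shows "r = act_idx m (refl m t) c \<longleftrightarrow> int m dvd 2 * int t - int c - int r"
  using act_idx_eqI[OF assms, of "refl m t" c] act_idx_dihedral(2)[OF assms(1) refl_in_dihedral[OF assms(1)], of t c]
    cact_refl_mirror_iff[OF assms(1), of t c r] by auto

lemma act_idx_mult:
  assumes "m > 0" "w \<in> dihedral m" "w' \<in> dihedral m"
  shows "act_idx m (w ** w') c = act_idx m w (act_idx m w' c)"
proof (rule act_idx_eqI[OF assms(1)])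
  have "cact (w ** w') ` mirror m c = cact w ` (cact w' ` mirror m c)"
    by (simp add: cact_mult image_comp o_def)
  then show "cact (w ** w') ` mirror m c = mirror m (act_idx m w (act_idx m w' c))"
    using act_idx_dihedral(2)[OF assms(1)] assms(2,3) by simp
qed (use act_idx_dihedral assms in auto)

lemma act_idx_rot_0: "m > 0 \<Longrightarrow> c < m \<Longrightarrow> act_idx m (rot m 0) c = c"
  by (rule act_idx_eqI) (simp_all add: rot_eq_int cact_int_rot_0)

lemma iota_carrier [simp]: "iota m w \<in> carrier_mat m m"
  by (simp add: iota_def)

lemma iota_mult:
  assumes "m > 0" "w \<in> dihedral m" "w' \<in> dihedral m"
  shows "iota m (w ** w') = iota m w * iota m w'"
proof (rule eq_matI)
  fix r c assume "r < dim_row (iota m w * iota m w')" "c < dim_col (iota m w * iota m w')"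
  then have rc: "r < m" "c < m" by (auto simp: iota_def)
  have l: "act_idx m w' c < m" using act_idx_dihedral assms by blast
  have "(iota m w * iota m w') $$ (r, c) =
    (\<Sum>u<m. if u = act_idx m w' c then iota m w $$ (r, u) else 0)"
    unfolding mult_mat_entry[OF iota_carrier iota_carrier rc]
    by (intro sum.cong refl) (use rc in \<open>auto simp: iota_def\<close>)
  also have "\<dots> = iota m (w ** w') $$ (r, c)"
    using rc l by (simp add: iota_def act_idx_mult[OF assms])
  finally show "iota m (w ** w') $$ (r, c) = (iota m w * iota m w') $$ (r, c)" by simp
qed (auto simp: iota_def)

lemma iota_rot_0: "m > 0 \<Longrightarrow> iota m (rot m 0) = 1\<^sub>m m"
  by (rule eq_matI) (auto simp: iota_def act_idx_rot_0)

lemma iota_refl_refl: "m > 0 \<Longrightarrow> iota m (refl m t) * iota m (refl m t) = 1\<^sub>m m"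
  by (metis iota_mult iota_rot_0 refl_in_dihedral refl_mult_refl)

section \<open>The residues of the connection\<close>

text \<open>A common eigenbasis of an involutive permutation \<open>\<sigma>\<close> of the basis vectors and of the rank one operator
  with row \<open>\<phi>\<close> in position \<open>i\<close>. Start from the vectors \<open>e\<^sub>s + sg(s) e\<^bsub>\<sigma>(s)\<^esub>\<close>, which are symmetric for the smaller element
  of an orbit (or a fixed point) and antisymmetric for the larger one. Every one except \<open>e\<^sub>i\<close> is then moved
  into the kernel of \<open>\<phi>\<close> by subtracting a multiple of \<open>e\<^sub>i\<close>, which is where \<open>a \<noteq> 0\<close> is
  needed; \<open>e\<^sub>i\<close> itself occurs with factor \<open>2\<close>, as \<open>\<sigma>\<close> fixes \<open>i\<close>.\<close>

lemma eigenbasis_exists: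
  fixes \<sigma> :: "nat \<Rightarrow> nat" and \<phi> :: "nat \<Rightarrow> complex"
  assumes \<sigma>: "\<And>s. s < m \<Longrightarrow> \<sigma> s < m" "\<And>s. s < m \<Longrightarrow> \<sigma> (\<sigma> s) = s"
    and i: "i < m" "\<sigma> i = i"
    and \<phi>: "\<And>s. s < m \<Longrightarrow> \<phi> (\<sigma> s) = \<phi> s" "\<phi> i = a" "a \<noteq> 0"
  defines "sg \<equiv> \<lambda>s. if s \<le> \<sigma> s then 1 else - 1 :: complex"
  obtains Q Q' where "Q \<in> carrier_mat m m" "Q' \<in> carrier_mat m m" "Q * Q' = 1\<^sub>m m" "Q' * Q = 1\<^sub>m m"
    "\<And>r s. r < m \<Longrightarrow> s < m \<Longrightarrow> Q $$ (\<sigma> r, s) = Q $$ (r, s) * sg s"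
    "\<And>s. s < m \<Longrightarrow> (\<Sum>u<m. \<phi> u * Q $$ (u, s)) = (if s = i then a * Q $$ (i, i) else 0)"
    "\<And>r. r < m \<Longrightarrow> r \<noteq> i \<Longrightarrow> Q $$ (r, i) = 0"
proof -
  define Q where "Q = Matrix.mat m m (\<lambda>(r, s). of_bool (r = s) + sg s * of_bool (r = \<sigma> s)
      - (if s \<noteq> i \<and> r = i then (1 + sg s) * \<phi> s / a else 0))"
  define Q' where "Q' = Matrix.mat m m (\<lambda>(r, s). (of_bool (r = s) - (if \<sigma> s = s then 0 else sg s * of_bool (r = \<sigma> s))
      + (if r = i then \<phi> s / a - of_bool (s = i) else 0)) / 2)"
  have sg2: "sg s * sg s = 1" for s by (simp add: sg_def)
  have sgi: "sg i = 1" by (simp add: sg_def i)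
  have sg\<sigma>: "sg (\<sigma> s) = - sg s" if "s < m" "\<sigma> s \<noteq> s" for s using that \<sigma> by (auto simp: sg_def)
  have sgfix: "sg s = 1" if "\<sigma> s = s" for s using that by (simp add: sg_def)
  have \<sigma>_eq: "\<sigma> r = s \<longleftrightarrow> r = \<sigma> s" if "r < m" "s < m" for r s using \<sigma> that by metis
  have cQ: "Q \<in> carrier_mat m m" "Q' \<in> carrier_mat m m" by (auto simp: Q_def Q'_def)
  have Qe: "Q $$ (r, s) = of_bool (r = s) + sg s * of_bool (r = \<sigma> s)
      - (if s \<noteq> i \<and> r = i then (1 + sg s) * \<phi> s / a else 0)" if "r < m" "s < m" for r s
    using that by (simp add: Q_def)
  have Qi: "Q $$ (r, i) = 2 * of_bool (r = i)" if "r < m" for r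
    using that i sgi by (simp add: Qe)
  have inv: "Q * Q' = 1\<^sub>m m"
  proof (rule eq_matI)
    fix r s assume "r < dim_row (1\<^sub>m m :: complex mat)" "s < dim_col (1\<^sub>m m :: complex mat)"
    then have rs: "r < m" "s < m" by auto
    have "(Q * Q') $$ (r, s) = (\<Sum>u<m. Q $$ (r, u) * Q' $$ (u, s))"
      by (rule mult_mat_entry[OF cQ rs])
    also have "\<dots> = (\<Sum>u<m. (if u = s then Q $$ (r, s) / 2 else 0)
        - (if u = \<sigma> s then (if \<sigma> s = s then 0 else sg s * Q $$ (r, \<sigma> s) / 2) else 0)
        + (if u = i then Q $$ (r, i) * (\<phi> s / a - of_bool (s = i)) / 2 else 0))"
      by (intro sum.cong refl) (use rs in \<open>auto simp: Q'_def diff_divide_distrib add_divide_distrib algebra_simps\<close>)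
    also have "\<dots> = Q $$ (r, s) / 2 - (if \<sigma> s = s then 0 else sg s * Q $$ (r, \<sigma> s) / 2)
        + Q $$ (r, i) * (\<phi> s / a - of_bool (s = i)) / 2"
      using rs i \<sigma>(1) by (simp add: sum.distrib sum_subtractf)
    also have "\<dots> = of_bool (r = s)"
    proof (cases "s = i")
      case True
      then show ?thesis using rs \<phi> i by (simp add: Qi)
    next
      case ns: False
      have nsi: "\<sigma> s \<noteq> i" using ns i \<sigma>_eq[OF rs(2) i(1)] by auto
      show ?thesis
      proof (cases "\<sigma> s = s")
        case True
        then show ?thesis using rs ns \<phi> i by (auto simp: Qi Qe sgfix)
      next
        case False
        have "sg s * Q $$ (r, \<sigma> s) = sg s * of_bool (r = \<sigma> s) - (sg s * sg s) * of_bool (r = s)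
          - (if r = i then (sg s - sg s * sg s) * \<phi> s / a else 0)"
          using rs nsi \<sigma>[OF rs(2)] \<phi>(1)[OF rs(2)] sg\<sigma>[OF rs(2) False] by (simp add: Qe algebra_simps)
        also have "\<dots> = sg s * of_bool (r = \<sigma> s) - of_bool (r = s) - (if r = i then (sg s - 1) * \<phi> s / a else 0)"
          unfolding sg2 by simp
        finally have eq: "sg s * Q $$ (r, \<sigma> s) =
          sg s * of_bool (r = \<sigma> s) - of_bool (r = s) - (if r = i then (sg s - 1) * \<phi> s / a else 0)" .
        have "Q $$ (r, s) / 2 - (if \<sigma> s = s then 0 else sg s * Q $$ (r, \<sigma> s) / 2)
            + Q $$ (r, i) * (\<phi> s / a - of_bool (s = i)) / 2
          = (Q $$ (r, s) - sg s * Q $$ (r, \<sigma> s)) / 2 + of_bool (r = i) * (\<phi> s / a)"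
          using False ns by (simp add: Qi[OF rs(1)] diff_divide_distrib)
        also have "\<dots> = of_bool (r = s)"
          unfolding eq Qe[OF rs] using ns
          by (cases "r = i") (simp_all add: add_divide_distrib diff_divide_distrib algebra_simps)
        finally show ?thesis .
      qed
    qed
    finally show "(Q * Q') $$ (r, s) = (1\<^sub>m m :: complex mat) $$ (r, s)" using rs by simp
  qed (use cQ in auto)
  show ?thesis
  proof (rule that[OF cQ inv mat_mult_left_right_inverse[OF cQ inv]])
    fix r s assume rs: "r < m" "s < m"
    have "\<sigma> r = i \<longleftrightarrow> r = i" using \<sigma>_eq[OF rs(1) i(1)] i(2) by auto
    moreover have "\<sigma> r = \<sigma> s \<longleftrightarrow> r = s" using \<sigma>(2) rs by metis
    moreover have "(1 + sg s) * \<phi> s / a = (1 + sg s) * \<phi> s / a * sg s"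
      using sg2[of s] by (simp add: algebra_simps)
    ultimately show "Q $$ (\<sigma> r, s) = Q $$ (r, s) * sg s"
      using rs \<sigma> \<sigma>_eq[OF rs] sg2[of s] by (simp add: Qe algebra_simps)
  next
    fix s assume s: "s < m"
    have "(\<Sum>u<m. \<phi> u * Q $$ (u, s)) = (\<Sum>u<m. (if u = s then \<phi> s else 0) + (if u = \<sigma> s then sg s * \<phi> (\<sigma> s) else 0)
       - (if u = i then (if s \<noteq> i then (1 + sg s) * \<phi> s else 0) else 0))"
      by (intro sum.cong refl) (use s \<phi>(2,3) in \<open>auto simp: Qe field_simps\<close>)
    also have "\<dots> = \<phi> s + sg s * \<phi> s - (if s \<noteq> i then (1 + sg s) * \<phi> s else 0)"
      using s \<sigma>(1) i \<phi>(1) by (simp add: sum.distrib sum_subtractf)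
    also have "\<dots> = (if s = i then a * Q $$ (i, i) else 0)"
      using i \<phi> sgi by (simp add: Qi algebra_simps)
    finally show "(\<Sum>u<m. \<phi> u * Q $$ (u, s)) = (if s = i then a * Q $$ (i, i) else 0)" .
  qed (simp add: Qi)
qed

text \<open>\<open>A\<^sub>j\<close>, the residue of the connection along \<open>H\<^sub>j\<close>.\<close>

definition lk_residue ::
  "nat \<Rightarrow> complex \<Rightarrow> (nat \<Rightarrow> complex) \<Rightarrow> (nat \<Rightarrow> complex) \<Rightarrow> nat \<Rightarrow> complex mat" where
  "lk_residue m \<kappa> k \<alpha> j = \<kappa> \<cdot>\<^sub>m (k j \<cdot>\<^sub>m iota m (refl m j) - pmat m k \<alpha> j)"

lemma lk_residue_carrier [simp]: "lk_residue m \<kappa> k \<alpha> j \<in> carrier_mat m m"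
  by (simp add: lk_residue_def pmat_def minus_carrier_mat)

lemma pmat_entry:
  assumes "r < m" "c < m"
  shows "pmat m k \<alpha> j $$ (r, c) = (if r \<noteq> j then 0 else if c = j then \<alpha> j
      else (\<Sum>t | t < m \<and> int m dvd 2 * int t - int c - int j. k t))"
proof -
  have "m > 0" using assms by simp
  then show ?thesis using assms by (simp add: pmat_def cact_refl_mirror_iff)
qed

lemma iota_refl_entry:
  assumes "r < m" "c < m"
  shows "iota m (refl m j) $$ (r, c) = of_bool (int m dvd 2 * int j - int c - int r)"
proof -
  have "m > 0" using assms by simp
  then show ?thesis using assms act_idx_refl_iff[of m r j c] by (simp add: iota_def)
qed

lemma lk_residue_entry:
  assumes "r < m" "c < m"
  shows "lk_residue m \<kappa> k \<alpha> j $$ (r, c) =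
    \<kappa> * (k j * iota m (refl m j) $$ (r, c) - pmat m k \<alpha> j $$ (r, c))"
  using assms by (simp add: lk_residue_def pmat_def iota_def)

lemma lk_form_eq:
  "lk_form m \<kappa> k \<alpha> z u =
     Matrix.mat m m (\<lambda>(r, c). \<Sum>j<m. lk_residue m \<kappa> k \<alpha> j $$ (r, c) * omega m j z u)"
  unfolding lk_form_def
proof (rule cong_mat[OF refl refl], clarify)
  fix r c assume rc: "r < m" "c < m"
  show "\<kappa> * (\<Sum>i<m. (k i \<cdot>\<^sub>m iota m (refl m i) - pmat m k \<alpha> i) $$ (r, c) * omega m i z u) =
    (\<Sum>j<m. lk_residue m \<kappa> k \<alpha> j $$ (r, c) * omega m j z u)"
    unfolding sum_distrib_left
    by (intro sum.cong refl) (use rc in \<open>simp add: lk_residue_def iota_def pmat_def mult.assoc\<close>)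
qed

lemma dvd_iff_of_sum:
  fixes x y :: int
  assumes "n dvd x + y"
  shows "n dvd x \<longleftrightarrow> n dvd y"
  using assms by (metis dvd_add_right_iff dvd_add_left_iff)

lemma act_idx_refl:
  assumes "m > 0" "c < m"
  shows "act_idx m (refl m t) c < m" "act_idx m (refl m t) (act_idx m (refl m t) c) = c"
    "int m dvd 2 * int t - int c - int (act_idx m (refl m t) c)"
proof -
  show 1: "act_idx m (refl m t) c < m" using act_idx_dihedral refl_in_dihedral assms by blast
  then show 2: "int m dvd 2 * int t - int c - int (act_idx m (refl m t) c)"
    using act_idx_refl_iff[OF assms(1) 1, of t c] by simp
  have "int m dvd 2 * int t - int (act_idx m (refl m t) c) - int c"
    using 2 by (simp add: algebra_simps)
  then show "act_idx m (refl m t) (act_idx m (refl m t) c) = c"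
    using act_idx_refl_iff[OF assms] by metis
qed

lemma act_idx_refl_self: "m > 0 \<Longrightarrow> i < m \<Longrightarrow> act_idx m (refl m i) i = i"
  using act_idx_refl_iff[of m i i i] by simp

text \<open>For even \<open>m\<close> the mirrors fall into two orbits, told apart by the parity of the index; this makes the
  parameters invariant under the group.\<close>

lemma even_act_idx_refl:
  assumes "even m" "m > 0" "c < m"
  shows "even (act_idx m (refl m t) c) \<longleftrightarrow> even c"
proof -
  have "(2::int) dvd int m" using assms(1) by simp
  then have "2 dvd 2 * int t - int c - int (act_idx m (refl m t) c)"
    using act_idx_refl(3)[OF assms(2,3)] dvd_trans by blast
  then show ?thesis by simp
qed

lemma iota_refl_conj_entry:
  assumes m: "m > 0" and X: "X \<in> carrier_mat m m" and rc: "r < m" "c < m"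
  shows "(iota m (refl m t) * X * iota m (refl m t)) $$ (r, c) =
    X $$ (act_idx m (refl m t) r, act_idx m (refl m t) c)"
proof -
  let ?S = "iota m (refl m t)" and ?\<sigma> = "act_idx m (refl m t)"
  have S: "?S $$ (u, v) = of_bool (u = ?\<sigma> v)" "?S $$ (u, v) = of_bool (v = ?\<sigma> u)" if "u < m" "v < m" for u v
    using that act_idx_refl(2)[OF m] by (auto simp: iota_def)
  have SX: "(?S * X) $$ (r, v) = X $$ (?\<sigma> r, v)" if "v < m" for v
  proof -
    have "(?S * X) $$ (r, v) = (\<Sum>u<m. if u = ?\<sigma> r then X $$ (u, v) else 0)"
      unfolding mult_mat_entry[OF iota_carrier X rc(1) that]
      by (intro sum.cong refl) (use rc S(2) in auto)
    then show ?thesis using act_idx_refl(1)[OF m rc(1)] by simp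
  qed
  have "(?S * X * ?S) $$ (r, c) = (\<Sum>v<m. if v = ?\<sigma> c then X $$ (?\<sigma> r, v) else 0)"
    unfolding mult_mat_entry[OF mult_carrier_mat[OF iota_carrier X] iota_carrier rc]
    by (intro sum.cong refl) (use rc S(1) SX in auto)
  then show ?thesis using act_idx_refl(1)[OF m rc(2)] by simp
qed

text \<open>The relation says that \<open>s\<^sub>t\<close> exchanges \<open>H\<^sub>u\<close> and \<open>H\<^sub>v\<close>, and it is preserved by \<open>s\<^sub>i\<close>, since conjugating
  \<open>s\<^sub>t\<close> by \<open>s\<^sub>i\<close> gives the reflection in \<open>s\<^sub>i(H\<^sub>t)\<close>.\<close>

lemma dvd_act_idx_refl:
  fixes i :: nat
  assumes m: "m > 0" and tuv: "t < m" "u < m" "v < m"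
  defines "\<sigma> \<equiv> act_idx m (refl m i)"
  shows "int m dvd 2 * int (\<sigma> t) - int (\<sigma> u) - int (\<sigma> v) \<longleftrightarrow> int m dvd 2 * int t - int u - int v"
proof -
  obtain e f g where "2 * int i - int t - int (\<sigma> t) = int m * e"
    "2 * int i - int u - int (\<sigma> u) = int m * f" "2 * int i - int v - int (\<sigma> v) = int m * g"
    using act_idx_refl(3)[OF m] tuv unfolding dvd_def \<sigma>_def by metis
  then have "(2 * int (\<sigma> t) - int (\<sigma> u) - int (\<sigma> v)) + (2 * int t - int u - int v) = int m * (f + g - 2 * e)"
    by (simp add: algebra_simps)
  then show ?thesis by (intro dvd_iff_of_sum) simp
qed

lemma by_parity_act_idx_refl:
  fixes x y :: complex
  shows "m > 0 \<Longrightarrow> even m \<Longrightarrow> t < m \<Longrightarrow> by_parity x y (act_idx m (refl m i) t) = by_parity x y t"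
  by (simp add: by_parity_def even_act_idx_refl)

lemma pmat_act_idx_refl:
  fixes i :: nat
  assumes m: "m > 0" "even m" and j: "j < m" and rc: "r < m" "c < m"
  defines "\<sigma> \<equiv> act_idx m (refl m i)"
  shows "pmat m (by_parity a b) (by_parity a' b') j $$ (\<sigma> r, \<sigma> c) =
    pmat m (by_parity a b) (by_parity a' b') (\<sigma> j) $$ (r, c)"
proof -
  let ?k = "by_parity a b"
  have \<sigma>: "\<sigma> t < m" "\<sigma> (\<sigma> t) = t" if "t < m" for t using act_idx_refl[OF m(1) that] by (auto simp: \<sigma>_def)
  note flip = dvd_act_idx_refl[OF m(1), where i = i, folded \<sigma>_def]
  note par = by_parity_act_idx_refl[OF m, where i = i, folded \<sigma>_def]
  have "(\<Sum>t | t < m \<and> int m dvd 2 * int t - int (\<sigma> c) - int j. ?k t) =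
    (\<Sum>t | t < m \<and> int m dvd 2 * int t - int c - int (\<sigma> j). ?k t)"
  proof (rule sum.reindex_bij_witness[of _ \<sigma> \<sigma>])
    fix t assume t: "t \<in> {t. t < m \<and> int m dvd 2 * int t - int (\<sigma> c) - int j}"
    then show "\<sigma> t \<in> {t. t < m \<and> int m dvd 2 * int t - int c - int (\<sigma> j)}"
      using flip[of t "\<sigma> c" j] rc j \<sigma> by auto
    show "?k (\<sigma> t) = ?k t" using t par by simp
  next
    fix t assume t: "t \<in> {t. t < m \<and> int m dvd 2 * int t - int c - int (\<sigma> j)}"
    then show "\<sigma> t \<in> {t. t < m \<and> int m dvd 2 * int t - int (\<sigma> c) - int j}"
      using flip[of t c "\<sigma> j"] rc j \<sigma> by auto
  qed (use \<sigma> in auto)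
  moreover have "\<sigma> r = j \<longleftrightarrow> r = \<sigma> j" "\<sigma> c = j \<longleftrightarrow> c = \<sigma> j" using \<sigma> rc j by metis+
  ultimately show ?thesis using rc \<sigma> par[OF j] by (simp add: pmat_entry)
qed

text \<open>Invariance of the connection under \<open>s\<^sub>i\<close>, expressed by residues.\<close>

lemma lk_residue_conj:
  assumes m: "m > 0" "even m" and j: "j < m"
  shows "iota m (refl m i) * lk_residue m \<kappa> (by_parity a b) (by_parity a' b') j * iota m (refl m i) =
    lk_residue m \<kappa> (by_parity a b) (by_parity a' b') (act_idx m (refl m i) j)"
proof (rule eq_matI)
  let ?\<sigma> = "act_idx m (refl m i)" and ?k = "by_parity a b" and ?\<alpha> = "by_parity a' b'"
  fix r c assume "r < dim_row (lk_residue m \<kappa> ?k ?\<alpha> (?\<sigma> j))" "c < dim_col (lk_residue m \<kappa> ?k ?\<alpha> (?\<sigma> j))"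
  then have rc: "r < m" "c < m" using lk_residue_carrier[of m \<kappa> ?k ?\<alpha> "?\<sigma> j"] by auto
  have \<sigma>: "?\<sigma> t < m" "?\<sigma> (?\<sigma> t) = t" if "t < m" for t using act_idx_refl[OF m(1) that] by auto
  have "iota m (refl m j) $$ (?\<sigma> r, ?\<sigma> c) = iota m (refl m (?\<sigma> j)) $$ (r, c)"
    using rc j \<sigma> dvd_act_idx_refl[OF m(1) \<sigma>(1)[OF j] rc(2,1), of i]
    by (simp add: iota_refl_entry)
  then show "(iota m (refl m i) * lk_residue m \<kappa> ?k ?\<alpha> j * iota m (refl m i)) $$ (r, c) =
      lk_residue m \<kappa> ?k ?\<alpha> (?\<sigma> j) $$ (r, c)"
    unfolding iota_refl_conj_entry[OF m(1) lk_residue_carrier rc]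
    using by_parity_act_idx_refl[OF m j] pmat_act_idx_refl[OF m j rc] rc \<sigma> by (simp add: lk_residue_entry)
qed (use lk_residue_carrier iota_carrier in \<open>auto simp: lk_residue_def iota_def pmat_def\<close>)

text \<open>The eigenvalue of \<open>\<iota>(s\<^sub>i)\<close> on the \<open>s\<close>-th vector of the eigenbasis.\<close>

definition reflection_sign :: "nat \<Rightarrow> nat \<Rightarrow> nat \<Rightarrow> complex" where
  "reflection_sign m i s = (if s \<le> act_idx m (refl m i) s then 1 else - 1)"

lemma reflection_sign_square [simp]: "reflection_sign m i s * reflection_sign m i s = 1"
  by (simp add: reflection_sign_def)

text \<open>The operator \<open>p\<^sub>i\<close> has image spanned by \<open>v\<^sub>i\<close>, and its row of coefficients is invariant under \<open>s\<^sub>i\<close>. So it acts on the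
  eigenbasis of \<open>eigenbasis_exists\<close> by \<open>\<alpha>\<^sub>i\<close> in position \<open>i\<close> and by zero elsewhere, while \<open>\<iota>(s\<^sub>i)\<close> acts by signs.\<close>

lemma lk_residue_diagonalizable:
  fixes a b a' b' \<kappa> :: complex
  defines "k \<equiv> by_parity a b" and "\<alpha> \<equiv> by_parity a' b'"
  assumes m: "m > 0" "even m" and i: "i < m" and \<alpha>: "\<alpha> i \<noteq> 0"
  defines "\<mu> \<equiv> \<lambda>s. \<kappa> * (k i * reflection_sign m i s - (if s = i then \<alpha> i else 0))"
  obtains Q Q' where "Q \<in> carrier_mat m m" "Q' \<in> carrier_mat m m" "Q * Q' = 1\<^sub>m m" "Q' * Q = 1\<^sub>m m"
    "iota m (refl m i) * Q = Q * diagonal m (reflection_sign m i)"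
    "lk_residue m \<kappa> k \<alpha> i * Q = Q * diagonal m \<mu>"
proof -
  let ?\<sigma> = "act_idx m (refl m i)" and ?S = "iota m (refl m i)"
  define \<phi> where "\<phi> s = pmat m k \<alpha> i $$ (i, s)" for s
  have \<sigma>: "?\<sigma> s < m" "?\<sigma> (?\<sigma> s) = s" if "s < m" for s using act_idx_refl[OF m(1) that] by auto
  have \<sigma>i: "?\<sigma> i = i" by (rule act_idx_refl_self[OF m(1) i])
  have "\<phi> (?\<sigma> s) = \<phi> s" if s: "s < m" for s
    using pmat_act_idx_refl[OF m i i s, of a b a' b' i] by (simp add: \<phi>_def k_def \<alpha>_def \<sigma>i)
  moreover have "\<phi> i = \<alpha> i" using i by (simp add: \<phi>_def pmat_entry)
  ultimately obtain Q Q' where Q: "Q \<in> carrier_mat m m" "Q' \<in> carrier_mat m m" "Q * Q' = 1\<^sub>m m" "Q' * Q = 1\<^sub>m m"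
    and Q\<sigma>: "\<And>r s. r < m \<Longrightarrow> s < m \<Longrightarrow> Q $$ (?\<sigma> r, s) = Q $$ (r, s) * reflection_sign m i s"
    and \<phi>Q: "\<And>s. s < m \<Longrightarrow> (\<Sum>u<m. \<phi> u * Q $$ (u, s)) = (if s = i then \<alpha> i * Q $$ (i, i) else 0)"
    and Qi: "\<And>r. r < m \<Longrightarrow> r \<noteq> i \<Longrightarrow> Q $$ (r, i) = 0"
    using eigenbasis_exists[of m ?\<sigma> i \<phi> "\<alpha> i"] \<sigma> i \<sigma>i \<alpha> unfolding reflection_sign_def by blast
  note diag = diagonal_mult_entry(2)[OF Q(1)]
  have SQ: "(\<Sum>u<m. ?S $$ (r, u) * Q $$ (u, s)) = Q $$ (r, s) * reflection_sign m i s" if rs: "r < m" "s < m" for r s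
  proof -
    have "(\<Sum>u<m. ?S $$ (r, u) * Q $$ (u, s)) = (\<Sum>u<m. if u = ?\<sigma> r then Q $$ (u, s) else 0)"
      by (intro sum.cong refl) (use rs \<sigma> in \<open>auto simp: iota_def\<close>)
    then show ?thesis using rs \<sigma> Q\<sigma> by simp
  qed
  show ?thesis
  proof (rule that[OF Q])
    show "?S * Q = Q * diagonal m (reflection_sign m i)"
    proof (rule eq_matI)
      fix r s assume "r < dim_row (Q * diagonal m (reflection_sign m i))"
        "s < dim_col (Q * diagonal m (reflection_sign m i))"
      then have rs: "r < m" "s < m" using Q(1) by (auto simp: diagonal_def)
      show "(?S * Q) $$ (r, s) = (Q * diagonal m (reflection_sign m i)) $$ (r, s)"
        unfolding diag[OF rs] mult_mat_entry[OF iota_carrier Q(1) rs] by (rule SQ[OF rs])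
    qed (use Q(1) in \<open>auto simp: iota_def diagonal_def\<close>)
    show "lk_residue m \<kappa> k \<alpha> i * Q = Q * diagonal m \<mu>"
    proof (rule eq_matI)
      fix r s assume "r < dim_row (Q * diagonal m \<mu>)"
        "s < dim_col (Q * diagonal m \<mu>)"
      then have rs: "r < m" "s < m" using Q(1) by (auto simp: diagonal_def)
      have "(\<Sum>u<m. lk_residue m \<kappa> k \<alpha> i $$ (r, u) * Q $$ (u, s)) =
        \<kappa> * (k i * (\<Sum>u<m. ?S $$ (r, u) * Q $$ (u, s)) - (\<Sum>u<m. pmat m k \<alpha> i $$ (r, u) * Q $$ (u, s)))"
        unfolding sum_distrib_left sum_subtractf[symmetric]
        by (intro sum.cong refl) (use rs in \<open>simp add: lk_residue_entry algebra_simps\<close>)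
      also have "(\<Sum>u<m. pmat m k \<alpha> i $$ (r, u) * Q $$ (u, s)) = (if s = i then \<alpha> i * Q $$ (r, i) else 0)"
      proof (cases "r = i")
        case True
        then show ?thesis using \<phi>Q[OF rs(2)] by (simp add: \<phi>_def)
      next
        case False
        then show ?thesis using rs Qi by (simp add: pmat_entry)
      qed
      finally have eq: "(\<Sum>u<m. lk_residue m \<kappa> k \<alpha> i $$ (r, u) * Q $$ (u, s)) =
        \<kappa> * (k i * (Q $$ (r, s) * reflection_sign m i s) - (if s = i then \<alpha> i * Q $$ (r, i) else 0))"
        unfolding SQ[OF rs] .
      show "(lk_residue m \<kappa> k \<alpha> i * Q) $$ (r, s) = (Q * diagonal m \<mu>) $$ (r, s)"
        unfolding diag[OF rs] mult_mat_entry[OF lk_residue_carrier Q(1) rs] eq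
        by (simp add: \<mu>_def algebra_simps)
    qed (use Q(1) carrier_matD(1)[OF lk_residue_carrier] in \<open>auto simp: diagonal_def\<close>)
  qed
qed

section \<open>The half monodromy of a reflection-symmetric system\<close>

lemma fundamental_pair_cong:
  assumes "fundamental_pair m D M \<Phi> \<Psi>" "\<And>c. M' c \<in> carrier_mat m m" "\<And>c. c \<in> D \<Longrightarrow> M' c = M c"
  shows "fundamental_pair m D M' \<Phi> \<Psi>"
  using assms by (simp add: fundamental_pair_def)

lemma conj_sum_entry:
  assumes Q: "Q \<in> carrier_mat m m" "Q' \<in> carrier_mat m m" and B: "\<And>j. B j \<in> carrier_mat m m" and rs: "r < m" "s < m"
  shows "(Q * Matrix.mat m m (\<lambda>(u, v). \<Sum>j\<in>J. B j $$ (u, v) * f j) * Q') $$ (r, s) =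
    (\<Sum>j\<in>J. (Q * B j * Q') $$ (r, s) * (f j :: complex))"
proof -
  define W where "W = Matrix.mat m m (\<lambda>(u, v). \<Sum>j\<in>J. B j $$ (u, v) * f j)"
  have W: "W \<in> carrier_mat m m" by (simp add: W_def)
  have "(Q * W * Q') $$ (r, s) = (\<Sum>v<m. (Q * W) $$ (r, v) * Q' $$ (v, s))"
    by (rule mult_mat_entry[OF mult_carrier_mat[OF Q(1) W] Q(2) rs])
  also have "\<dots> = (\<Sum>v<m. (\<Sum>u<m. Q $$ (r, u) * (\<Sum>j\<in>J. B j $$ (u, v) * f j)) * Q' $$ (v, s))"
    by (intro sum.cong refl, subst mult_mat_entry[OF Q(1) W]) (use rs in \<open>auto simp: W_def\<close>)
  also have "\<dots> = (\<Sum>v<m. \<Sum>u<m. \<Sum>j\<in>J. Q $$ (r, u) * B j $$ (u, v) * Q' $$ (v, s) * f j)"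
    by (simp add: sum_distrib_left sum_distrib_right mult_ac)
  also have "\<dots> = (\<Sum>v<m. \<Sum>j\<in>J. \<Sum>u<m. Q $$ (r, u) * B j $$ (u, v) * Q' $$ (v, s) * f j)"
    by (intro sum.cong refl, rule sum.swap)
  also have "\<dots> = (\<Sum>j\<in>J. \<Sum>v<m. \<Sum>u<m. Q $$ (r, u) * B j $$ (u, v) * Q' $$ (v, s) * f j)"
    by (rule sum.swap)
  also have "\<dots> = (\<Sum>j\<in>J. (Q * B j * Q') $$ (r, s) * f j)"
  proof (intro sum.cong refl)
    fix j
    have "(Q * B j * Q') $$ (r, s) = (\<Sum>v<m. (\<Sum>u<m. Q $$ (r, u) * B j $$ (u, v)) * Q' $$ (v, s))"
      unfolding mult_mat_entry[OF mult_carrier_mat[OF Q(1) B] Q(2) rs]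
      by (intro sum.cong refl, subst mult_mat_entry[OF Q(1) B]) (use rs in auto)
    then show "(\<Sum>v<m. \<Sum>u<m. Q $$ (r, u) * B j $$ (u, v) * Q' $$ (v, s) * f j) = (Q * B j * Q') $$ (r, s) * f j"
      by (simp add: sum_distrib_right)
  qed
  finally show ?thesis unfolding W_def .
qed

text \<open>The expansion of \<open>g / (1 + g c)\<close>, a simple pole at \<open>-1/g\<close> with residue one; \<open>g = 0\<close> covers a pole at
  infinity, which occurs for the mirror parallel to the line.\<close>

definition geom_fps :: "complex \<Rightarrow> complex fps" where
  "geom_fps g = Abs_fps (\<lambda>n. g * (- g) ^ n)"

lemma geom_fps_sums:
  assumes "norm (g * c) < 1"
  shows "(\<lambda>n. b * fps_nth (geom_fps g) n * c ^ n) sums (b * (g / (1 + g * c)))"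
proof -
  have "(\<lambda>n. (- (g * c)) ^ n) sums (1 / (1 - (- (g * c))))"
    by (rule geometric_sums) (use assms in simp)
  then have "(\<lambda>n. b * g * (- (g * c)) ^ n) sums (b * g * (1 / (1 - (- (g * c)))))" by (rule sums_mult)
  moreover have "(- (g * c)) ^ n = (- g) ^ n * c ^ n" for n by (simp flip: power_mult_distrib)
  ultimately show ?thesis by (simp add: geom_fps_def mult.assoc)
qed

text \<open>A Fuchsian system with a pole at \<open>0\<close> and all other poles outside the closed disc of radius \<open>1/2\<close>, whose
  residues are permuted by \<open>S\<close> in the way \<open>c \<mapsto> -c\<close> permutes the poles. In an eigenbasis \<open>Q\<close> of the residue
  at \<open>0\<close> the solution is \<open>Q H(c) c\<^bsup>diag(\<mu>)\<^esup>\<close>, and \<open>S\<close> becomes \<open>diag(sg)\<close>. Transport from \<open>-1/2\<close> to \<open>1/2\<close>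
  below the origin followed by \<open>S\<close> is therefore diagonalized by \<open>X = Q H(-1/2)\<close>, because
  \<open>diag(sg) H(1/2) = H(-1/2) diag(sg)\<close>.\<close>

lemma reflection_symmetric_half_monodromy:
  fixes A :: "nat \<Rightarrow> complex mat" and g \<mu> sg :: "nat \<Rightarrow> complex" and \<sigma> :: "nat \<Rightarrow> nat" and S :: "complex mat"
  defines "f \<equiv> \<lambda>i j c. if j = i then 1 / c else g j / (1 + g j * c)"
  assumes nr: "nonresonant m \<mu>" and i: "i < m" "\<sigma> i = i"
    and A: "\<And>j. A j \<in> carrier_mat m m" and S: "S \<in> carrier_mat m m" "S * S = 1\<^sub>m m"
    and Q: "Q \<in> carrier_mat m m" "Q' \<in> carrier_mat m m" "Q * Q' = 1\<^sub>m m" "Q' * Q = 1\<^sub>m m"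
    and SQ: "S * Q = Q * diagonal m sg" and AQ: "A i * Q = Q * diagonal m \<mu>"
    and sg: "\<And>r. r < m \<Longrightarrow> sg r * sg r = 1"
    and \<sigma>: "\<And>j. j < m \<Longrightarrow> \<sigma> j < m" "\<And>j. j < m \<Longrightarrow> \<sigma> (\<sigma> j) = j"
    and SAS: "\<And>j. j < m \<Longrightarrow> S * A j * S = A (\<sigma> j)"
    and g: "\<And>j. j < m \<Longrightarrow> j \<noteq> i \<Longrightarrow> norm (g j) < 2" "\<And>j. j < m \<Longrightarrow> j \<noteq> i \<Longrightarrow> g (\<sigma> j) = - g j"
  obtains \<rho> \<Phi> \<Psi> X X' where "1 / 2 < \<rho>"
    "fundamental_pair m (slit_disc \<rho>) (\<lambda>c. Matrix.mat m m (\<lambda>(r, s). \<Sum>j<m. A j $$ (r, s) * f i j c)) \<Phi> \<Psi>"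
    "\<And>j c. j < m \<Longrightarrow> j \<noteq> i \<Longrightarrow> norm c < \<rho> \<Longrightarrow> norm (g j * c) < 1"
    "X \<in> carrier_mat m m" "X' \<in> carrier_mat m m" "X * X' = 1\<^sub>m m" "X' * X = 1\<^sub>m m"
    "S * \<Phi> (1 / 2) * \<Psi> (- 1 / 2) = X * diagonal m (\<lambda>s. sg s * exp (\<mu> s * (\<i> * pi))) * X'"
proof -
  let ?J = "{..<m} - {i}"
  \<comment> \<open>The open disc of radius \<open>1/G\<close> contains no pole except \<open>0\<close>; inserting \<open>1\<close> keeps \<open>G\<close> positive.\<close>
  define G where "G = Max (insert 1 ((\<lambda>j. norm (g j)) ` ?J))"
  have G: "1 \<le> G" "\<And>j. j < m \<Longrightarrow> j \<noteq> i \<Longrightarrow> norm (g j) \<le> G" "G < 2"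
    unfolding G_def using g(1) by auto
  define \<rho> where "\<rho> = 1 / G"
  have \<rho>: "1 / 2 < \<rho>" "0 < \<rho>" using G(1,3) by (auto simp: \<rho>_def field_simps)
  have g\<rho>: "norm (g j) \<le> 1 / \<rho>" if "j < m" "j \<noteq> i" for j using G(2)[OF that] by (simp add: \<rho>_def)
  have gc: "norm (g j * c) < 1" if "j < m" "j \<noteq> i" "norm c < \<rho>" for j c
  proof -
    have "norm (g j) * norm c \<le> G * norm c" using G(2)[OF that(1,2)] by (simp add: mult_right_mono)
    also have "\<dots> < G * \<rho>" using that(3) G(1) by simp
    also have "G * \<rho> = 1" using G(1) by (simp add: \<rho>_def)
    finally show ?thesis by (simp add: norm_mult)
  qed
  define B where "B j = Q' * A j * Q" for j
  have cB [simp]: "B j \<in> carrier_mat m m" for j using A Q by (simp add: B_def square_mat_assoc[where m = m])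
  note [simp] = A S(1) Q(1,2)
  have Bi: "B i = diagonal m \<mu>"
  proof -
    have "B i = Q' * (A i * Q)" by (simp add: B_def square_mat_assoc[where m = m])
    also have "\<dots> = (Q' * Q) * diagonal m \<mu>" unfolding AQ by (simp add: square_mat_assoc[where m = m])
    finally show ?thesis by (simp add: Q(4) square_mat_assoc[where m = m])
  qed
  have Q'S: "Q' * S = diagonal m sg * Q'"
  proof -
    have "Q' * S = Q' * (S * Q) * Q'" by (simp add: square_mat_assoc[where m = m] Q(3) right_mult_one_mat[OF S(1)])
    also have "\<dots> = (Q' * Q) * diagonal m sg * Q'" unfolding SQ by (simp add: square_mat_assoc[where m = m])
    finally show ?thesis by (simp add: Q(4) square_mat_assoc[where m = m])
  qed
  \<comment> \<open>In the eigenbasis, conjugation by \<open>S\<close> multiplies entries by signs.\<close>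
  have B\<sigma>: "sg r * B j $$ (r, s) * sg s = B (\<sigma> j) $$ (r, s)" if "j < m" "r < m" "s < m" for j r s
  proof -
    have "diagonal m sg * B j * diagonal m sg = (diagonal m sg * Q') * A j * (Q * diagonal m sg)"
      by (simp add: B_def square_mat_assoc[where m = m])
    also have "\<dots> = Q' * (S * A j * S) * Q"
      unfolding Q'S[symmetric] SQ[symmetric] by (simp add: square_mat_assoc[where m = m])
    finally have "diagonal m sg * B j * diagonal m sg = B (\<sigma> j)" using SAS[OF that(1)] by (simp add: B_def)
    then show ?thesis
      using diagonal_mult_entry(2)[OF mult_carrier_mat[OF diagonal_carrier cB] that(2,3), of sg j sg]
        diagonal_mult_entry(1)[OF cB that(2,3), of sg j] by simp
  qed
  define R where "R r s = (\<Sum>j\<in>?J. fps_const (B j $$ (r, s)) * geom_fps (g j))" for r s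
  have Rn: "fps_nth (R r s) n = (\<Sum>j\<in>?J. B j $$ (r, s) * (g j * (- g j) ^ n))" for r s n
    by (simp add: R_def fps_sum_nth geom_fps_def)
  define C where "C = (\<Sum>r<m. \<Sum>s<m. \<Sum>j\<in>?J. norm (B j $$ (r, s)) * norm (g j))"
  have Rbound: "norm (fps_nth (R r s) n) \<le> C / \<rho> ^ n" if rs: "r < m" "s < m" for r s n
  proof -
    have "norm (fps_nth (R r s) n) \<le> (\<Sum>j\<in>?J. norm (B j $$ (r, s)) * norm (g j) * norm (g j) ^ n)"
      unfolding Rn by (rule order.trans[OF norm_sum]) (simp add: norm_mult norm_power mult.assoc)
    also have "\<dots> \<le> (\<Sum>j\<in>?J. norm (B j $$ (r, s)) * norm (g j) * (1 / \<rho>) ^ n)"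
      by (intro sum_mono mult_left_mono power_mono g\<rho>) auto
    also have "\<dots> = (\<Sum>j\<in>?J. norm (B j $$ (r, s)) * norm (g j)) / \<rho> ^ n"
      by (simp add: sum_divide_distrib power_divide)
    also have "\<dots> \<le> C / \<rho> ^ n"
    proof (rule divide_right_mono)
      have "(\<Sum>j\<in>?J. norm (B j $$ (r, s)) * norm (g j)) \<le> (\<Sum>s<m. \<Sum>j\<in>?J. norm (B j $$ (r, s)) * norm (g j))"
        by (rule member_le_sum) (use rs in \<open>auto intro: sum_nonneg\<close>)
      also have "\<dots> \<le> C" unfolding C_def
        by (rule member_le_sum) (use rs in \<open>auto intro!: sum_nonneg\<close>)
      finally show "(\<Sum>j\<in>?J. norm (B j $$ (r, s)) * norm (g j)) \<le> C" .
    qed (use \<rho> in simp)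
    finally show ?thesis .
  qed
  have evalR: "eval_fps (R r s) c = (\<Sum>j\<in>?J. B j $$ (r, s) * (g j / (1 + g j * c)))" if "norm c < \<rho>" for r s c
  proof -
    have "(\<lambda>n. \<Sum>j\<in>?J. B j $$ (r, s) * fps_nth (geom_fps (g j)) n * c ^ n) sums
      (\<Sum>j\<in>?J. B j $$ (r, s) * (g j / (1 + g j * c)))"
      by (intro sums_sum geom_fps_sums gc) (use that in auto)
    then show ?thesis by (simp add: eval_fps_def R_def fps_sum_nth sum_distrib_right sums_unique[symmetric])
  qed
  \<comment> \<open>The residues are permuted in the way \<open>c \<mapsto> -c\<close> permutes the poles, so together the two operations change the sign of \<open>R(c)\<close>.\<close>
  have Rpar: "sg r * fps_nth (R r u) n * sg u = (- 1) ^ Suc n * fps_nth (R r u) n" if "r < m" "u < m" for r u n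
  proof -
    have "sg r * fps_nth (R r u) n * sg u = (\<Sum>j\<in>?J. (sg r * B j $$ (r, u) * sg u) * (g j * (- g j) ^ n))"
      by (simp add: Rn sum_distrib_left sum_distrib_right mult_ac)
    also have "\<dots> = (\<Sum>j\<in>?J. B (\<sigma> j) $$ (r, u) * (g j * (- g j) ^ n))"
      by (intro sum.cong refl) (use B\<sigma> that in auto)
    also have "\<dots> = (\<Sum>j\<in>?J. B j $$ (r, u) * (g (\<sigma> j) * (- g (\<sigma> j)) ^ n))"
    proof (rule sum.reindex_bij_witness[of _ \<sigma> \<sigma>])
      fix j assume "j \<in> ?J"
      then show "\<sigma> j \<in> ?J" using \<sigma> i by (auto dest: arg_cong[of _ _ \<sigma>])
      then show "\<sigma> j \<in> ?J" .
    qed (use \<sigma> in auto)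
    also have "\<dots> = (\<Sum>j\<in>?J. (- 1) ^ Suc n * (B j $$ (r, u) * (g j * (- g j) ^ n)))"
    proof (intro sum.cong refl)
      fix j assume "j \<in> ?J"
      then have "g (\<sigma> j) = - g j" using g(2) by auto
      moreover have "g j ^ n = (- 1) ^ n * (- g j) ^ n" by (simp flip: power_mult_distrib)
      ultimately show "B j $$ (r, u) * (g (\<sigma> j) * (- g (\<sigma> j)) ^ n) =
        (- 1) ^ Suc n * (B j $$ (r, u) * (g j * (- g j) ^ n))"
        by (simp only: minus_minus power_Suc mult_ac mult_minus_left mult_minus_right mult_1_left)
    qed
    finally show ?thesis by (simp add: Rn sum_distrib_left)
  qed
  define H where "H c = Matrix.mat m m (\<lambda>(r, s). eval_fps (frob m \<mu> R r s) c)" for c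
  define K where "K c = Matrix.mat m m (\<lambda>(r, s). eval_fps (frob_inv m \<mu> R r s) c)" for c
  define E where "E x = diagonal m (\<lambda>r. exp (\<mu> r * x))" for x
  define \<Phi> where "\<Phi> c = Q * (H c * E (Ln (\<i> * c)))" for c
  define \<Psi> where "\<Psi> c = E (- Ln (\<i> * c)) * K c * Q'" for c
  have [simp]: "H c \<in> carrier_mat m m" "K c \<in> carrier_mat m m" "E c \<in> carrier_mat m m" for c
    by (auto simp: H_def K_def E_def)
  have EE: "E x * E y = E (x + y)" for x y
    by (simp add: E_def diagonal_mult_diagonal distrib_left exp_add)
  have fp1: "fundamental_pair m (slit_disc \<rho>)
      (\<lambda>c. Q * Matrix.mat m m (\<lambda>(r, s). (if r = s then \<mu> r else 0) / c + eval_fps (R r s) c) * Q') \<Phi> \<Psi>"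
    unfolding \<Phi>_def \<Psi>_def E_def H_def K_def
    using fundamental_pair_conj[OF fuchsian_fundamental_pair(1)[OF nr \<rho>(2) Rbound] Q(1,2,4)] .
  have fp: "fundamental_pair m (slit_disc \<rho>) (\<lambda>c. Matrix.mat m m (\<lambda>(r, s). \<Sum>j<m. A j $$ (r, s) * f i j c)) \<Phi> \<Psi>"
  proof (rule fundamental_pair_cong[OF fp1])
    fix c assume "c \<in> slit_disc \<rho>"
    then have c: "norm c < \<rho>" by (simp add: slit_disc_def)
    have "Matrix.mat m m (\<lambda>(r, s). (if r = s then \<mu> r else 0) / c + eval_fps (R r s) c) =
      Matrix.mat m m (\<lambda>(r, s). \<Sum>j<m. B j $$ (r, s) * f i j c)"
    proof (rule cong_mat[OF refl refl], clarify)
      fix r s assume rs: "r < m" "s < m"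
      have "(\<Sum>j<m. B j $$ (r, s) * f i j c) = B i $$ (r, s) * f i i c + (\<Sum>j\<in>?J. B j $$ (r, s) * f i j c)"
        using i(1) by (intro sum.remove) auto
      also have "(\<Sum>j\<in>?J. B j $$ (r, s) * f i j c) = eval_fps (R r s) c"
        unfolding evalR[OF c] by (intro sum.cong refl) (auto simp: f_def)
      finally show "(if r = s then \<mu> r else 0) / c + eval_fps (R r s) c = (\<Sum>j<m. B j $$ (r, s) * f i j c)"
        using rs by (simp add: Bi f_def diagonal_def)
    qed
    moreover have "Q * Matrix.mat m m (\<lambda>(r, s). \<Sum>j<m. B j $$ (r, s) * f i j c) * Q' =
      Matrix.mat m m (\<lambda>(r, s). \<Sum>j<m. A j $$ (r, s) * f i j c)" (is "?L = ?R")
    proof (rule eq_matI)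
      fix r s assume "r < dim_row ?R" "s < dim_col ?R"
      then have rs: "r < m" "s < m" by auto
      have "Q * B j * Q' = A j" for j
      proof -
        have "Q * B j * Q' = (Q * Q') * A j * (Q * Q')" by (simp add: B_def square_mat_assoc[where m = m])
        then show ?thesis by (simp add: Q(3) square_mat_assoc[where m = m] right_mult_one_mat[OF A])
      qed
      then show "?L $$ (r, s) = ?R $$ (r, s)"
        using rs by (subst conj_sum_entry[OF Q(1,2) cB rs]) simp
    qed (use carrier_matD[OF Q(1)] carrier_matD[OF Q(2)] in auto)
    ultimately show "Matrix.mat m m (\<lambda>(r, s). \<Sum>j<m. A j $$ (r, s) * f i j c) =
      Q * Matrix.mat m m (\<lambda>(r, s). (if r = s then \<mu> r else 0) / c + eval_fps (R r s) c) * Q'" by simp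
  qed simp
  define X where "X = Q * H (- 1 / 2)"
  define X' where "X' = K (- 1 / 2) * Q'"
  have KH: "K (- 1 / 2) * H (- 1 / 2) = 1\<^sub>m m" unfolding H_def K_def
    by (rule fuchsian_fundamental_pair(2)[OF nr \<rho>(2) Rbound]) (use \<rho> in auto)
  have X [simp]: "X \<in> carrier_mat m m" "X' \<in> carrier_mat m m" by (simp_all add: X_def X'_def square_mat_assoc[where m = m])
  have "X' * X = K (- 1 / 2) * ((Q' * Q) * H (- 1 / 2))" by (simp add: X_def X'_def square_mat_assoc[where m = m])
  then have X'X: "X' * X = 1\<^sub>m m" using KH by (simp add: Q(4) square_mat_assoc[where m = m])
  have XX': "X * X' = 1\<^sub>m m" by (rule mat_mult_left_right_inverse[OF X(2,1) X'X])
  have Hpar: "diagonal m sg * H (1 / 2) = H (- 1 / 2) * diagonal m sg"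
  proof (rule eq_matI)
    fix r s assume "r < dim_row (H (- 1 / 2) * diagonal m sg)" "s < dim_col (H (- 1 / 2) * diagonal m sg)"
    then have rs: "r < m" "s < m" by (auto simp: H_def diagonal_def)
    have "ereal (norm (- 1 / 2 :: complex)) < fps_conv_radius (frob m \<mu> R r s)"
      by (rule less_le_trans[OF _ frob_conv_radius[OF \<rho>(2) Rbound rs]]) (use \<rho> in auto)
    from eval_frob_parity[OF sg Rpar rs this]
    have "sg r * H (1 / 2) $$ (r, s) = H (- 1 / 2) $$ (r, s) * sg s" using rs by (simp add: H_def)
    then show "(diagonal m sg * H (1 / 2)) $$ (r, s) = (H (- 1 / 2) * diagonal m sg) $$ (r, s)"
      using rs by (simp add: diagonal_mult_entry[of _ m] del: index_mult_mat(1))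
  qed (auto simp: H_def diagonal_def)
  \<comment> \<open>The half circle below the origin raises the argument by \<open>\<pi>\<close>.\<close>
  have Ln_diff: "Ln (\<i> * (1 / 2)) - Ln (\<i> * (- 1 / 2)) = \<i> * pi"
  proof -
    have half: "Ln (1 / 2) = of_real (ln (1 / 2))" using Ln_of_real[of "1 / 2"] by simp
    have A: "Ln (\<i> * (1 / 2)) = of_real (ln (1 / 2)) + \<i> * (pi / 2)"
      using Ln_times_of_real[of "1 / 2" \<i>] half by (simp add: mult.commute)
    have B: "Ln (\<i> * (- 1 / 2)) = of_real (ln (1 / 2)) - \<i> * (pi / 2)"
      using Ln_times_of_real[of "1 / 2" "- \<i>"] half by (simp add: mult.commute)
    show ?thesis unfolding A B by simp
  qed
  have dd: "diagonal m sg * E (\<i> * pi) = diagonal m (\<lambda>s. sg s * exp (\<mu> s * (\<i> * pi)))"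
    by (simp add: E_def diagonal_mult_diagonal)
  let ?L1 = "Ln (\<i> * (1 / 2))" and ?L0 = "Ln (\<i> * (- 1 / 2))"
  have "S * \<Phi> (1 / 2) * \<Psi> (- 1 / 2) = (S * Q) * H (1 / 2) * (E ?L1 * E (- ?L0)) * K (- 1 / 2) * Q'"
    by (simp add: \<Phi>_def \<Psi>_def square_mat_assoc[where m = m])
  also have "E ?L1 * E (- ?L0) = E (\<i> * pi)" unfolding EE using Ln_diff by simp
  also have "(S * Q) * H (1 / 2) * E (\<i> * pi) * K (- 1 / 2) * Q' =
      Q * (diagonal m sg * H (1 / 2)) * E (\<i> * pi) * K (- 1 / 2) * Q'"
    unfolding SQ by (simp add: square_mat_assoc[where m = m])
  also have "\<dots> = X * (diagonal m sg * E (\<i> * pi)) * X'"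
    unfolding Hpar by (simp add: X_def X'_def square_mat_assoc[where m = m])
  finally have "S * \<Phi> (1 / 2) * \<Psi> (- 1 / 2) = X * diagonal m (\<lambda>s. sg s * exp (\<mu> s * (\<i> * pi))) * X'"
    unfolding dd .
  from that[OF \<rho>(1) fp gc X XX' X'X this] show thesis .
qed

section \<open>The line through the base point and its mirror image\<close>

lemma form_line: "form m j (h + c *s a) = form m j h + c * form m j a"
  by (simp add: form_def algebra_simps)

lemma form_smult: "form m j (c *s a) = c * form m j a"
  by (simp add: form_def algebra_simps)

lemma refl_polar:
  "refl m i *v vector [r * cos \<theta>, r * sin \<theta>] =
     vector [r * cos (2 * angle m i - \<theta>), r * sin (2 * angle m i - \<theta>)]"
  by (simp add: refl_def Finite_Cartesian_Product.vec_eq_iff forall_2 matrix_vector_mult_def sum_2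
      cos_diff sin_diff algebra_simps)

text \<open>The midpoint lies on \<open>H\<^sub>i\<close> and the difference is orthogonal to it, so in polar coordinates the forms
  become products of a sine and a cosine.\<close>

lemma form_midpoint_and_normal:
  assumes p: "p = vector [r * cos \<theta>, r * sin \<theta>]"
  shows "form m j (cplx ((1 / 2) *\<^sub>R (p + refl m i *v p))) =
      of_real (r * cos (\<theta> - angle m i) * sin (angle m j - angle m i))"
    and "form m j (cplx (refl m i *v p - p)) =
      of_real (2 * r * sin (\<theta> - angle m i) * cos (angle m j - angle m i))"
proof -
  define x \<phi> where "x = \<theta> - angle m i" and "\<phi> = angle m i"
  have \<theta>: "\<theta> = \<phi> + x" "2 * angle m i - \<theta> = \<phi> - x" by (simp_all add: x_def \<phi>_def)
  have q: "refl m i *v p = vector [r * cos (\<phi> - x), r * sin (\<phi> - x)]" unfolding p refl_polar \<theta>(2) ..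
  have "sin (angle m j) * ((r * cos (\<phi> + x) + r * cos (\<phi> - x)) / 2)
      - cos (angle m j) * ((r * sin (\<phi> + x) + r * sin (\<phi> - x)) / 2) = r * cos x * sin (angle m j - \<phi>)"
    by (simp add: cos_add cos_diff sin_add sin_diff algebra_simps)
  then show "form m j (cplx ((1 / 2) *\<^sub>R (p + refl m i *v p))) =
      of_real (r * cos (\<theta> - angle m i) * sin (angle m j - angle m i))"
    unfolding q unfolding p \<theta>(1) x_def[symmetric] \<phi>_def[symmetric] form_def cplx_def
    by (simp flip: of_real_mult of_real_diff of_real_add of_real_divide add: add_divide_distrib)
  have "sin (angle m j) * (r * cos (\<phi> - x) - r * cos (\<phi> + x))
      - cos (angle m j) * (r * sin (\<phi> - x) - r * sin (\<phi> + x)) = 2 * r * sin x * cos (angle m j - \<phi>)"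
    by (simp add: cos_add cos_diff sin_add sin_diff algebra_simps)
  then show "form m j (cplx (refl m i *v p - p)) =
      of_real (2 * r * sin (\<theta> - angle m i) * cos (angle m j - angle m i))"
    unfolding q unfolding p \<theta>(1) x_def[symmetric] \<phi>_def[symmetric] form_def cplx_def
    by (simp flip: of_real_mult of_real_diff of_real_add of_real_divide)
qed

lemma sector_elim:
  assumes "p \<in> sector m"
  obtains r \<theta> where "p = vector [r * cos \<theta>, r * sin \<theta>]" "0 < r" "0 < \<theta>" "\<theta> < pi / real m"
  using assms by (auto simp: sector_def)

text \<open>With \<open>\<delta>\<close> the angle from \<open>H\<^sub>i\<close> to \<open>p\<close>, the arguments are the angles from \<open>s\<^sub>i(p)\<close> and from \<open>p\<close> to \<open>H\<^sub>j\<close>.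
  Positivity of the product of sines says that both points lie on the same side of \<open>H\<^sub>j\<close>.\<close>

lemma angle_sub_bounds:
  assumes m: "m \<ge> 2" and ij: "i < m" "j < m" "j \<noteq> i" and \<delta>: "\<bar>\<delta>\<bar> < pi / real m"
  shows "0 < sin (angle m j - angle m i + \<delta>) * sin (angle m j - angle m i - \<delta>)"
proof -
  define n where "n = pi / real m"
  have n: "0 < n" "real m * n = pi" using m by (auto simp: n_def)
  have ang: "angle m j = real j * n" "angle m i = real i * n" by (auto simp: angle_def n_def)
  consider "j > i" | "j < i" using ij by linarith
  then show ?thesis
  proof cases
    case 1
    have "1 * n \<le> (real j - real i) * n" "(real j - real i) * n \<le> (real m - 1) * n"
      using 1 ij n by (intro mult_right_mono; linarith)+
    then have b: "n \<le> angle m j - angle m i" "angle m j - angle m i \<le> pi - n"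
      using n by (simp_all add: ang algebra_simps)
    show ?thesis using b \<delta> unfolding n_def[symmetric] by (intro mult_pos_pos sin_gt_zero) linarith+
  next
    case 2
    have "1 * n \<le> (real i - real j) * n" "(real i - real j) * n \<le> (real m - 1) * n"
      using 2 ij n by (intro mult_right_mono; linarith)+
    then have b: "n \<le> angle m i - angle m j" "angle m i - angle m j \<le> pi - n"
      using n by (simp_all add: ang algebra_simps)
    have "0 < sin (angle m i - angle m j - \<delta>)" "0 < sin (angle m i - angle m j + \<delta>)"
      using b \<delta> unfolding n_def[symmetric] by (intro sin_gt_zero; linarith)+
    then have "0 < sin (angle m i - angle m j - \<delta>) * sin (angle m i - angle m j + \<delta>)" by (rule mult_pos_pos)
    moreover have "sin (angle m j - angle m i + \<delta>) = - sin (angle m i - angle m j - \<delta>)"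
      "sin (angle m j - angle m i - \<delta>) = - sin (angle m i - angle m j + \<delta>)"
      unfolding sin_minus[symmetric] by (simp_all add: algebra_simps)
    ultimately show ?thesis by simp
  qed
qed

text \<open>The coordinate of the intersection of the line with \<open>H\<^sub>j\<close> is \<open>-1/g\<^sub>j\<close> for \<open>g\<^sub>j = f\<^sub>j(a) / f\<^sub>j(h)\<close>. Because
  \<open>p\<close> and \<open>s\<^sub>i(p)\<close> lie in chambers adjacent along \<open>H\<^sub>i\<close>, no other mirror separates them, which is
  \<open>\<bar>g\<^sub>j\<bar> < 2\<close>; and as \<open>s\<^sub>i\<close> fixes \<open>h\<close> and negates \<open>a\<close>, it negates these coordinates.\<close>

lemma segment_geometry:
  fixes i :: nat
  assumes m: "m \<ge> 2" and p: "p \<in> sector m" and i: "i \<in> {0, 1}"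
  defines "h \<equiv> cplx ((1 / 2) *\<^sub>R (p + refl m i *v p))" and "a \<equiv> cplx (refl m i *v p - p)"
  shows "form m i h = 0" "form m i a \<noteq> 0"
    and "\<And>j. j < m \<Longrightarrow> j \<noteq> i \<Longrightarrow> form m j h \<noteq> 0 \<and> norm (form m j a / form m j h) < 2"
    and "\<And>j. j < m \<Longrightarrow> j \<noteq> i \<Longrightarrow>
      form m (act_idx m (refl m i) j) a / form m (act_idx m (refl m i) j) h = - (form m j a / form m j h)"
proof -
  obtain r \<theta> where r: "p = vector [r * cos \<theta>, r * sin \<theta>]" "0 < r" "0 < \<theta>" "\<theta> < pi / real m"
    using sector_elim[OF p] .
  define \<delta> where "\<delta> = \<theta> - angle m i"
  have im: "i < m" using i m by auto
  have angi: "angle m i = 0 \<or> angle m i = pi / real m" using i by (auto simp: angle_def)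
  have \<delta>: "\<bar>\<delta>\<bar> < pi / real m" "\<delta> \<noteq> 0" using r angi by (auto simp: \<delta>_def)
  have "pi / real m \<le> pi / 2" using m by (intro divide_left_mono) auto
  then have cos: "0 < cos \<delta>" using \<delta> by (intro cos_gt_zero_pi) linarith+
  have sin: "sin \<delta> \<noteq> 0"
  proof -
    have "\<bar>\<delta>\<bar> < pi" using \<delta>(1) \<open>pi / real m \<le> pi / 2\<close> pi_gt_zero by linarith
    then have "sin \<bar>\<delta>\<bar> > 0" using \<delta>(2) by (intro sin_gt_zero) auto
    then show ?thesis by (auto simp: abs_if split: if_splits)
  qed
  note F = form_midpoint_and_normal[OF r(1), of m _ i, folded \<delta>_def h_def a_def]
  show "form m i h = 0" "form m i a \<noteq> 0" using F[of i] r(2) sin by auto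
  have key: "\<bar>sin \<delta> * cos (angle m j - angle m i)\<bar> < \<bar>cos \<delta> * sin (angle m j - angle m i)\<bar>"
    if "j < m" "j \<noteq> i" for j
  proof -
    define x where "x = angle m j - angle m i"
    have "0 < sin (x + \<delta>) * sin (x - \<delta>)"
      unfolding x_def by (rule angle_sub_bounds[OF m im that \<delta>(1)])
    also have "\<dots> = (cos \<delta> * sin x)\<^sup>2 - (sin \<delta> * cos x)\<^sup>2"
      by (simp add: sin_add sin_diff power2_eq_square algebra_simps)
    finally have "(sin \<delta> * cos x)\<^sup>2 < (cos \<delta> * sin x)\<^sup>2" by simp
    then show ?thesis unfolding x_def[symmetric] by (metis abs_le_square_iff not_le)
  qed
  show 3: "form m j h \<noteq> 0 \<and> norm (form m j a / form m j h) < 2" if j: "j < m" "j \<noteq> i" for j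
  proof
    have "\<bar>cos \<delta> * sin (angle m j - angle m i)\<bar> > 0" using key[OF j] by linarith
    then show nz: "form m j h \<noteq> 0" unfolding F(1) of_real_eq_0_iff using r(2) by auto
    have nh: "norm (form m j h) = r * \<bar>cos \<delta> * sin (angle m j - angle m i)\<bar>"
      unfolding F(1) norm_of_real using r(2) by (simp add: abs_mult)
    have na: "norm (form m j a) = 2 * r * \<bar>sin \<delta> * cos (angle m j - angle m i)\<bar>"
      unfolding F(2) norm_of_real using r(2) by (simp add: abs_mult)
    have "norm (form m j a) < 2 * norm (form m j h)" unfolding nh na using key[OF j] r(2) by simp
    then show "norm (form m j a / form m j h) < 2" using nz by (simp add: norm_divide field_simps)
  qed
  fix j assume j: "j < m" "j \<noteq> i"
  define j' where "j' = act_idx m (refl m i) j"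
  have m0: "m > 0" using m by simp
  have j': "j' < m" "j' \<noteq> i"
    using act_idx_refl[OF m0 j(1)] act_idx_refl_self[OF m0 im] j unfolding j'_def by metis+
  have "int m dvd 2 * int i - int j - int j'"
    unfolding j'_def by (rule act_idx_refl(3)[OF m0 j(1)])
  then have "sin (int_angle m (2 * int i - int j - int j')) = 0"
    using sin_int_angle_eq_0_iff[OF m0] by blast
  moreover have "int_angle m (2 * int i - int j - int j') = - ((angle m j - angle m i) + (angle m j' - angle m i))"
    unfolding angle_eq_int int_angle_diff int_angle_double by simp
  ultimately have "sin (- ((angle m j - angle m i) + (angle m j' - angle m i))) = 0" by (simp only:)
  then have "sin ((angle m j - angle m i) + (angle m j' - angle m i)) = 0"
    by (simp only: sin_minus neg_equal_0_iff_equal)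
  then have cross: "cos (angle m j' - angle m i) * sin (angle m j - angle m i) =
      - cos (angle m j - angle m i) * sin (angle m j' - angle m i)"
    unfolding sin_add by (simp add: add_eq_0_iff mult.commute)
  have "form m j' a * form m j h = - form m j a * form m j' h"
  proof -
    have "2 * r * sin \<delta> * cos (angle m j' - angle m i) * (r * cos \<delta> * sin (angle m j - angle m i)) =
      2 * r * sin \<delta> * (r * cos \<delta>) * (cos (angle m j' - angle m i) * sin (angle m j - angle m i))" by simp
    also have "\<dots> = - (2 * r * sin \<delta> * cos (angle m j - angle m i)) * (r * cos \<delta> * sin (angle m j' - angle m i))"
      unfolding cross by simp
    finally show ?thesis unfolding F of_real_mult[symmetric] of_real_minus[symmetric] by (simp only:)
  qed
  then show "form m (act_idx m (refl m i) j) a / form m (act_idx m (refl m i) j) h = - (form m j a / form m j h)"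
    using 3[OF j] 3[OF j'] unfolding j'_def[symmetric] by (simp add: field_simps)
qed

text \<open>The path \<open>sigma_path\<close> in the coordinate \<open>c\<close> of the line.\<close>

definition segment_path :: "real \<Rightarrow> real \<Rightarrow> complex" where
  "segment_path \<tau> = linepath (- 1 / 2) (of_real (\<tau> - 1 / 2)) +++
     (\<lambda>t. of_real (\<tau> - 1 / 2) * exp (of_real pi * \<i> * of_real t)) +++
     linepath (of_real (1 / 2 - \<tau>)) (1 / 2)"

lemma segment_path_ends: "segment_path \<tau> 0 = - 1 / 2" "segment_path \<tau> 1 = 1 / 2"
  by (simp_all add: segment_path_def joinpaths_def linepath_def)

lemma valid_segment_path: "valid_path (segment_path \<tau>)"
proof -
  have lin: "valid_path (linepath x y)" for x y :: complex
    unfolding valid_path_def linepath_def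
    by (intro C1_differentiable_imp_piecewise)
      (auto simp: C1_differentiable_on_def intro!: exI[of _ "\<lambda>_. y - x"] derivative_eq_intros simp: algebra_simps)
  have arc: "valid_path (\<lambda>t. of_real (\<tau> - 1 / 2) * exp (of_real pi * \<i> * of_real t) :: complex)"
    unfolding valid_path_def
  proof (rule C1_differentiable_imp_piecewise, unfold C1_differentiable_on_def, intro exI conjI ballI)
    fix t :: real
    have "((\<lambda>z. of_real (\<tau> - 1 / 2) * exp (of_real pi * \<i> * z) :: complex) has_field_derivative
        of_real (\<tau> - 1 / 2) * (exp (of_real pi * \<i> * of_real t) * (of_real pi * \<i>))) (at (of_real t))"
      by (auto intro!: derivative_eq_intros)
    then show "((\<lambda>t. of_real (\<tau> - 1 / 2) * exp (of_real pi * \<i> * of_real t) :: complex) has_vector_derivative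
        of_real (\<tau> - 1 / 2) * (exp (of_real pi * \<i> * of_real t) * (of_real pi * \<i>))) (at t)"
      by (rule has_vector_derivative_real_field)
  qed (intro continuous_intros)
  show ?thesis
    unfolding segment_path_def
    by (intro valid_path_join lin arc) (simp_all add: pathstart_def pathfinish_def joinpaths_def linepath_def exp_pi_i')
qed

lemma segment_path_image:
  assumes \<tau>: "0 < \<tau>" "\<tau> < 1 / 2" and \<rho>: "1 / 2 < \<rho>"
  shows "segment_path \<tau> ` {0..1} \<subseteq> slit_disc \<rho>"
proof -
  have slit: "c \<in> slit_disc \<rho>" if "norm c \<le> 1 / 2" "Re c = 0 \<Longrightarrow> Im c < 0" for c
    using that \<rho> by (auto simp: slit_disc_def complex_nonpos_Reals_iff not_le)
  have "linepath (complex_of_real x) (of_real y) t \<in> slit_disc \<rho>"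
    if "t \<in> {0..1}" "\<bar>x\<bar> \<le> 1 / 2" "\<bar>y\<bar> \<le> 1 / 2" "x * y > 0" for x y t
  proof -
    have eq: "linepath (complex_of_real x) (of_real y) t = of_real (linepath x y t)"
      by (simp add: linepath_def scaleR_conv_of_real)
    have "linepath x y t \<in> closed_segment x y" using that(1) linepath_in_path by blast
    then have "\<bar>linepath x y t\<bar> \<le> 1 / 2 \<and> linepath x y t \<noteq> 0"
      using that(2-4) by (auto simp: closed_segment_eq_real_ivl zero_less_mult_iff split: if_splits)
    then show ?thesis unfolding eq by (intro slit) auto
  qed
  note lin = this
  have 1: "path_image (linepath (- 1 / 2) (complex_of_real (\<tau> - 1 / 2))) \<subseteq> slit_disc \<rho>"
    using lin[of _ "- 1 / 2" "\<tau> - 1 / 2"] \<tau> by (auto simp: path_image_def)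
  have 3: "path_image (linepath (complex_of_real (1 / 2 - \<tau>)) (1 / 2)) \<subseteq> slit_disc \<rho>"
    using lin[of _ "1 / 2 - \<tau>" "1 / 2"] \<tau> by (auto simp: path_image_def)
  have 2: "path_image (\<lambda>t. of_real (\<tau> - 1 / 2) * exp (of_real pi * \<i> * of_real t) :: complex) \<subseteq> slit_disc \<rho>"
  proof (clarsimp simp: path_image_def)
    fix t :: real assume t: "0 \<le> t" "t \<le> 1"
    have sin: "0 \<le> sin (pi * t)" using t by (intro sin_ge_zero) auto
    have eq: "(of_real \<tau> - 1 / 2) * exp (of_real pi * \<i> * of_real t) = of_real (\<tau> - 1 / 2) * cis (pi * t)"
      by (simp add: cis_conv_exp mult_ac)
    show "(of_real \<tau> - 1 / 2) * exp (of_real pi * \<i> * of_real t) \<in> slit_disc \<rho>"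
      unfolding eq
    proof (rule slit)
      show "norm (of_real (\<tau> - 1 / 2) * cis (pi * t)) \<le> 1 / 2" unfolding norm_mult norm_of_real norm_cis using \<tau> by simp
      assume "Re (of_real (\<tau> - 1 / 2) * cis (pi * t)) = 0"
      then have "cos (pi * t) = 0" using \<tau> by simp
      then have "sin (pi * t) \<noteq> 0" using sin_cos_squared_add[of "pi * t"] by auto
      then have "0 < sin (pi * t)" using sin by simp
      then show "Im (of_real (\<tau> - 1 / 2) * cis (pi * t)) < 0" using \<tau> by (simp add: mult_neg_pos)
    qed
  qed
  have "path_image (segment_path \<tau>) \<subseteq> slit_disc \<rho>"
    unfolding segment_path_def using 1 2 3 path_image_join_subset by (meson Un_least order_trans)
  then show ?thesis by (simp add: path_image_def)
qed

lemma cplx_add: "cplx (x + y) = cplx x + cplx y" and cplx_diff: "cplx (x - y) = cplx x - cplx y"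
  and cplx_scaleR: "cplx (r *\<^sub>R x) = of_real r *s cplx x"
  by (simp_all add: cplx_def Finite_Cartesian_Product.vec_eq_iff)

lemma scaleR_eq_smult: "r *\<^sub>R (z :: complex^2) = of_real r *s z"
  by (simp add: Finite_Cartesian_Product.vec_eq_iff scaleR_conv_of_real[where 'a = complex])

text \<open>Since a reflection is an isometry, the inner product of \<open>p\<close> with \<open>a = s\<^sub>i(p) - p\<close> is minus half of that of \<open>a\<close> with
  itself. Hence the quotient of inner products in the half circle is \<open>\<tau> - 1/2\<close>, which centres it at the
  midpoint of the segment.\<close>

lemma sigma_path_eq:
  fixes i :: nat
  assumes "refl m i *v p \<noteq> p"
  shows "sigma_path m p \<tau> i t = cplx ((1 / 2) *\<^sub>R (p + refl m i *v p)) + segment_path \<tau> t *s cplx (refl m i *v p - p)"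
proof -
  define q where "q = refl m i *v p"
  define a where "a = q - p"
  define h where "h = (1 / 2) *\<^sub>R (p + q)"
  have orth: "inner (refl m i *v x) (refl m i *v x) = inner x x" for x
  proof -
    have "(c * y + s * z)\<^sup>2 + (s * y - c * z)\<^sup>2 = (s\<^sup>2 + c\<^sup>2) * (y\<^sup>2 + z\<^sup>2)" for c s y z :: real
      by (simp add: power2_eq_square algebra_simps)
    from this[of "cos (2 * angle m i)" "x $ 1" "sin (2 * angle m i)" "x $ 2"]
    have "(cos (2 * angle m i) * x $ 1 + sin (2 * angle m i) * x $ 2)\<^sup>2 + (sin (2 * angle m i) * x $ 1 - cos (2 * angle m i) * x $ 2)\<^sup>2
      = ((sin (2 * angle m i))\<^sup>2 + (cos (2 * angle m i))\<^sup>2) * ((x $ 1)\<^sup>2 + (x $ 2)\<^sup>2)"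
 .
    then show ?thesis
      by (simp add: refl_def inner_vec_def sum_2 matrix_vector_mult_def flip: power2_eq_square)
  qed
  have qq: "inner q q = inner p p" unfolding q_def by (rule orth)
  have a0: "inner a a \<noteq> 0" using assms by (simp add: a_def q_def)
  have pa: "inner p a = - (1 / 2) * inner a a"
    using qq by (simp add: a_def inner_diff_left inner_diff_right inner_commute field_simps)
  have coeff: "inner (p + \<tau> *\<^sub>R a) a / inner a a = \<tau> - 1 / 2"
    using a0 by (simp add: inner_add_left pa field_simps)
  have "refl m i *v q = rot m 0 *v p"
    by (simp only: q_def matrix_vector_mul_assoc refl_mult_refl)
  also have "\<dots> = p"
    by (simp add: rot_def angle_def Finite_Cartesian_Product.vec_eq_iff forall_2 matrix_vector_mult_def sum_2)
  finally have refl_q: "refl m i *v q = p" .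
  have s_p': "refl m i *v (p + \<tau> *\<^sub>R a) = q - \<tau> *\<^sub>R a"
    by (simp add: matrix_vector_right_distrib matrix_vector_mult_scaleR matrix_vector_mult_diff_distrib a_def refl_q
        q_def[symmetric] scaleR_right_diff_distrib)
  have sigma: "sigma_path m p \<tau> i = (linepath (cplx p) (cplx (p + \<tau> *\<^sub>R a)) +++
      (\<lambda>t. cplx (p + \<tau> *\<^sub>R a) - ((1 - exp (of_real pi * \<i> * of_real t)) * of_real (\<tau> - 1 / 2)) *s cplx a) +++
      linepath (cplx (q - \<tau> *\<^sub>R a)) (cplx q))"
    unfolding sigma_path_def Let_def q_def[symmetric] a_def[symmetric] coeff s_p' ..
  have pq: "cplx p = cplx h - (1 / 2) *s cplx a" "cplx q = cplx h + (1 / 2) *s cplx a"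
    by (simp_all add: h_def a_def cplx_def Finite_Cartesian_Product.vec_eq_iff field_simps)
  have parts: "linepath (cplx p) (cplx (p + \<tau> *\<^sub>R a)) t = cplx h + linepath (- 1 / 2) (of_real (\<tau> - 1 / 2)) t *s cplx a"
    "cplx (p + \<tau> *\<^sub>R a) - ((1 - exp (of_real pi * \<i> * of_real t)) * of_real (\<tau> - 1 / 2)) *s cplx a =
      cplx h + (of_real (\<tau> - 1 / 2) * exp (of_real pi * \<i> * of_real t)) *s cplx a"
    "linepath (cplx (q - \<tau> *\<^sub>R a)) (cplx q) t = cplx h + linepath (of_real (1 / 2 - \<tau>)) (1 / 2) t *s cplx a" for t
    unfolding linepath_def cplx_add cplx_diff cplx_scaleR pq
    by (simp_all add: scaleR_eq_smult scaleR_conv_of_real[where 'a = complex] Finite_Cartesian_Product.vec_eq_iff field_simps)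
  show ?thesis
    unfolding h_def[unfolded q_def, symmetric] a_def[unfolded q_def, symmetric]
      sigma segment_path_def joinpaths_def parts by simp
qed

section \<open>Flat sections and the monodromy of the quotient bundle\<close>

lemma bounded_linear_smult_vec: "bounded_linear (\<lambda>c::complex. c *s (a :: complex^2))"
  by (rule linear_conv_bounded_linear[THEN iffD1], rule linearI)
    (simp_all add: Finite_Cartesian_Product.vec_eq_iff algebra_simps)

text \<open>If \<open>M\<close> is the restriction of the connection to the line, flat sections along a path in the line are the
  solutions of the system \<open>M\<close> along the coordinate path. In the first claim the tangent vector supplied by
  \<open>flat_along\<close> is identified with the derivative of the coordinate times \<open>a\<close> by uniqueness of derivatives.\<close>

lemma flat_along_line:
  assumes \<gamma>: "\<And>t. \<gamma> t = h + c t *s a" and c: "valid_path c" "c ` {0..1} \<subseteq> D"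
    and compl: "\<And>z. z \<in> D \<Longrightarrow> h + z *s a \<in> arr_compl m"
    and M: "\<And>z c'. z \<in> D \<Longrightarrow> lk_form m \<kappa> k \<alpha> (h + z *s a) (c' *s a) = c' \<cdot>\<^sub>m M z"
    and fp: "fundamental_pair m D M \<Phi> \<Psi>"
  shows "\<And>F. flat_along m \<kappa> k \<alpha> \<gamma> F \<Longrightarrow> F 1 = \<Phi> (c 1) *\<^sub>v (\<Psi> (c 0) *\<^sub>v F 0)"
    and "\<And>w. w \<in> carrier_vec m \<Longrightarrow> \<exists>F. flat_along m \<kappa> k \<alpha> \<gamma> F \<and> F 0 = w"
proof -
  have cM: "M z \<in> carrier_mat m m" and c\<Phi>: "\<Phi> z \<in> carrier_mat m m" and c\<Psi>: "\<Psi> z \<in> carrier_mat m m" for z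
    using fp by (auto simp: fundamental_pair_def)
  have cont: "continuous_on {0..1} c" using valid_path_imp_path[OF c(1)] by (simp add: path_def)
  obtain S0 where S0: "finite S0" "\<And>t. t \<in> {0..1} - S0 \<Longrightarrow> c differentiable (at t)"
    using c(1) unfolding valid_path_def piecewise_C1_differentiable_on_def C1_differentiable_on_eq by blast
  have c': "\<exists>c'. (c has_vector_derivative c') (at t within {0..1})" if "t \<in> {0..1} - S0" for t
    using S0(2)[OF that] vector_derivative_works has_vector_derivative_at_within by blast
  have \<gamma>': "(\<gamma> has_vector_derivative d *s a) (at t within {0..1})"
    if "(c has_vector_derivative d) (at t within {0..1})" for d t
    unfolding \<gamma> using bounded_linear.has_vector_derivative[OF bounded_linear_smult_vec that, of a]
    by (auto intro!: derivative_eq_intros simp: fun_eq_iff)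
  have rhs: "vec_index (lk_form m \<kappa> k \<alpha> (\<gamma> t) (d *s a) *\<^sub>v v) j = d * vec_index (M (c t) *\<^sub>v v) j"
    if "t \<in> {0..1}" "v \<in> carrier_vec m" "j < m" for t d v j
  proof -
    have "lk_form m \<kappa> k \<alpha> (\<gamma> t) (d *s a) = d \<cdot>\<^sub>m M (c t)" unfolding \<gamma> using c(2) that(1) by (intro M) auto
    then show ?thesis
      using that cM[of "c t"] mult_vec_entry[OF smult_carrier_mat[OF cM[of "c t"]] that(2,3), of d]
        mult_vec_entry[OF cM[of "c t"] that(2,3)] by (simp add: sum_distrib_left mult.assoc)
  qed
  show "F 1 = \<Phi> (c 1) *\<^sub>v (\<Psi> (c 0) *\<^sub>v F 0)" if F: "flat_along m \<kappa> k \<alpha> \<gamma> F" for F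
  proof -
    obtain S where S: "finite S" and Sd: "\<And>t. t \<in> {0..1} - S \<Longrightarrow> \<exists>u.
        (\<gamma> has_vector_derivative u) (at t within {0..1}) \<and>
        (\<forall>j<m. ((\<lambda>s. vec_index (F s) j) has_vector_derivative
                  vec_index (lk_form m \<kappa> k \<alpha> (\<gamma> t) u *\<^sub>v F t) j) (at t within {0..1}))"
      using F unfolding flat_along_def by blast
    have cF: "F t \<in> carrier_vec m" if "t \<in> {0..1}" for t using F that by (simp add: flat_along_def)
    show ?thesis
    proof (rule fundamental_pair_transport[OF fp c(2) cont cF])
      show "finite (S \<union> S0)" using S S0 by simp
      show "continuous_on {0..1} (\<lambda>t. vec_index (F t) j)" if "j < m" for j
        using F that by (simp add: flat_along_def)
      fix t assume t: "t \<in> {0..1} - (S \<union> S0)"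
      obtain d where d: "(c has_vector_derivative d) (at t within {0..1})" using c' t by blast
      obtain u where u: "(\<gamma> has_vector_derivative u) (at t within {0..1})"
        and Fu: "\<And>j. j < m \<Longrightarrow> ((\<lambda>s. vec_index (F s) j) has_vector_derivative
                  vec_index (lk_form m \<kappa> k \<alpha> (\<gamma> t) u *\<^sub>v F t) j) (at t within {0..1})"
        using Sd t by blast
      have "u = d *s a"
        using vector_derivative_unique_within_closed_interval[of 0 1 t \<gamma> u "d *s a"] u \<gamma>'[OF d] t by auto
      then show "\<exists>c'. (c has_vector_derivative c') (at t within {0..1}) \<and>
        (\<forall>j<m. ((\<lambda>s. vec_index (F s) j) has_vector_derivative c' * vec_index (M (c t) *\<^sub>v F t) j) (at t within {0..1}))"
        using d Fu rhs[of t "F t"] cF t by auto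
    qed
  qed
  show "\<exists>F. flat_along m \<kappa> k \<alpha> \<gamma> F \<and> F 0 = w" if w: "w \<in> carrier_vec m" for w
  proof -
    define w' where "w' = \<Psi> (c 0) *\<^sub>v w"
    have w': "w' \<in> carrier_vec m" unfolding w'_def by (rule mult_mat_vec_carrier[OF c\<Psi> w])
    note sol = fundamental_pair_solution[OF fp c(2) cont w']
    have "flat_along m \<kappa> k \<alpha> \<gamma> (\<lambda>t. \<Phi> (c t) *\<^sub>v w')"
      unfolding flat_along_def
    proof (intro conjI ballI allI impI)
      show "path_image \<gamma> \<subseteq> arr_compl m" using c(2) compl by (auto simp: path_image_def \<gamma>)
      show "\<exists>S. finite S \<and> (\<forall>t\<in>{0..1} - S. \<exists>u. (\<gamma> has_vector_derivative u) (at t within {0..1}) \<and>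
        (\<forall>j<m. ((\<lambda>s. vec_index (\<Phi> (c s) *\<^sub>v w') j) has_vector_derivative
                  vec_index (lk_form m \<kappa> k \<alpha> (\<gamma> t) u *\<^sub>v (\<Phi> (c t) *\<^sub>v w')) j) (at t within {0..1})))"
      proof (intro exI[of _ S0] conjI ballI S0(1))
        fix t assume t: "t \<in> {0..1} - S0"
        obtain d where d: "(c has_vector_derivative d) (at t within {0..1})" using c' t by blast
        show "\<exists>u. (\<gamma> has_vector_derivative u) (at t within {0..1}) \<and>
          (\<forall>j<m. ((\<lambda>s. vec_index (\<Phi> (c s) *\<^sub>v w') j) has_vector_derivative
                  vec_index (lk_form m \<kappa> k \<alpha> (\<gamma> t) u *\<^sub>v (\<Phi> (c t) *\<^sub>v w')) j) (at t within {0..1}))"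
          using \<gamma>'[OF d] sol(3)[OF _ d] rhs[OF _ sol(1)] t by (intro exI[of _ "d *s a"]) auto
      qed
    qed (use sol in auto)
    moreover have "\<Phi> (c 0) *\<^sub>v w' = w"
    proof -
      have "\<Phi> (c 0) * \<Psi> (c 0) = 1\<^sub>m m"
        using fp c(2) by (intro mat_mult_left_right_inverse[OF c\<Psi> c\<Phi>]) (auto simp: fundamental_pair_def image_subset_iff)
      then show ?thesis
        unfolding w'_def using assoc_mult_mat_vec[OF c\<Phi>[of "c 0"] c\<Psi>[of "c 0"] w] w by simp
    qed
    ultimately show ?thesis by (intro exI[of _ "\<lambda>t. \<Phi> (c t) *\<^sub>v w'"]) auto
  qed
qed

text \<open>The open sector is a chamber, so the group acts freely on the orbit of its points.\<close>

lemma sector_stabilizer: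
  assumes m: "m \<ge> 2" and p: "p \<in> sector m" and w: "w \<in> dihedral m" and wp: "cact w (cplx p) = cplx p"
  shows "w = rot m 0"
proof -
  have m0: "m > 0" using m by simp
  obtain r \<theta> where r: "p = vector [r * cos \<theta>, r * sin \<theta>]" "0 < r" "0 < \<theta>" "\<theta> < pi / real m"
    using sector_elim[OF p] .
  have wp': "w *v p = p"
    using wp unfolding cact_cplx by (simp add: cplx_def Finite_Cartesian_Product.vec_eq_iff)
  show ?thesis
  proof (cases "w \<in> range (int_rot m)")
    case True
    then obtain a where a: "w = int_rot m a" by auto
    define x where "x = 2 * int_angle m a"
    have e1: "r * (cos x * cos \<theta> - sin x * sin \<theta>) = r * cos \<theta>" "r * (sin x * cos \<theta> + cos x * sin \<theta>) = r * sin \<theta>"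
      using arg_cong[OF wp', of "\<lambda>v. v $ 1"] arg_cong[OF wp', of "\<lambda>v. v $ 2"]
      by (simp_all add: a r(1) int_rot_def matrix_vector_mult_def sum_2 x_def algebra_simps)
    then have e: "cos x * cos \<theta> - sin x * sin \<theta> = cos \<theta>" "sin x * cos \<theta> + cos x * sin \<theta> = sin \<theta>"
      using r(2) by auto
    have rot: "c * (s'\<^sup>2 + c'\<^sup>2) = (c * c' - s * s') * c' + (s * c' + c * s') * s'"
      "s * (s'\<^sup>2 + c'\<^sup>2) = (s * c' + c * s') * c' - (c * c' - s * s') * s'" for c s c' s' :: real
      by (simp_all add: power2_eq_square algebra_simps)
    have "cos x * ((sin \<theta>)\<^sup>2 + (cos \<theta>)\<^sup>2) = (cos x * cos \<theta> - sin x * sin \<theta>) * cos \<theta> + (sin x * cos \<theta> + cos x * sin \<theta>) * sin \<theta>"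
      "sin x * ((sin \<theta>)\<^sup>2 + (cos \<theta>)\<^sup>2) = (sin x * cos \<theta> + cos x * sin \<theta>) * cos \<theta> - (cos x * cos \<theta> - sin x * sin \<theta>) * sin \<theta>"
      by (rule rot)+
    then have "cos x = 1" "sin x = 0" unfolding e by (simp_all flip: power2_eq_square)
    then show ?thesis by (simp add: a int_rot_def rot_def angle_def x_def)
  next
    case False
    then obtain a where a: "w = int_refl m a" using w dihedral_eq[OF m0] by auto
    define x where "x = int_angle m a"
    have e1: "r * (cos (2 * x) * cos \<theta> + sin (2 * x) * sin \<theta>) = r * cos \<theta>" "r * (sin (2 * x) * cos \<theta> - cos (2 * x) * sin \<theta>) = r * sin \<theta>"
      using arg_cong[OF wp', of "\<lambda>v. v $ 1"] arg_cong[OF wp', of "\<lambda>v. v $ 2"]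
      by (simp_all add: a r(1) int_refl_def matrix_vector_mult_def sum_2 x_def algebra_simps)
    then have e: "cos (2 * x - \<theta>) = cos \<theta>" "sin (2 * x - \<theta>) = sin \<theta>"
      using r(2) by (auto simp: cos_diff sin_diff)
    have "cos (2 * (x - \<theta>)) = cos (2 * x - \<theta> - \<theta>)" by (simp add: algebra_simps)
    also have "\<dots> = 1" unfolding cos_diff[of "2 * x - \<theta>"] e by (simp flip: power2_eq_square)
    finally have "sin (x - \<theta>) = 0" unfolding cos_double_sin by simp
    then obtain n :: int where "x - \<theta> = of_int n * pi" using sin_zero_iff_int2 by blast
    then have "\<theta> = of_int (a - n * int m) * (pi / real m)"
      using m0 by (simp add: x_def int_angle_def field_simps)
    moreover define l where "l = a - n * int m"
    ultimately have l: "\<theta> = of_int l * (pi / real m)" by simp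
    have n: "0 < pi / real m" using m0 by simp
    have "0 < of_int l * (pi / real m)" "of_int l * (pi / real m) < 1 * (pi / real m)"
      using r(3,4) l by simp_all
    then have "0 < real_of_int l" "real_of_int l < 1"
      using zero_less_mult_pos2[OF _ n] mult_less_cancel_right_pos[OF n] by blast+
    then have "0 < l" "l < 1" by linarith+
    then show ?thesis by linarith
  qed
qed

text \<open>Multiplying the group element that runs through the orbit by \<open>s\<^sub>i\<close> on the right permutes the group, so it only
  relabels the orbit.\<close>

lemma bundle_pt_refl:
  assumes m0: "m > 0" and v: "v \<in> carrier_vec m"
  shows "bundle_pt m (cplx (refl m i *v p)) v = bundle_pt m (cplx p) (iota m (refl m i) *\<^sub>v v)"
proof -
  let ?s = "refl m i"
  have s: "?s \<in> dihedral m" by (rule refl_in_dihedral[OF m0])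
  have x: "cact w (cplx (?s *v p)) = cact (w ** ?s) (cplx p)" for w
    by (simp add: cact_cplx matrix_vector_mul_assoc)
  have ss: "iota m ?s *\<^sub>v (iota m ?s *\<^sub>v v) = v"
    using v iota_refl_refl[OF m0, of i] by (simp flip: assoc_mult_mat_vec[OF iota_carrier iota_carrier v])
  have y: "iota m (w ** ?s) *\<^sub>v u = iota m w *\<^sub>v (iota m ?s *\<^sub>v u)" if "w \<in> dihedral m" "u \<in> carrier_vec m" for w u
    unfolding iota_mult[OF m0 that(1) s] by (rule assoc_mult_mat_vec[OF iota_carrier iota_carrier that(2)])
  have sv: "iota m ?s *\<^sub>v v \<in> carrier_vec m" using v by (intro mult_mat_vec_carrier[OF iota_carrier])
  have ws: "cact (w ** ?s ** ?s) z = cact w z" for w z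
    by (simp add: cact_mult[of "w ** ?s"] cact_mult[of w] flip: cact_mult[of ?s ?s])
       (simp add: refl_mult_refl rot_eq_int cact_int_rot_0)
  show ?thesis unfolding bundle_pt_def
  proof (intro equalityI subsetI)
    fix b assume "b \<in> {(cact w (cplx (?s *v p)), iota m w *\<^sub>v v) |w. w \<in> dihedral m}"
    then obtain w where w: "w \<in> dihedral m" "b = (cact w (cplx (?s *v p)), iota m w *\<^sub>v v)" by auto
    have "b = (cact (w ** ?s) (cplx p), iota m (w ** ?s) *\<^sub>v (iota m ?s *\<^sub>v v))"
      unfolding w(2) x y[OF w(1) sv] ss ..
    then show "b \<in> {(cact w (cplx p), iota m w *\<^sub>v (iota m ?s *\<^sub>v v)) |w. w \<in> dihedral m}"
      using dihedral_mult_refl[OF m0 w(1)] by blast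
  next
    fix b assume "b \<in> {(cact w (cplx p), iota m w *\<^sub>v (iota m ?s *\<^sub>v v)) |w. w \<in> dihedral m}"
    then obtain w where w: "w \<in> dihedral m" "b = (cact w (cplx p), iota m w *\<^sub>v (iota m ?s *\<^sub>v v))" by auto
    have "b = (cact (w ** ?s) (cplx (?s *v p)), iota m (w ** ?s) *\<^sub>v v)"
      unfolding w(2) x y[OF w(1) v] ws ..
    then show "b \<in> {(cact w (cplx (?s *v p)), iota m w *\<^sub>v v) |w. w \<in> dihedral m}"
      using dihedral_mult_refl[OF m0 w(1)] by blast
  qed
qed

text \<open>The fibre of the quotient bundle at a point with trivial stabilizer is identified with \<open>V\<close>.\<close>

lemma bundle_pt_inj:
  assumes m: "m \<ge> 2" and p: "p \<in> sector m" and uv: "u \<in> carrier_vec m" "v \<in> carrier_vec m"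
    and eq: "bundle_pt m (cplx p) u = bundle_pt m (cplx p) v"
  shows "u = v"
proof -
  have m0: "m > 0" using m by simp
  have "(cplx p, u) \<in> bundle_pt m (cplx p) u"
  proof -
    have "cplx p = cact (rot m 0) (cplx p)" by (simp add: rot_eq_int cact_int_rot_0)
    moreover have "u = iota m (rot m 0) *\<^sub>v u" using uv(1) by (simp add: iota_rot_0[OF m0])
    ultimately show ?thesis unfolding bundle_pt_def using rot_0_in_dihedral[OF m0] by blast
  qed
  then obtain w where w: "w \<in> dihedral m" "cplx p = cact w (cplx p)" "u = iota m w *\<^sub>v v"
    unfolding eq unfolding bundle_pt_def by auto
  have "w = rot m 0" by (rule sector_stabilizer[OF m p w(1) w(2)[symmetric]])
  then show ?thesis using w(3) uv(2) by (simp add: iota_rot_0[OF m0])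
qed

text \<open>The definite description in \<open>lk_monodromy\<close> is met: flat sections with every initial value exist,
  which forces uniqueness, and \<open>bundle_pt_refl\<close> moves the end of the path back to \<open>p\<close>.\<close>

lemma lk_monodromy_eq:
  assumes m: "m \<ge> 2" and p: "p \<in> sector m"
    and ends: "\<gamma> 0 = cplx p" "\<gamma> 1 = cplx (refl m i *v p)"
    and P: "P \<in> carrier_mat m m" "\<And>F. flat_along m \<kappa> k \<alpha> \<gamma> F \<Longrightarrow> F 1 = P *\<^sub>v F 0"
    and ex: "\<And>w. w \<in> carrier_vec m \<Longrightarrow> \<exists>F. flat_along m \<kappa> k \<alpha> \<gamma> F \<and> F 0 = w"
  shows "lk_monodromy m \<kappa> k \<alpha> \<gamma> = iota m (refl m i) * P"
  unfolding lk_monodromy_def pathstart_def pathfinish_def ends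
proof (rule the_equality)
  let ?S = "iota m (refl m i)"
  have m0: "m > 0" using m by simp
  have cSP: "?S * P \<in> carrier_mat m m" by (rule mult_carrier_mat[OF iota_carrier P(1)])
  have F01: "F 0 \<in> carrier_vec m" "F 1 \<in> carrier_vec m" if "flat_along m \<kappa> k \<alpha> \<gamma> F" for F
    using that by (auto simp: flat_along_def)
  have F1: "bundle_pt m (cplx (refl m i *v p)) (F 1) = bundle_pt m (cplx p) ((?S * P) *\<^sub>v F 0)"
    if F: "flat_along m \<kappa> k \<alpha> \<gamma> F" for F
    unfolding P(2)[OF F] bundle_pt_refl[OF m0 mult_mat_vec_carrier[OF P(1) F01(1)[OF F]]]
      assoc_mult_mat_vec[OF iota_carrier P(1) F01(1)[OF F]] ..
  show "?S * P \<in> carrier_mat m m \<and> (\<forall>F. flat_along m \<kappa> k \<alpha> \<gamma> F \<longrightarrow>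
      bundle_pt m (cplx p) ((?S * P) *\<^sub>v F 0) = bundle_pt m (cplx (refl m i *v p)) (F 1))"
    using F1 cSP by auto
  fix T assume T: "T \<in> carrier_mat m m \<and> (\<forall>F. flat_along m \<kappa> k \<alpha> \<gamma> F \<longrightarrow>
      bundle_pt m (cplx p) (T *\<^sub>v F 0) = bundle_pt m (cplx (refl m i *v p)) (F 1))"
  have Tw: "T *\<^sub>v w = (?S * P) *\<^sub>v w" if w: "w \<in> carrier_vec m" for w
  proof -
    obtain F where F: "flat_along m \<kappa> k \<alpha> \<gamma> F" "F 0 = w" using ex[OF w] by blast
    then have "bundle_pt m (cplx p) (T *\<^sub>v w) = bundle_pt m (cplx p) ((?S * P) *\<^sub>v w)"
      using T F1[OF F(1)] by auto
    then show ?thesis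
      using T by (intro bundle_pt_inj[OF m p mult_mat_vec_carrier[OF _ w] mult_mat_vec_carrier[OF cSP w]]) auto
  qed
  show "T = ?S * P"
  proof (rule eq_matI)
    fix r s assume "r < dim_row (?S * P)" "s < dim_col (?S * P)"
    then have rs: "r < m" "s < m" using cSP by auto
    have ent: "A $$ (r, s) = vec_index (A *\<^sub>v unit_vec m s) r" if "A \<in> carrier_mat m m" for A :: "complex mat"
      using that rs by (simp add: scalar_prod_right_unit)
    show "T $$ (r, s) = (?S * P) $$ (r, s)"
      unfolding ent[OF cSP] using ent[of T] T Tw[of "unit_vec m s"] by simp
  qed (use T cSP in auto)
qed

text \<open>The only eigenvalues are \<open>\<plusminus>\<kappa> k\<close> and \<open>\<kappa> k - \<kappa> a\<close>, so the only nonzero differences, up to sign, are the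
  three numbers assumed not to be integers.\<close>

lemma nonresonant_eigenvalues:
  assumes m: "m > 0" and i: "i < m"
    and A: "\<kappa> * a \<notin> \<int>" and K: "2 * (\<kappa> * k) \<notin> \<int>" and KA: "2 * (\<kappa> * k) - \<kappa> * a \<notin> \<int>"
  shows "nonresonant m (\<lambda>s. \<kappa> * (k * reflection_sign m i s - (if s = i then a else 0)))"
  unfolding nonresonant_def
proof (intro allI impI)
  fix r s n assume "r < m" "s < m"
  define \<mu> where "\<mu> s = \<kappa> * (k * reflection_sign m i s - (if s = i then a else 0))" for s
  define u w where "u = \<kappa> * k" and "w = \<kappa> * a"
  have "reflection_sign m i i = 1" using act_idx_refl_self[OF m i] by (simp add: reflection_sign_def)
  then have \<mu>: "\<mu> s = u \<or> \<mu> s = - u \<or> \<mu> s = u - w" for s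
    by (cases "s = i") (simp_all add: \<mu>_def u_def w_def reflection_sign_def right_diff_distrib)
  have no: "w \<notin> \<int>" "- w \<notin> \<int>" "u + u \<notin> \<int>" "- u - u \<notin> \<int>" "u + u - w \<notin> \<int>" "w - u - u \<notin> \<int>"
  proof -
    show 1: "w \<notin> \<int>" "u + u \<notin> \<int>" "u + u - w \<notin> \<int>" using A K KA unfolding u_def w_def mult_2 by blast+
    have neg: "x \<notin> \<int> \<Longrightarrow> - x \<notin> \<int>" for x :: complex using Ints_minus[of "- x"] by auto
    show "- w \<notin> \<int>" "- u - u \<notin> \<int>" "w - u - u \<notin> \<int>"
      using neg[OF 1(1)] neg[OF 1(2)] neg[OF 1(3)] by simp_all
  qed
  have "\<mu> r - \<mu> s \<in> {0, w, - w, u + u, - u - u, u + u - w, w - u - u}"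
    using \<mu>[of r] \<mu>[of s] by (elim disjE) simp_all
  moreover have "of_nat (Suc n) \<in> (\<int> :: complex set)" "of_nat (Suc n) \<noteq> (0 :: complex)"
    by (rule Ints_of_nat, simp only: of_nat_eq_0_iff nat.distinct not_False_eq_True)
  ultimately have "\<mu> r - \<mu> s \<noteq> of_nat (Suc n)" using no by (metis empty_iff insert_iff)
  then show "\<kappa> * (k * reflection_sign m i r - (if r = i then a else 0)) -
      \<kappa> * (k * reflection_sign m i s - (if s = i then a else 0)) \<noteq> of_nat (Suc n)"
    unfolding \<mu>_def .
qed

text \<open>The eigenvalues of the monodromy are those of \<open>\<iota>(s\<^sub>i) exp(\<pi> \<i> A\<^sub>i)\<close>, listed in the eigenbasis of the residue.\<close>

lemma lk_monodromy_diagonalizable: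
  fixes a b a' b' \<kappa> :: complex and i :: nat
  defines "k \<equiv> by_parity a b" and "\<alpha> \<equiv> by_parity a' b'"
  assumes m: "m \<ge> 2" "even m" and p: "p \<in> sector m" and i: "i \<in> {0, 1}" and \<tau>: "0 < \<tau>" "\<tau> < 1 / 2"
    and gen: "\<kappa> * \<alpha> i \<notin> \<int>" "2 * (\<kappa> * k i) \<notin> \<int>" "2 * (\<kappa> * k i) - \<kappa> * \<alpha> i \<notin> \<int>"
  obtains X X' where "X \<in> carrier_mat m m" "X' \<in> carrier_mat m m" "X * X' = 1\<^sub>m m" "X' * X = 1\<^sub>m m"
    "lk_monodromy m \<kappa> k \<alpha> (sigma_path m p \<tau> i) = X * diagonal m (\<lambda>s. reflection_sign m i s *
        exp (\<kappa> * (k i * reflection_sign m i s - (if s = i then \<alpha> i else 0)) * (\<i> * pi))) * X'"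
proof -
  have m0: "m > 0" and im: "i < m" using m i by auto
  let ?\<sigma> = "act_idx m (refl m i)" and ?S = "iota m (refl m i)" and ?A = "lk_residue m \<kappa> k \<alpha>"
  let ?\<mu> = "\<lambda>s. \<kappa> * (k i * reflection_sign m i s - (if s = i then \<alpha> i else 0))"
  define h where "h = cplx ((1 / 2) *\<^sub>R (p + refl m i *v p))"
  define v where "v = cplx (refl m i *v p - p)"
  note geo = segment_geometry[OF m(1) p i, folded h_def v_def]
  define g where "g j = form m j v / form m j h" for j
  have \<alpha>0: "\<alpha> i \<noteq> 0" using gen(1) by auto
  have \<sigma>i: "?\<sigma> i = i" by (rule act_idx_refl_self[OF m0 im])
  obtain Q Q' where Q: "Q \<in> carrier_mat m m" "Q' \<in> carrier_mat m m" "Q * Q' = 1\<^sub>m m" "Q' * Q = 1\<^sub>m m"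
    and SQ: "?S * Q = Q * diagonal m (reflection_sign m i)" and AQ: "?A i * Q = Q * diagonal m ?\<mu>"
    using lk_residue_diagonalizable[OF m0 m(2) im, of a' b' \<kappa> a b] \<alpha>0 unfolding k_def \<alpha>_def by blast
  have SAS: "?S * ?A j * ?S = ?A (?\<sigma> j)" if "j < m" for j
    unfolding k_def \<alpha>_def by (rule lk_residue_conj[OF m0 m(2) that])
  have g2: "norm (g j) < 2" "g (?\<sigma> j) = - g j" if "j < m" "j \<noteq> i" for j
    using geo(3,4)[OF that] by (auto simp: g_def)
  have nr: "nonresonant m ?\<mu>" by (rule nonresonant_eigenvalues[OF m0 im gen])
  obtain \<rho> \<Phi> \<Psi> X X' where \<rho>: "1 / 2 < \<rho>"
    and fp: "fundamental_pair m (slit_disc \<rho>)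
      (\<lambda>c. Matrix.mat m m (\<lambda>(r, s). \<Sum>j<m. ?A j $$ (r, s) * (if j = i then 1 / c else g j / (1 + g j * c)))) \<Phi> \<Psi>"
    and gc: "\<And>j c. j < m \<Longrightarrow> j \<noteq> i \<Longrightarrow> norm c < \<rho> \<Longrightarrow> norm (g j * c) < 1"
    and X: "X \<in> carrier_mat m m" "X' \<in> carrier_mat m m" "X * X' = 1\<^sub>m m" "X' * X = 1\<^sub>m m"
    and T: "?S * \<Phi> (1 / 2) * \<Psi> (- 1 / 2) = X * diagonal m (\<lambda>s. reflection_sign m i s * exp (?\<mu> s * (\<i> * pi))) * X'"
    by (rule reflection_symmetric_half_monodromy[where A = ?A and S = ?S and sg = "reflection_sign m i"
          and \<sigma> = ?\<sigma> and g = g, OF nr im \<sigma>i lk_residue_carrier iota_carrier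
          iota_refl_refl[OF m0] Q SQ AQ reflection_sign_square act_idx_refl(1,2)[OF m0] SAS g2])
      (assumption+, rule that)
  let ?M = "\<lambda>c. Matrix.mat m m (\<lambda>(r, s). \<Sum>j<m. ?A j $$ (r, s) * (if j = i then 1 / c else g j / (1 + g j * c)))"
  have vne: "refl m i *v p \<noteq> p"
    using geo(2) by (auto simp: v_def form_def cplx_def)
  have \<gamma>: "sigma_path m p \<tau> i t = h + segment_path \<tau> t *s v" for t
    unfolding h_def v_def by (rule sigma_path_eq[OF vne])
  have compl: "h + z *s v \<in> arr_compl m" if z: "z \<in> slit_disc \<rho>" for z
  proof -
    have z0: "z \<noteq> 0" "norm z < \<rho>" using z by (auto simp: slit_disc_def)
    have "form m j (h + z *s v) \<noteq> 0" if j: "j < m" for j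
    proof (cases "j = i")
      case True
      then show ?thesis using geo(1,2) z0 by (simp add: form_line)
    next
      case False
      have "1 + g j * z \<noteq> 0"
      proof
        assume "1 + g j * z = 0"
        then have "g j * z = - 1" by (simp add: add_eq_0_iff)
        then show False using gc[OF j False z0(2)] by simp
      qed
      then show ?thesis using geo(3)[OF j False] by (simp add: form_line g_def field_simps)
    qed
    then show ?thesis by (auto simp: arr_compl_def mirror_eq_kernel)
  qed
  have M: "lk_form m \<kappa> k \<alpha> (h + z *s v) (d *s v) = d \<cdot>\<^sub>m ?M z"
    if "z \<in> slit_disc \<rho>" for z d
  proof -
    have om: "omega m j (h + z *s v) (d *s v) = d * (if j = i then 1 / z else g j / (1 + g j * z))" if j: "j < m" for j
    proof (cases "j = i")
      case True
      then show ?thesis using geo(1,2) by (simp add: omega_def form_line form_smult)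
    next
      case False
      have nz: "form m j h \<noteq> 0" using geo(3)[OF j False] by simp
      have "form m j v = form m j h * g j" using nz by (simp add: g_def)
      then have "omega m j (h + z *s v) (d *s v) = d * (form m j h * g j) / (form m j h * (1 + g j * z))"
        by (simp add: omega_def form_line form_smult algebra_simps)
      then show ?thesis using False nz by simp
    qed
    show ?thesis
    proof (rule eq_matI)
      fix r s assume "r < dim_row (d \<cdot>\<^sub>m ?M z)" "s < dim_col (d \<cdot>\<^sub>m ?M z)"
      then have rs: "r < m" "s < m" by auto
      then show "lk_form m \<kappa> k \<alpha> (h + z *s v) (d *s v) $$ (r, s) = (d \<cdot>\<^sub>m ?M z) $$ (r, s)"
        by (simp add: lk_form_eq om sum_distrib_left mult.left_commute)
    qed (auto simp: lk_form_eq)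
  qed
  have flat: "F 1 = \<Phi> (1 / 2) *\<^sub>v (\<Psi> (- 1 / 2) *\<^sub>v F 0)"
    if "flat_along m \<kappa> k \<alpha> (sigma_path m p \<tau> i) F" for F
    by (rule flat_along_line(1)[OF \<gamma> valid_segment_path segment_path_image[OF \<tau> \<rho>] _ _ fp that,
          unfolded segment_path_ends]; (erule compl | erule M))
  have ex: "\<exists>F. flat_along m \<kappa> k \<alpha> (sigma_path m p \<tau> i) F \<and> F 0 = w" if "w \<in> carrier_vec m" for w
    by (rule flat_along_line(2)[OF \<gamma> valid_segment_path segment_path_image[OF \<tau> \<rho>] _ _ fp that];
        (erule compl | erule M))
  have c\<Phi>: "\<Phi> z \<in> carrier_mat m m" and c\<Psi>: "\<Psi> z \<in> carrier_mat m m" for z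
    using fp by (auto simp: fundamental_pair_def)
  have ends: "sigma_path m p \<tau> i 0 = cplx p" "sigma_path m p \<tau> i 1 = cplx (refl m i *v p)"
    unfolding \<gamma> segment_path_ends h_def v_def
    by (simp_all add: cplx_def Finite_Cartesian_Product.vec_eq_iff field_simps)
  have "lk_monodromy m \<kappa> k \<alpha> (sigma_path m p \<tau> i) = ?S * (\<Phi> (1 / 2) * \<Psi> (- 1 / 2))"
  proof (rule lk_monodromy_eq[OF m(1) p ends mult_carrier_mat[OF c\<Phi> c\<Psi>] _ ex])
    fix F assume F: "flat_along m \<kappa> k \<alpha> (sigma_path m p \<tau> i) F"
    then have "F 0 \<in> carrier_vec m" by (simp add: flat_along_def)
    then show "F 1 = \<Phi> (1 / 2) * \<Psi> (- 1 / 2) *\<^sub>v F 0"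
      using flat[OF F] assoc_mult_mat_vec[OF c\<Phi> c\<Psi>] by simp
  qed
  also have "\<dots> = ?S * \<Phi> (1 / 2) * \<Psi> (- 1 / 2)"
    by (rule assoc_mult_mat[symmetric, OF iota_carrier c\<Phi> c\<Psi>])
  finally show thesis using that[OF X] T by simp
qed

section \<open>Generic parameters and the cubic relation\<close>

lemma conj_diagonal_entry:
  assumes X: "X \<in> carrier_mat m m" "X' \<in> carrier_mat m m" and rs: "r < m" "s < m"
  shows "(X * diagonal m d * X') $$ (r, s) = (\<Sum>u<m. X $$ (r, u) * d u * X' $$ (u, s))"
  unfolding mult_mat_entry[OF mult_carrier_mat[OF X(1) diagonal_carrier] X(2) rs]
  by (intro sum.cong refl, subst diagonal_mult_entry(2)[OF X(1)]) (use rs in auto)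

text \<open>Conjugation of diagonal matrices is a homomorphism of algebras; polynomials in a diagonalizable matrix
  can so be computed eigenvalue by eigenvalue.\<close>

lemma conj_diagonal_algebra:
  assumes X: "X \<in> carrier_mat m m" "X' \<in> carrier_mat m m" "X * X' = 1\<^sub>m m" "X' * X = 1\<^sub>m m"
  defines "Z \<equiv> \<lambda>d. X * diagonal m d * X'"
  shows "Z d * Z d' = Z (\<lambda>s. d s * d' s)"
    and "Z d + c \<cdot>\<^sub>m 1\<^sub>m m = Z (\<lambda>s. d s + c)" and "Z d - c \<cdot>\<^sub>m 1\<^sub>m m = Z (\<lambda>s. d s - c)"
    and "c \<cdot>\<^sub>m Z d = Z (\<lambda>s. c * d s)"
proof -
  note [simp] = X(1,2)
  have cZ [simp]: "Z d \<in> carrier_mat m m" for d by (simp add: Z_def square_mat_assoc[where m = m])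
  have Ze: "Z d $$ (r, s) = (\<Sum>u<m. X $$ (r, u) * d u * X' $$ (u, s))" if "r < m" "s < m" for d r s
    unfolding Z_def by (rule conj_diagonal_entry[OF X(1,2) that])
  have dims: "dim_row (Z d) = m" "dim_col (Z d) = m" for d using carrier_matD[OF cZ] by auto
  have "Z d * Z d' = X * diagonal m d * ((X' * X) * (diagonal m d' * X'))"
    by (simp add: Z_def square_mat_assoc[where m = m])
  also have "\<dots> = X * (diagonal m d * diagonal m d') * X'"
    unfolding X(4) by (simp add: square_mat_assoc[where m = m])
  finally show "Z d * Z d' = Z (\<lambda>s. d s * d' s)" by (simp add: Z_def diagonal_mult_diagonal)
  have one: "(1\<^sub>m m :: complex mat) $$ (r, s) = (\<Sum>u<m. X $$ (r, u) * X' $$ (u, s))" if "r < m" "s < m" for r s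
    unfolding X(3)[symmetric] by (rule mult_mat_entry[OF X(1,2) that])
  show "Z d + c \<cdot>\<^sub>m 1\<^sub>m m = Z (\<lambda>s. d s + c)"
  proof (rule eq_matI)
    fix r s assume "r < dim_row (Z (\<lambda>s. d s + c))" "s < dim_col (Z (\<lambda>s. d s + c))"
    then have rs: "r < m" "s < m" by (simp_all add: dims)
    then have "(Z d + c \<cdot>\<^sub>m 1\<^sub>m m) $$ (r, s) = Z d $$ (r, s) + c * (1\<^sub>m m :: complex mat) $$ (r, s)" by simp
    also have "\<dots> = Z (\<lambda>s. d s + c) $$ (r, s)"
      unfolding Ze[OF rs] one[OF rs] by (simp add: sum_distrib_left sum.distrib algebra_simps)
    finally show "(Z d + c \<cdot>\<^sub>m 1\<^sub>m m) $$ (r, s) = Z (\<lambda>s. d s + c) $$ (r, s)" .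
  qed (simp_all add: dims)
  show "Z d - c \<cdot>\<^sub>m 1\<^sub>m m = Z (\<lambda>s. d s - c)"
  proof (rule eq_matI)
    fix r s assume "r < dim_row (Z (\<lambda>s. d s - c))" "s < dim_col (Z (\<lambda>s. d s - c))"
    then have rs: "r < m" "s < m" by (simp_all add: dims)
    then have "(Z d - c \<cdot>\<^sub>m 1\<^sub>m m) $$ (r, s) = Z d $$ (r, s) - c * (1\<^sub>m m :: complex mat) $$ (r, s)" by simp
    also have "\<dots> = Z (\<lambda>s. d s - c) $$ (r, s)"
      unfolding Ze[OF rs] one[OF rs] by (simp add: sum_distrib_left sum_subtractf algebra_simps)
    finally show "(Z d - c \<cdot>\<^sub>m 1\<^sub>m m) $$ (r, s) = Z (\<lambda>s. d s - c) $$ (r, s)" .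
  qed (simp_all add: dims)
  show "c \<cdot>\<^sub>m Z d = Z (\<lambda>s. c * d s)"
    by (rule eq_matI) (simp_all add: dims Ze sum_distrib_left mult_ac)
qed

lemma rank_ge_1:
  assumes A: "(A :: complex mat) \<in> carrier_mat m m" and rs: "r < m" "s < m" "A $$ (r, s) \<noteq> 0"
  shows "vec_space.rank m A \<ge> 1"
proof -
  interpret vec_space "TYPE(complex)" m .
  have c: "col A s \<in> carrier_vec m" using A rs by auto
  have empty: "lin_indpt {}" "span {} = {0\<^sub>v m}"
    using finite_lin_indpt2[of "{}"] span_zero span_empty by auto
  have "col A s \<noteq> 0\<^sub>v m"
  proof
    assume "col A s = 0\<^sub>v m"
    then have "vec_index (col A s) r = 0" using rs by simp
    then show False using A rs by simp
  qed
  then have "lin_indpt {col A s}"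
    using lin_dep_iff_in_span[of "{}" "col A s"] c empty by auto
  then have "rank A \<ge> card {col A s}"
    using A rs(2) by (intro rank_ge_card_indpt[OF A]) (auto simp: cols_def)
  then show ?thesis by simp
qed

lemma rank_conj_diagonal_single:
  assumes X: "X \<in> carrier_mat m m" "X' \<in> carrier_mat m m" "X' * X = 1\<^sub>m m"
    and i: "i < m" and d: "d i \<noteq> 0" "\<And>s. s < m \<Longrightarrow> s \<noteq> i \<Longrightarrow> d s = 0"
  shows "vec_space.rank m (X * diagonal m d * X') = 1"
proof -
  let ?E = "X * diagonal m d * X'"
  have cE: "?E \<in> carrier_mat m m" using X by (intro mult_carrier_mat[of _ m m] diagonal_carrier)
  have E: "?E $$ (r, s) = (X $$ (r, i) * d i) * X' $$ (i, s)" if "r < m" "s < m" for r s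
  proof -
    have "?E $$ (r, s) = (\<Sum>u<m. if u = i then X $$ (r, i) * d i * X' $$ (i, s) else 0)"
      unfolding conj_diagonal_entry[OF X(1,2) that] by (intro sum.cong refl) (use d in auto)
    then show ?thesis using i by simp
  qed
  have "(\<Sum>u<m. X' $$ (i, u) * X $$ (u, i)) = 1"
    using mult_mat_entry[OF X(2,1) i i] X(3) i by simp
  then obtain u where u: "u < m" "X' $$ (i, u) * X $$ (u, i) \<noteq> 0"
    by (metis (no_types, lifting) lessThan_iff sum.neutral zero_neq_one)
  have "vec_space.rank m ?E \<ge> 1"
    using u d(1) E[OF u(1) u(1)] by (intro rank_ge_1[OF cE u(1) u(1)]) simp
  moreover have "vec_space.rank m ?E \<le> 1"
    using cE E by (intro vec_space.rank_le_1_product_entries[OF cE, of "\<lambda>r. X $$ (r, i) * d i" "\<lambda>s. X' $$ (i, s)"])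
      (simp add: carrier_matD[OF cE] del: index_mult_mat)
  ultimately show ?thesis by simp
qed

lemma holo_on_const: "holo_on U (\<lambda>x. c)"
  unfolding holo_on_def by (auto intro!: exI[of _ "\<lambda>x. 0"])

lemma holo_on_nth: "holo_on U (\<lambda>x. x $ i)"
  unfolding holo_on_def
  by (auto intro!: exI[of _ "\<lambda>x. x $ i"] bounded_linear_imp_has_derivative bounded_linear_vec_nth)

lemma holo_on_diff: "holo_on U f \<Longrightarrow> holo_on U g \<Longrightarrow> holo_on U (\<lambda>x. f x - g x)"
  unfolding holo_on_def
proof (intro ballI)
  fix x assume "\<forall>x\<in>U. \<exists>f'. (f has_derivative f') (at x) \<and> (\<forall>c v. f' (c *s v) = c * f' v)"
    "\<forall>x\<in>U. \<exists>g'. (g has_derivative g') (at x) \<and> (\<forall>c v. g' (c *s v) = c * g' v)" "x \<in> U"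
  then obtain f' g' where "(f has_derivative f') (at x)" "\<And>c v. f' (c *s v) = c * f' v"
    "(g has_derivative g') (at x)" "\<And>c v. g' (c *s v) = c * g' v" by blast
  then show "\<exists>h. ((\<lambda>x. f x - g x) has_derivative h) (at x) \<and> (\<forall>c v. h (c *s v) = c * h v)"
    by (intro exI[of _ "\<lambda>v. f' v - g' v"]) (auto intro!: derivative_eq_intros simp: algebra_simps)
qed

lemma holo_on_mult: "holo_on U f \<Longrightarrow> holo_on U g \<Longrightarrow> holo_on U (\<lambda>x. f x * g x)"
  unfolding holo_on_def
proof (intro ballI)
  fix x assume "\<forall>x\<in>U. \<exists>f'. (f has_derivative f') (at x) \<and> (\<forall>c v. f' (c *s v) = c * f' v)"
    "\<forall>x\<in>U. \<exists>g'. (g has_derivative g') (at x) \<and> (\<forall>c v. g' (c *s v) = c * g' v)" "x \<in> U"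
  then obtain f' g' where "(f has_derivative f') (at x)" "\<And>c v. f' (c *s v) = c * f' v"
    "(g has_derivative g') (at x)" "\<And>c v. g' (c *s v) = c * g' v" by blast
  then show "\<exists>h. ((\<lambda>x. f x * g x) has_derivative h) (at x) \<and> (\<forall>c v. h (c *s v) = c * h v)"
    by (intro exI[of _ "\<lambda>v. f x * g' v + f' v * g x"]) (auto intro!: derivative_eq_intros simp: algebra_simps)
qed

lemma holo_on_exp: "holo_on U f \<Longrightarrow> holo_on U (\<lambda>x. exp (f x))"
  unfolding holo_on_def
proof (intro ballI)
  fix x assume "\<forall>x\<in>U. \<exists>f'. (f has_derivative f') (at x) \<and> (\<forall>c v. f' (c *s v) = c * f' v)" "x \<in> U"
  then obtain f' where f': "(f has_derivative f') (at x)" "\<And>c v. f' (c *s v) = c * f' v" by blast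
  have "((\<lambda>x. exp (f x)) has_derivative (\<lambda>v. exp (f x) * f' v)) (at x)"
    using has_derivative_compose[OF f'(1), of exp "\<lambda>y. exp (f x) * y"] DERIV_exp[of "f x"]
    by (simp add: has_field_derivative_def)
  then show "\<exists>h. ((\<lambda>x. exp (f x)) has_derivative h) (at x) \<and> (\<forall>c v. h (c *s v) = c * h v)"
    using f'(2) by (intro exI[of _ "\<lambda>v. exp (f x) * f' v"]) (auto simp: mult.left_commute)
qed

text \<open>The exceptional set is the zero set of a single entire function.\<close>

lemma generically_nonzero:
  assumes f: "holo_on UNIV f" and ne: "f x0 \<noteq> 0" and P: "\<And>x. f x \<noteq> 0 \<Longrightarrow> P x"
  shows "generically P"
  unfolding generically_def
proof (intro exI conjI allI impI)
  let ?Z = "{x. f x = 0}"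
  have "continuous_on UNIV f"
    using f unfolding holo_on_def by (metis continuous_at_imp_continuous_on has_derivative_continuous)
  then have "closed ?Z" by (simp add: closed_Collect_eq)
  then show "closed_analytic ?Z" unfolding closed_analytic_def using f
    by (auto intro!: exI[of _ UNIV] exI[of _ "{f}"])
  show "?Z \<noteq> UNIV" using ne by auto
qed (use P in auto)

text \<open>This vanishes exactly when one of \<open>\<kappa> a\<close>, \<open>2 \<kappa> k\<close>, \<open>2 \<kappa> k - \<kappa> a\<close> is an integer. Apart from resonance
  between eigenvalues of the residue, nonvanishing excludes the degenerate cases \<open>l\<^bsup>-1\<^esup> = q\<close>, \<open>q\<^bsup>-1\<^esup> = q\<close>
  and \<open>l\<^bsup>-1\<^esup> = -q\<^bsup>-1\<^esup>\<close>: with \<open>E = l q\<close> they would give \<open>E\<^sup>2 = 1\<close>, \<open>q\<^sup>4 = 1\<close> and \<open>q\<^sup>4 = E\<^sup>2\<close>.\<close>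

definition resonance_factor :: "complex \<Rightarrow> complex \<Rightarrow> complex \<Rightarrow> complex" where
  "resonance_factor \<kappa> k a = (exp (2 * (\<kappa> * a) * of_real pi * \<i>) - 1) *
     (exp (2 * (2 * (\<kappa> * k)) * of_real pi * \<i>) - 1) * (exp (2 * (2 * (\<kappa> * k) - \<kappa> * a) * of_real pi * \<i>) - 1)"

lemma resonance_factor_nonzero:
  assumes "resonance_factor \<kappa> k a \<noteq> 0"
  shows "\<kappa> * a \<notin> \<int>" "2 * (\<kappa> * k) \<notin> \<int>" "2 * (\<kappa> * k) - \<kappa> * a \<notin> \<int>"
proof -
  have one: "exp (2 * z * of_real pi * \<i>) = 1" if "z \<in> \<int>" for z :: complex
  proof -
    from that obtain n where "z = of_int n" by (rule Ints_cases)
    then show ?thesis using exp_integer_2pi[of "of_int n"] by simp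
  qed
  show "\<kappa> * a \<notin> \<int>" "2 * (\<kappa> * k) \<notin> \<int>" "2 * (\<kappa> * k) - \<kappa> * a \<notin> \<int>"
    using assms one[of "\<kappa> * a"] one[of "2 * (\<kappa> * k)"] one[of "2 * (\<kappa> * k) - \<kappa> * a"]
    unfolding resonance_factor_def mult_eq_0_iff right_minus_eq by blast+
qed

theorem lemma3p2:
  fixes m :: nat and \<kappa> :: complex and p :: "real^2"
  assumes "m \<ge> 2" and "even m" and "\<kappa> \<noteq> 0" and "p \<in> sector m"
  shows "generically (\<lambda>x :: complex^4.
    let k = by_parity (x $ 1) (x $ 2);
        \<alpha> = by_parity (x $ 3) (x $ 4);
        q = (\<lambda>i. exp (\<kappa> * k i * of_real pi * \<i>));
        l = (\<lambda>i. exp (\<kappa> * \<alpha> i * of_real pi * \<i>) / q i)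
    in \<forall>i\<in>{0, 1}. \<forall>\<tau>::real. 0 < \<tau> \<and> \<tau> < 1/2 \<longrightarrow>
        (let T = lk_monodromy m \<kappa> k \<alpha> (sigma_path m p \<tau> i);
             I = 1\<^sub>m m;
             e = (l i / (inverse (q i) - q i)) \<cdot>\<^sub>m ((T - q i \<cdot>\<^sub>m I) * (T + inverse (q i) \<cdot>\<^sub>m I))
         in (T - inverse (l i) \<cdot>\<^sub>m I) * (T - q i \<cdot>\<^sub>m I) * (T + inverse (q i) \<cdot>\<^sub>m I) = 0\<^sub>m m m \<and>
            vec_space.rank m e = 1))"
proof (rule generically_nonzero)
  let ?f = "\<lambda>x :: complex^4. resonance_factor \<kappa> (x $ 1) (x $ 3) * resonance_factor \<kappa> (x $ 2) (x $ 4)"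
  show "holo_on UNIV ?f"
    unfolding resonance_factor_def
    by (intro holo_on_mult holo_on_diff holo_on_exp holo_on_const holo_on_nth)
  \<comment> \<open>At this point \<open>\<kappa> k = 1/8\<close> and \<open>\<kappa> \<alpha> = 1/2\<close>, so the three exponentials are \<open>-1\<close>, \<open>\<i>\<close> and \<open>-\<i>\<close>.\<close>
  define x0 :: "complex^4" where "x0 = (\<chi> j. if j = 1 \<or> j = 2 then 1 / (8 * \<kappa>) else 1 / (2 * \<kappa>))"
  have "resonance_factor \<kappa> (1 / (8 * \<kappa>)) (1 / (2 * \<kappa>)) \<noteq> 0"
  proof -
    have "exp (of_real pi * \<i> / 2) = \<i>" using exp_Euler[of "pi / 2"]
      by (simp add: exp_eq_polar cis_conv_exp[symmetric] mult.commute)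
    moreover have "exp (- (of_real pi * \<i> / 2)) = - \<i>" using calculation by (simp add: exp_minus)
    ultimately show ?thesis using assms(3)
      by (simp add: resonance_factor_def complex_eq_iff)
  qed
  then show "?f x0 \<noteq> 0" by (simp add: x0_def)
next
  fix x :: "complex^4"
  define k where "k = by_parity (x $ 1) (x $ 2)"
  define \<alpha> where "\<alpha> = by_parity (x $ 3) (x $ 4)"
  define q where "q i = exp (\<kappa> * k i * of_real pi * \<i>)" for i
  define l where "l i = exp (\<kappa> * \<alpha> i * of_real pi * \<i>) / q i" for i
  assume "resonance_factor \<kappa> (x $ 1) (x $ 3) * resonance_factor \<kappa> (x $ 2) (x $ 4) \<noteq> 0"
  then have rf: "resonance_factor \<kappa> (k i) (\<alpha> i) \<noteq> 0" if "i \<in> {0, 1}" for i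
    using that by (auto simp: k_def \<alpha>_def by_parity_def)
  have main: "(T - inverse (l i) \<cdot>\<^sub>m 1\<^sub>m m) * (T - q i \<cdot>\<^sub>m 1\<^sub>m m) * (T + inverse (q i) \<cdot>\<^sub>m 1\<^sub>m m) = 0\<^sub>m m m \<and>
      vec_space.rank m ((l i / (inverse (q i) - q i)) \<cdot>\<^sub>m ((T - q i \<cdot>\<^sub>m 1\<^sub>m m) * (T + inverse (q i) \<cdot>\<^sub>m 1\<^sub>m m))) = 1"
    if i: "i \<in> {0, 1}" and \<tau>: "0 < \<tau>" "\<tau> < 1 / 2" and T_def: "T = lk_monodromy m \<kappa> k \<alpha> (sigma_path m p \<tau> i)" for i \<tau> T
  proof -
    have im: "i < m" using assms(1) i by auto
    note gen = resonance_factor_nonzero[OF rf[OF i]]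
    define t where "t = (\<lambda>s. reflection_sign m i s *
        exp (\<kappa> * (k i * reflection_sign m i s - (if s = i then \<alpha> i else 0)) * (\<i> * pi)))"
    note diag = lk_monodromy_diagonalizable[where a = "x $ 1" and b = "x $ 2" and a' = "x $ 3" and b' = "x $ 4",
        folded k_def \<alpha>_def, OF assms(1,2,4) i \<tau> gen]
    obtain X X' where X: "X \<in> carrier_mat m m" "X' \<in> carrier_mat m m" "X * X' = 1\<^sub>m m" "X' * X = 1\<^sub>m m"
      and T: "T = X * diagonal m t * X'"
      by (rule diag) (rule that[unfolded T_def t_def])
    note alg = conj_diagonal_algebra[OF X]
    define E where "E = exp (\<kappa> * \<alpha> i * of_real pi * \<i>)"
    have q0: "q i \<noteq> 0" and E0: "E \<noteq> 0" and l: "l i = E / q i" by (simp_all add: q_def E_def l_def)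
    have "E * E \<noteq> 1" "q i * q i * (q i * q i) \<noteq> 1" "q i * q i * (q i * q i) / (E * E) \<noteq> 1"
    proof -
      have e: "exp (2 * (\<kappa> * \<alpha> i) * of_real pi * \<i>) = E * E"
        "exp (2 * (2 * (\<kappa> * k i)) * of_real pi * \<i>) = q i * q i * (q i * q i)"
        by (simp_all add: E_def q_def exp_add[symmetric] algebra_simps)
      have "exp (2 * (2 * (\<kappa> * k i) - \<kappa> * \<alpha> i) * of_real pi * \<i>) = q i * q i * (q i * q i) / (E * E)"
        unfolding e[symmetric] exp_diff[symmetric] by (simp add: algebra_simps)
      then show "E * E \<noteq> 1" "q i * q i * (q i * q i) \<noteq> 1" "q i * q i * (q i * q i) / (E * E) \<noteq> 1"
        using rf[OF i] unfolding resonance_factor_def e by auto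
    qed
    then have ne: "inverse (q i) - q i \<noteq> 0" "inverse (l i) - q i \<noteq> 0" "inverse (l i) + inverse (q i) \<noteq> 0"
    proof -
      assume gE: "E * E \<noteq> 1" "q i * q i * (q i * q i) \<noteq> 1" "q i * q i * (q i * q i) / (E * E) \<noteq> 1"
      show "inverse (q i) - q i \<noteq> 0"
      proof
        assume "inverse (q i) - q i = 0"
        then have "q i * q i = 1" using q0 by (simp add: field_simps)
        then show False using gE(2) by simp
      qed
      show "inverse (l i) - q i \<noteq> 0"
      proof
        assume "inverse (l i) - q i = 0"
        then have "E = 1" using q0 E0 by (simp add: l field_simps)
        then show False using gE(1) by simp
      qed
      show "inverse (l i) + inverse (q i) \<noteq> 0"
      proof
        assume "inverse (l i) + inverse (q i) = 0"
        then have "q i * q i = - E" using q0 E0 by (simp add: l field_simps add_eq_0_iff)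
        then show False using gE(3) E0 by simp
      qed
    qed
    have ti: "t i = inverse (l i)"
    proof -
      have "reflection_sign m i i = 1"
        using act_idx_refl_self[OF _ im] assms(1) by (simp add: reflection_sign_def)
      then show ?thesis by (simp add: t_def l_def q_def exp_diff[symmetric] exp_minus[symmetric] algebra_simps)
    qed
    have ts: "t s = q i \<or> t s = - inverse (q i)" if "s \<noteq> i" for s
      using that by (auto simp: t_def q_def reflection_sign_def exp_minus[symmetric] mult_ac)
    have zero: "diagonal m (\<lambda>s. (t s - inverse (l i)) * (t s - q i) * (t s + inverse (q i))) = 0\<^sub>m m m"
    proof (rule eq_matI)
      fix r s assume "r < dim_row (0\<^sub>m m m :: complex mat)" "s < dim_col (0\<^sub>m m m :: complex mat)"
      then have rs: "r < m" "s < m" by auto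
      have "(t r - inverse (l i)) * (t r - q i) * (t r + inverse (q i)) = 0"
        using ti ts[of r] by (cases "r = i") auto
      then show "diagonal m (\<lambda>s. (t s - inverse (l i)) * (t s - q i) * (t s + inverse (q i))) $$ (r, s) =
          (0\<^sub>m m m :: complex mat) $$ (r, s)" using rs by (auto simp: diagonal_def)
    qed (auto simp: diagonal_def)
    have "(T - inverse (l i) \<cdot>\<^sub>m 1\<^sub>m m) * (T - q i \<cdot>\<^sub>m 1\<^sub>m m) * (T + inverse (q i) \<cdot>\<^sub>m 1\<^sub>m m) = 0\<^sub>m m m"
      unfolding T alg zero using X by simp
    moreover have "vec_space.rank m ((l i / (inverse (q i) - q i)) \<cdot>\<^sub>m ((T - q i \<cdot>\<^sub>m 1\<^sub>m m) * (T + inverse (q i) \<cdot>\<^sub>m 1\<^sub>m m))) = 1"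
      unfolding T alg
    proof (rule rank_conj_diagonal_single[OF X(1,2,4) im])
      have "l i \<noteq> 0" using q0 E0 by (simp add: l)
      then show "l i / (inverse (q i) - q i) * ((t i - q i) * (t i + inverse (q i))) \<noteq> 0"
        using ne by (simp add: ti)
      show "l i / (inverse (q i) - q i) * ((t s - q i) * (t s + inverse (q i))) = 0" if "s \<noteq> i" for s
        using ts[OF that] by auto
    qed
    ultimately show ?thesis by blast
  qed
  show "let k = by_parity (x $ 1) (x $ 2);
        \<alpha> = by_parity (x $ 3) (x $ 4);
        q = (\<lambda>i. exp (\<kappa> * k i * of_real pi * \<i>));
        l = (\<lambda>i. exp (\<kappa> * \<alpha> i * of_real pi * \<i>) / q i)
    in \<forall>i\<in>{0, 1}. \<forall>\<tau>::real. 0 < \<tau> \<and> \<tau> < 1/2 \<longrightarrow>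
        (let T = lk_monodromy m \<kappa> k \<alpha> (sigma_path m p \<tau> i);
             I = 1\<^sub>m m;
             e = (l i / (inverse (q i) - q i)) \<cdot>\<^sub>m ((T - q i \<cdot>\<^sub>m I) * (T + inverse (q i) \<cdot>\<^sub>m I))
         in (T - inverse (l i) \<cdot>\<^sub>m I) * (T - q i \<cdot>\<^sub>m I) * (T + inverse (q i) \<cdot>\<^sub>m I) = 0\<^sub>m m m \<and>
            vec_space.rank m e = 1)"
    using main unfolding Let_def k_def[symmetric] \<alpha>_def[symmetric] q_def[symmetric] l_def[symmetric] by blast
qed

end
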